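(* Let $k$ be a field, $G$ a (not necessarily finite) discrete group, and $k[G]$ its group algebra with its standard Hopf algebra structure. The category of (left-left) Yetter-Drinfeld modules over $k[G]$ is isomorphic to the category of functors from the groupoid $G\ltimes G$ into the category of $k$-modules.
   Context: The Hopf algebra structure on $k[G]$ is $\Delta(g)=g\otimes g$, $\varepsilon(g)=1$, $S(g)=g^{-1}$ for $g\in G$. A Yetter-Drinfeld module over a Hopf algebra $H$ is a left $H$-module and (coassociative, counital) left $H$-comodule $X$, coaction $x\mapsto x_{(-1)}\otimes x_{(0)}\in H\otimes X$, with $(hx)_{(-1)}\otimes (hx)_{(0)}=h_{(1)}x_{(-1)}S(h_{(3)})\otimes h_{(2)}x_{(0)}$ for all $h\in H$, $x\in X$. Morphisms are $k$-linear maps compatible with action and coaction. (Since $S^2=\mathrm{id}$ for $k[G]$, these are the same as anti-Yetter-Drinfeld modules, where $S$ is replaced by $S^{-1}$.) The groupoid $G\ltimes G$ has object set $G$ and morphism set $G\times G$; the morphism $(g,g')$ has source $g'$ and target $gg'g^{-1}$, and composition is given by group multiplication: $(h,gg'g^{-1})\circ(g,g')=(hg,g')$. Morphisms in the functor category are natural transformations. *)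

theory Defs
  imports Complex_Main "HOL-Library.Poly_Mapping" "HOL-Library.FuncSet"
begin

section \<open>Categories, functors, natural transformations\<close>

record ('o, 'm) category =
  ob :: "'o set"
  arr :: "'m set"
  dom :: "'m \<Rightarrow> 'o"
  cod :: "'m \<Rightarrow> 'o"
  ident :: "'o \<Rightarrow> 'm"
  comp :: "'m \<Rightarrow> 'm \<Rightarrow> 'm"

text \<open>
  The composite \<open>comp C g f\<close> (first \<open>f\<close>, then \<open>g\<close>) is only meaningful if \<open>cod C f = dom C g\<close>.
\<close>

definition is_category :: "('o, 'm) category \<Rightarrow> bool" where
  "is_category C \<longleftrightarrow>
     (\<forall>f\<in>arr C. dom C f \<in> ob C \<and> cod C f \<in> ob C) \<and>
     (\<forall>a\<in>ob C. ident C a \<in> arr C \<and> dom C (ident C a) = a \<and> cod C (ident C a) = a) \<and>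
     (\<forall>f\<in>arr C. \<forall>g\<in>arr C. cod C f = dom C g \<longrightarrow>
        comp C g f \<in> arr C \<and> dom C (comp C g f) = dom C f \<and> cod C (comp C g f) = cod C g) \<and>
     (\<forall>f\<in>arr C. comp C f (ident C (dom C f)) = f \<and> comp C (ident C (cod C f)) f = f) \<and>
     (\<forall>f\<in>arr C. \<forall>g\<in>arr C. \<forall>h\<in>arr C. cod C f = dom C g \<longrightarrow> cod C g = dom C h \<longrightarrow>
        comp C h (comp C g f) = comp C (comp C h g) f)"

record ('o, 'm, 'p, 'n) func =
  fob :: "'o \<Rightarrow> 'p"
  farr :: "'m \<Rightarrow> 'n"

text \<open>
  A functor is required to be \<open>undefined\<close> outside the objects and arrows of its source, so that
  equality of functors is the mathematical one.  The same convention is used below for natural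
  transformations, for the structure maps of modules and comodules, and for linear maps.
\<close>

definition is_functor ::
  "('o, 'm) category \<Rightarrow> ('p, 'n) category \<Rightarrow> ('o, 'm, 'p, 'n) func \<Rightarrow> bool" where
  "is_functor C D F \<longleftrightarrow>
     fob F \<in> ob C \<rightarrow>\<^sub>E ob D \<and>
     farr F \<in> arr C \<rightarrow>\<^sub>E arr D \<and>
     (\<forall>f\<in>arr C. dom D (farr F f) = fob F (dom C f) \<and> cod D (farr F f) = fob F (cod C f)) \<and>
     (\<forall>a\<in>ob C. farr F (ident C a) = ident D (fob F a)) \<and>
     (\<forall>f\<in>arr C. \<forall>g\<in>arr C. cod C f = dom C g \<longrightarrow>
        farr F (comp C g f) = comp D (farr F g) (farr F f))"

definition is_nat_trans ::
  "('o, 'm) category \<Rightarrow> ('p, 'n) category \<Rightarrow>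
   ('o, 'm, 'p, 'n) func \<Rightarrow> ('o \<Rightarrow> 'n) \<Rightarrow> ('o, 'm, 'p, 'n) func \<Rightarrow> bool" where
  "is_nat_trans C D F \<eta> F' \<longleftrightarrow>
     is_functor C D F \<and> is_functor C D F' \<and>
     \<eta> \<in> ob C \<rightarrow>\<^sub>E arr D \<and>
     (\<forall>a\<in>ob C. dom D (\<eta> a) = fob F a \<and> cod D (\<eta> a) = fob F' a) \<and>
     (\<forall>f\<in>arr C. comp D (\<eta> (cod C f)) (farr F f) = comp D (farr F' f) (\<eta> (dom C f)))"

definition functor_category ::
  "('o, 'm) category \<Rightarrow> ('p, 'n) category \<Rightarrow>
   (('o, 'm, 'p, 'n) func, ('o, 'm, 'p, 'n) func \<times> ('o \<Rightarrow> 'n) \<times> ('o, 'm, 'p, 'n) func) category"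
where
  "functor_category C D =
     \<lparr> ob = {F. is_functor C D F},
       arr = {(F, \<eta>, F'). is_nat_trans C D F \<eta> F'},
       dom = (\<lambda>(F, \<eta>, F'). F),
       cod = (\<lambda>(F, \<eta>, F'). F'),
       ident = (\<lambda>F. (F, \<lambda>a\<in>ob C. ident D (fob F a), F)),
       comp = (\<lambda>(F', \<theta>, F'') (F, \<eta>, G). (F, \<lambda>a\<in>ob C. comp D (\<theta> a) (\<eta> a), F'')) \<rparr>"

text \<open>Isomorphism of categories in the strict sense: mutually inverse functors.\<close>

definition isomorphic_categories :: "('o, 'm) category \<Rightarrow> ('p, 'n) category \<Rightarrow> bool" where
  "isomorphic_categories C D \<longleftrightarrow>
     is_category C \<and> is_category D \<and>
     (\<exists>F F'. is_functor C D F \<and> is_functor D C F' \<and>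
        (\<forall>a\<in>ob C. fob F' (fob F a) = a) \<and> (\<forall>f\<in>arr C. farr F' (farr F f) = f) \<and>
        (\<forall>b\<in>ob D. fob F (fob F' b) = b) \<and> (\<forall>g\<in>arr D. farr F (farr F' g) = g))"


section \<open>Modules over a field and their category\<close>

record ('k, 'v) kmod =
  car :: "'v set"
  vadd :: "'v \<Rightarrow> 'v \<Rightarrow> 'v"
  vzero :: 'v
  vsmult :: "'k \<Rightarrow> 'v \<Rightarrow> 'v"

definition kmodule :: "('k::field, 'v, 'z) kmod_scheme \<Rightarrow> bool" where
  "kmodule V \<longleftrightarrow>
     vzero V \<in> car V \<and>
     (\<forall>x\<in>car V. \<forall>y\<in>car V. vadd V x y \<in> car V) \<and>
     (\<forall>x\<in>car V. \<forall>y\<in>car V. \<forall>z\<in>car V. vadd V (vadd V x y) z = vadd V x (vadd V y z)) \<and>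
     (\<forall>x\<in>car V. \<forall>y\<in>car V. vadd V x y = vadd V y x) \<and>
     (\<forall>x\<in>car V. vadd V (vzero V) x = x) \<and>
     (\<forall>x\<in>car V. \<exists>y\<in>car V. vadd V x y = vzero V) \<and>
     (\<forall>c. \<forall>x\<in>car V. vsmult V c x \<in> car V) \<and>
     (\<forall>c. \<forall>x\<in>car V. \<forall>y\<in>car V. vsmult V c (vadd V x y) = vadd V (vsmult V c x) (vsmult V c y)) \<and>
     (\<forall>c d. \<forall>x\<in>car V. vsmult V (c + d) x = vadd V (vsmult V c x) (vsmult V d x)) \<and>
     (\<forall>c d. \<forall>x\<in>car V. vsmult V (c * d) x = vsmult V c (vsmult V d x)) \<and>
     (\<forall>x\<in>car V. vsmult V 1 x = x)"

definition ext_kmodule :: "('k::field, 'v, 'z) kmod_scheme \<Rightarrow> bool" where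
  "ext_kmodule V \<longleftrightarrow> kmodule V \<and>
     (\<forall>x y. \<not> (x \<in> car V \<and> y \<in> car V) \<longrightarrow> vadd V x y = undefined) \<and>
     (\<forall>c. vsmult V c \<in> extensional (car V))"

definition klinear ::
  "('k::field, 'v, 'y) kmod_scheme \<Rightarrow> ('k, 'w, 'z) kmod_scheme \<Rightarrow> ('v \<Rightarrow> 'w) \<Rightarrow> bool" where
  "klinear V W f \<longleftrightarrow>
     f \<in> car V \<rightarrow>\<^sub>E car W \<and>
     (\<forall>x\<in>car V. \<forall>y\<in>car V. f (vadd V x y) = vadd W (f x) (f y)) \<and>
     (\<forall>c. \<forall>x\<in>car V. f (vsmult V c x) = vsmult W c (f x))"

text \<open>
  HOL has no type of all sets, so the category of \<open>k\<close>-modules is the one of all \<open>k\<close>-modules whose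
  underlying set is contained in the type \<open>'v\<close>, which plays the role of a universe.  For direct sums over a group
  \<open>'g\<close> to exist, the universe must be closed under \<open>'g\<close>-indexed products, i.e. there must be an
  injection from \<open>'g \<Rightarrow> 'v\<close> into \<open>'v\<close>.
\<close>

definition kmod_category ::
  "(('k::field, 'v) kmod, ('k, 'v) kmod \<times> ('v \<Rightarrow> 'v) \<times> ('k, 'v) kmod) category" where
  "kmod_category =
     \<lparr> ob = {V. ext_kmodule V},
       arr = {(V, f, W). ext_kmodule V \<and> ext_kmodule W \<and> klinear V W f},
       dom = (\<lambda>(V, f, W). V),
       cod = (\<lambda>(V, f, W). W),
       ident = (\<lambda>V. (V, \<lambda>x\<in>car V. x, V)),
       comp = (\<lambda>(W, g, Z) (V, f, W'). (V, compose (car V) g f, Z)) \<rparr>"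


section \<open>Tensor products\<close>

text \<open>
  \<open>V \<otimes> W\<close> is the quotient of the free module on \<open>V \<times> W\<close>, realised as the formal linear
  combinations \<open>'v \<times> 'w \<Rightarrow>\<^sub>0 'k\<close> supported in \<open>car V \<times> car W\<close>, by the span of the
  bilinearity relations.
\<close>

definition pm_scale :: "'k::field \<Rightarrow> ('b \<Rightarrow>\<^sub>0 'k) \<Rightarrow> ('b \<Rightarrow>\<^sub>0 'k)" where
  "pm_scale c p = Poly_Mapping.map ((*) c) p"

lemma lookup_pm_scale [simp]: "Poly_Mapping.lookup (pm_scale c p) b = c * Poly_Mapping.lookup p b"
  by (simp add: pm_scale_def Poly_Mapping.map.rep_eq when_def)

interpretation pm: vector_space "pm_scale :: 'k::field \<Rightarrow> ('b \<Rightarrow>\<^sub>0 'k) \<Rightarrow> _"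
  by unfold_locales (auto intro!: poly_mapping_eqI simp: lookup_add algebra_simps)

definition bilinear_relators ::
  "('k::field, 'v, 'y) kmod_scheme \<Rightarrow> ('k, 'w, 'z) kmod_scheme \<Rightarrow> ('v \<times> 'w \<Rightarrow>\<^sub>0 'k) set" where
  "bilinear_relators V W =
     {Poly_Mapping.single (vadd V a a', b) 1 - Poly_Mapping.single (a, b) 1
        - Poly_Mapping.single (a', b) 1 | a a' b. a \<in> car V \<and> a' \<in> car V \<and> b \<in> car W} \<union>
     {Poly_Mapping.single (a, vadd W b b') 1 - Poly_Mapping.single (a, b) 1
        - Poly_Mapping.single (a, b') 1 | a b b'. a \<in> car V \<and> b \<in> car W \<and> b' \<in> car W} \<union>
     {Poly_Mapping.single (vsmult V c a, b) 1 - Poly_Mapping.single (a, b) c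
        | c a b. a \<in> car V \<and> b \<in> car W} \<union>
     {Poly_Mapping.single (a, vsmult W c b) 1 - Poly_Mapping.single (a, b) c
        | c a b. a \<in> car V \<and> b \<in> car W}"

definition tensor_class ::
  "('k::field, 'v, 'y) kmod_scheme \<Rightarrow> ('k, 'w, 'z) kmod_scheme \<Rightarrow>
   ('v \<times> 'w \<Rightarrow>\<^sub>0 'k) \<Rightarrow> ('v \<times> 'w \<Rightarrow>\<^sub>0 'k) set" where
  "tensor_class V W p =
     {q. Poly_Mapping.keys q \<subseteq> car V \<times> car W \<and> q - p \<in> pm.span (bilinear_relators V W)}"

definition tensor ::
  "('k::field, 'v, 'y) kmod_scheme \<Rightarrow> ('k, 'w, 'z) kmod_scheme \<Rightarrow>
   ('k, ('v \<times> 'w \<Rightarrow>\<^sub>0 'k) set) kmod" where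
  "tensor V W =
     \<lparr> car = tensor_class V W ` {p. Poly_Mapping.keys p \<subseteq> car V \<times> car W},
       vadd = (\<lambda>s t. tensor_class V W ((SOME p. p \<in> s) + (SOME q. q \<in> t))),
       vzero = tensor_class V W 0,
       vsmult = (\<lambda>c t. tensor_class V W (pm_scale c (SOME p. p \<in> t))) \<rparr>"

definition pure ::
  "('k::field, 'v, 'y) kmod_scheme \<Rightarrow> ('k, 'w, 'z) kmod_scheme \<Rightarrow>
   'v \<Rightarrow> 'w \<Rightarrow> ('v \<times> 'w \<Rightarrow>\<^sub>0 'k) set" where
  "pure V W a b = tensor_class V W (Poly_Mapping.single (a, b) 1)"

text \<open>
  The linear map \<open>V \<otimes> W \<rightarrow> U\<close> induced by a bilinear map \<open>\<beta>\<close>.  It expresses Sweedler notation: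
  for \<open>t = \<Sum> t\<^sub>1 \<otimes> t\<^sub>2\<close>, the value \<open>tensor_lift V W U \<beta> t\<close> is \<open>\<Sum> \<beta> t\<^sub>1 t\<^sub>2\<close>.
\<close>

definition tensor_lift ::
  "('k::field, 'v, 'x) kmod_scheme \<Rightarrow> ('k, 'w, 'y) kmod_scheme \<Rightarrow> ('k, 'u, 'z) kmod_scheme \<Rightarrow>
   ('v \<Rightarrow> 'w \<Rightarrow> 'u) \<Rightarrow> ('v \<times> 'w \<Rightarrow>\<^sub>0 'k) set \<Rightarrow> 'u" where
  "tensor_lift V W U \<beta> =
     (THE f. klinear (tensor V W) U f \<and>
        (\<forall>a\<in>car V. \<forall>b\<in>car W. f (pure V W a b) = \<beta> a b))"


section \<open>Yetter-Drinfeld modules\<close>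

text \<open>
  The data of a Hopf algebra over \<open>'k\<close>; its underlying ring is the type \<open>'h\<close>.
\<close>

record (overloaded) ('k::zero, 'h) hopf =
  hscale :: "'k \<Rightarrow> 'h \<Rightarrow> 'h"
  comult :: "'h \<Rightarrow> ('h \<times> 'h \<Rightarrow>\<^sub>0 'k) set"
  counit :: "'h \<Rightarrow> 'k"
  antipode :: "'h \<Rightarrow> 'h"

definition hmod :: "('k::field, 'h::ring_1) hopf \<Rightarrow> ('k, 'h) kmod" where
  "hmod H = \<lparr> car = UNIV, vadd = (+), vzero = 0, vsmult = hscale H \<rparr>"

record (overloaded) ('k::zero, 'h, 'v) ydmod = "('k, 'v) kmod" +
  act :: "'h \<Rightarrow> 'v \<Rightarrow> 'v"
  coact :: "'v \<Rightarrow> ('h \<times> 'v \<Rightarrow>\<^sub>0 'k) set"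

definition left_module :: "('k::field, 'h::ring_1) hopf \<Rightarrow> ('k, 'h, 'v) ydmod \<Rightarrow> bool" where
  "left_module H X \<longleftrightarrow>
     (\<forall>h. klinear X X (act X h)) \<and>
     (\<forall>h h'. \<forall>x\<in>car X. act X (h + h') x = vadd X (act X h x) (act X h' x)) \<and>
     (\<forall>c h. \<forall>x\<in>car X. act X (hscale H c h) x = vsmult X c (act X h x)) \<and>
     (\<forall>x\<in>car X. act X 1 x = x) \<and>
     (\<forall>h h'. \<forall>x\<in>car X. act X (h * h') x = act X h (act X h' x))"

text \<open>
  Coassociativity is stated in \<open>H \<otimes> (H \<otimes> X)\<close>: \<open>(id \<otimes> \<delta>)(\<delta> x)\<close> equals the image of
  \<open>(\<Delta> \<otimes> id)(\<delta> x)\<close> under the associator \<open>(a \<otimes> b) \<otimes> y \<mapsto> a \<otimes> (b \<otimes> y)\<close>.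
\<close>

definition left_comodule :: "('k::field, 'h::ring_1) hopf \<Rightarrow> ('k, 'h, 'v) ydmod \<Rightarrow> bool" where
  "left_comodule H X \<longleftrightarrow>
     (let A = hmod H; AX = tensor A X; AAX = tensor A AX in
       klinear X AX (coact X) \<and>
       (\<forall>x\<in>car X. tensor_lift A X X (\<lambda>h y. vsmult X (counit H h) y) (coact X x) = x) \<and>
       (\<forall>x\<in>car X.
          tensor_lift A X AAX (\<lambda>h y. pure A AX h (coact X y)) (coact X x) =
          tensor_lift A X AAX
            (\<lambda>h y. tensor_lift A A AAX (\<lambda>a b. pure A AX a (pure A X b y)) (comult H h))
            (coact X x)))"

text \<open>
  \<open>\<delta> (h x) = h1 a S(h3) \<otimes> h2 y\<close> in Sweedler notation, where \<open>\<delta> x = a \<otimes> y\<close> and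
  \<open>(id \<otimes> \<Delta>)(\<Delta> h) = h1 \<otimes> h2 \<otimes> h3\<close>, that is, \<open>\<Delta> h = h1 \<otimes> h'\<close> and \<open>\<Delta> h' = h2 \<otimes> h3\<close>.
\<close>

definition yd_compatible :: "('k::field, 'h::ring_1) hopf \<Rightarrow> ('k, 'h, 'v) ydmod \<Rightarrow> bool" where
  "yd_compatible H X \<longleftrightarrow>
     (let A = hmod H; AX = tensor A X in
       \<forall>h. \<forall>x\<in>car X.
         coact X (act X h x) =
         tensor_lift A A AX
           (\<lambda>h1 h'. tensor_lift A A AX
              (\<lambda>h2 h3. tensor_lift A X AX
                 (\<lambda>a y. pure A X (h1 * a * antipode H h3) (act X h2 y))
                 (coact X x))
              (comult H h'))
           (comult H h))"

definition yd_module :: "('k::field, 'h::ring_1) hopf \<Rightarrow> ('k, 'h, 'v) ydmod \<Rightarrow> bool" where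
  "yd_module H X \<longleftrightarrow>
     ext_kmodule X \<and> left_module H X \<and> left_comodule H X \<and> yd_compatible H X"

definition yd_morphism ::
  "('k::field, 'h::ring_1) hopf \<Rightarrow> ('k, 'h, 'v) ydmod \<Rightarrow> ('k, 'h, 'v) ydmod \<Rightarrow> ('v \<Rightarrow> 'v) \<Rightarrow> bool"
where
  "yd_morphism H X Y f \<longleftrightarrow>
     klinear X Y f \<and>
     (\<forall>h. \<forall>x\<in>car X. f (act X h x) = act Y h (f x)) \<and>
     (\<forall>x\<in>car X.
        tensor_lift (hmod H) X (tensor (hmod H) Y) (\<lambda>h y. pure (hmod H) Y h (f y)) (coact X x) =
        coact Y (f x))"

definition yd_category ::
  "('k::field, 'h::ring_1) hopf \<Rightarrow>
   (('k, 'h, 'v) ydmod, ('k, 'h, 'v) ydmod \<times> ('v \<Rightarrow> 'v) \<times> ('k, 'h, 'v) ydmod) category" where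
  "yd_category H =
     \<lparr> ob = {X. yd_module H X},
       arr = {(X, f, Y). yd_module H X \<and> yd_module H Y \<and> yd_morphism H X Y f},
       dom = (\<lambda>(X, f, Y). X),
       cod = (\<lambda>(X, f, Y). Y),
       ident = (\<lambda>X. (X, \<lambda>x\<in>car X. x, X)),
       comp = (\<lambda>(Y, g, Z) (X, f, Y'). (X, compose (car X) g f, Z)) \<rparr>"


section \<open>The group algebra and the conjugation groupoid\<close>

text \<open>
  Groups are types of class \<open>group_add\<close>: the group law is written additively but need not be
  commutative.  The group algebra \<open>k[G]\<close> is the type \<open>'g \<Rightarrow>\<^sub>0 'k\<close> with the convolution product of
  the library, in which \<open>Poly_Mapping.single g 1\<close> is the basis element \<open>g\<close>.  The structure maps
  below are the linear extensions of \<open>g \<mapsto> g \<otimes> g\<close>, \<open>g \<mapsto> 1\<close> and \<open>g \<mapsto> g\<^sup>-\<^sup>1\<close>.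
\<close>

definition kG_module :: "('k::field, 'g::group_add \<Rightarrow>\<^sub>0 'k) kmod" where
  "kG_module = \<lparr> car = UNIV, vadd = (+), vzero = 0, vsmult = pm_scale \<rparr>"

definition group_hopf :: "('k::field, 'g::group_add \<Rightarrow>\<^sub>0 'k) hopf" where
  "group_hopf =
     \<lparr> hscale = pm_scale,
       comult = (\<lambda>a. tensor_class kG_module kG_module
          (\<Sum>g\<in>Poly_Mapping.keys a. Poly_Mapping.single
             (Poly_Mapping.single g 1, Poly_Mapping.single g 1) (Poly_Mapping.lookup a g))),
       counit = (\<lambda>a. \<Sum>g\<in>Poly_Mapping.keys a. Poly_Mapping.lookup a g),
       antipode = (\<lambda>a. \<Sum>g\<in>Poly_Mapping.keys a. Poly_Mapping.single (- g) (Poly_Mapping.lookup a g)) \<rparr>"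

lemma hmod_group_hopf: "hmod group_hopf = kG_module"
  by (simp add: hmod_def group_hopf_def kG_module_def)

text \<open>The arrow \<open>(g, g')\<close> goes from \<open>g'\<close> to \<open>g g' g\<^sup>-\<^sup>1\<close>.\<close>

definition conj_groupoid :: "('g::group_add, 'g \<times> 'g) category" where
  "conj_groupoid =
     \<lparr> ob = UNIV,
       arr = UNIV,
       dom = (\<lambda>(g, g'). g'),
       cod = (\<lambda>(g, g'). g + g' - g),
       ident = (\<lambda>g'. (0, g')),
       comp = (\<lambda>(h, h') (g, g'). (h + g, g')) \<rparr>"

lemma is_category_conj_groupoid: "is_category conj_groupoid"
  by (auto simp: is_category_def conj_groupoid_def add.assoc diff_conv_add_uminus minus_add
      simp del: add_uminus_conv_diff)

end

(*
  A Yetter-Drinfeld module over k[G] is a G-graded module X = (+) X_g on which h maps X_g to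
  X_{h g h^-1}, so X |-> (X_g)_g is an equivalence onto the functor category, with quasi-inverse the
  direct sum.  Isomorphism of categories, with equality on objects, additionally needs the
  isomorphism classes on both sides to be equally numerous.  By a Cantor-Schroeder-Bernstein
  argument it suffices to map objects injectively in both directions into the right isomorphism
  class.  A functor is recovered from its direct sum formed inside the universe 'v.  Conversely,
  X is determined by the functor (X_g)_g and the elements of 'v that name the finite sums of
  homogeneous elements; there are no more such families of names than families indexed by the
  homogeneous elements, so they can be recorded by renaming the elements of the X_g.
*)

theory Submission
  imports Defs "HOL-Algebra.FiniteProduct"
begin

section \<open>Modules and linear maps\<close>

text \<open>A tensor is a class of formal combinations, so equality of tensors is hard to inspect
  directly. The way around this is the family of maps \<open>coef X g\<close>: an element of k[G]
  \<otimes> X is determined by these coefficients, and coassociativity, counitality, compatibility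
  and colinearity all become equations inside X between the maps \<open>gr X g\<close> and
  \<open>rho X g\<close>.

  The Cantor-Schroeder-Bernstein bijection must send X to an object isomorphic to
  \<open>components X\<close>. A bare bijection would not do; its piecewise description in terms of
  the two injections is what supplies the isomorphisms. Conjugating arrows by chosen isomorphisms
  then turns the full and faithful functor into a strict isomorphism.

  Recording names inside renamed elements takes a pairing on 'v. The universe hypothesis yields one
  from two distinct elements of G and says nothing for the trivial group, where every element is
  homogeneous and there are no further names to record. Hence the case distinction on G.\<close>

lemma kmod_zero [simp]: "kmodule V \<Longrightarrow> vzero V \<in> car V"
  and kmod_add [simp]: "kmodule V \<Longrightarrow> x \<in> car V \<Longrightarrow> y \<in> car V \<Longrightarrow> vadd V x y \<in> car V"
  and kmod_smult [simp]: "kmodule V \<Longrightarrow> x \<in> car V \<Longrightarrow> vsmult V c x \<in> car V"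
  and kmod_zero_left [simp]: "kmodule V \<Longrightarrow> x \<in> car V \<Longrightarrow> vadd V (vzero V) x = x"
  and kmod_one [simp]: "kmodule V \<Longrightarrow> x \<in> car V \<Longrightarrow> vsmult V 1 x = x"
  by (auto simp: kmodule_def)

lemma kmod_assoc: "kmodule V \<Longrightarrow> x \<in> car V \<Longrightarrow> y \<in> car V \<Longrightarrow> z \<in> car V \<Longrightarrow>
    vadd V (vadd V x y) z = vadd V x (vadd V y z)"
  and kmod_comm: "kmodule V \<Longrightarrow> x \<in> car V \<Longrightarrow> y \<in> car V \<Longrightarrow> vadd V x y = vadd V y x"
  and kmod_inverse: "kmodule V \<Longrightarrow> x \<in> car V \<Longrightarrow> \<exists>y\<in>car V. vadd V x y = vzero V"
  and kmod_smult_add: "kmodule V \<Longrightarrow> x \<in> car V \<Longrightarrow> y \<in> car V \<Longrightarrow>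
    vsmult V c (vadd V x y) = vadd V (vsmult V c x) (vsmult V c y)"
  and kmod_add_smult: "kmodule V \<Longrightarrow> x \<in> car V \<Longrightarrow>
    vsmult V (c + d) x = vadd V (vsmult V c x) (vsmult V d x)"
  and kmod_mult_smult: "kmodule V \<Longrightarrow> x \<in> car V \<Longrightarrow>
    vsmult V (c * d) x = vsmult V c (vsmult V d x)"
  unfolding kmodule_def by blast+

lemma kmod_zero_right [simp]: "kmodule V \<Longrightarrow> x \<in> car V \<Longrightarrow> vadd V x (vzero V) = x"
  by (metis kmod_comm kmod_zero kmod_zero_left)

lemma kmod_lcomm: "kmodule V \<Longrightarrow> x \<in> car V \<Longrightarrow> y \<in> car V \<Longrightarrow> z \<in> car V \<Longrightarrow>
    vadd V x (vadd V y z) = vadd V y (vadd V x z)"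
  by (metis kmod_assoc kmod_comm)

text \<open>Inverses are only asserted to exist, so identities such as 0 x = 0 are derived by
  cancelling in x + x = x.\<close>

lemma kmod_idem:
  assumes "kmodule V" "x \<in> car V" "vadd V x x = x"
  shows "x = vzero V"
  by (metis assms kmod_assoc kmod_inverse kmod_zero_right)

lemma kmod_0_smult [simp]:
  assumes "kmodule V" "x \<in> car V"
  shows "vsmult V 0 x = vzero V"
  by (rule kmod_idem) (use assms in \<open>auto simp flip: kmod_add_smult\<close>)

lemma kmod_smult_zero [simp]:
  assumes "kmodule V"
  shows "vsmult V c (vzero V) = vzero V"
  by (rule kmod_idem) (use assms in \<open>auto simp flip: kmod_smult_add\<close>)

lemma kmod_minus [simp]:
  assumes "kmodule V" "x \<in> car V"
  shows "vadd V x (vsmult V (- 1) x) = vzero V"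
  using kmod_add_smult[OF assms, of 1 "-1"] assms by simp

lemma kmod_minus_left [simp]:
  assumes "kmodule V" "x \<in> car V"
  shows "vadd V (vsmult V (- 1) x) x = vzero V"
  using kmod_minus[OF assms] assms kmod_comm[of V x "vsmult V (-1) x"] by simp

lemma kmod_cancel:
  assumes "kmodule V" "x \<in> car V" "y \<in> car V" "z \<in> car V" "vadd V z x = vadd V z y"
  shows "x = y"
  by (metis assms kmod_assoc kmod_minus_left kmod_smult kmod_zero_left)

text \<open>Linearity without the extensionality clause of \<open>klinear\<close>, so that lambda
  terms and compositions qualify without being restricted to the carrier.\<close>

definition lin_on ::
  "('k::field, 'v, 'y) kmod_scheme \<Rightarrow> ('k, 'w, 'z) kmod_scheme \<Rightarrow> ('v \<Rightarrow> 'w) \<Rightarrow> bool" where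
  "lin_on V W f \<longleftrightarrow>
     (\<forall>x\<in>car V. f x \<in> car W) \<and>
     (\<forall>x\<in>car V. \<forall>y\<in>car V. f (vadd V x y) = vadd W (f x) (f y)) \<and>
     (\<forall>c. \<forall>x\<in>car V. f (vsmult V c x) = vsmult W c (f x))"

lemma klinear_iff_lin_on: "klinear V W f \<longleftrightarrow> lin_on V W f \<and> f \<in> extensional (car V)"
  by (auto simp: klinear_def lin_on_def PiE_def Pi_def)

lemma klinear_lin_on: "klinear V W f \<Longrightarrow> lin_on V W f"
  by (simp add: klinear_iff_lin_on)

lemma lin_on_cong:
  assumes "kmodule V" "\<And>x. x \<in> car V \<Longrightarrow> f x = g x"
  shows "lin_on V W f \<longleftrightarrow> lin_on V W g"
  using assms by (auto simp: lin_on_def)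

lemma klinear_restrict: "kmodule V \<Longrightarrow> klinear V W (restrict f (car V)) \<longleftrightarrow> lin_on V W f"
  by (auto simp: klinear_iff_lin_on cong: lin_on_cong)

lemma lin_on_closed: "lin_on V W f \<Longrightarrow> x \<in> car V \<Longrightarrow> f x \<in> car W"
  and lin_on_add: "lin_on V W f \<Longrightarrow> x \<in> car V \<Longrightarrow> y \<in> car V \<Longrightarrow>
    f (vadd V x y) = vadd W (f x) (f y)"
  and lin_on_smult: "lin_on V W f \<Longrightarrow> x \<in> car V \<Longrightarrow> f (vsmult V c x) = vsmult W c (f x)"
  by (auto simp: lin_on_def)

lemma lin_on_zero: "lin_on V W f \<Longrightarrow> kmodule V \<Longrightarrow> kmodule W \<Longrightarrow> f (vzero V) = vzero W"
  by (metis kmod_0_smult kmod_zero lin_on_closed lin_on_smult)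

lemma lin_onI:
  assumes "\<And>x. x \<in> car V \<Longrightarrow> f x \<in> car W"
    and "\<And>x y. x \<in> car V \<Longrightarrow> y \<in> car V \<Longrightarrow> f (vadd V x y) = vadd W (f x) (f y)"
    and "\<And>c x. x \<in> car V \<Longrightarrow> f (vsmult V c x) = vsmult W c (f x)"
  shows "lin_on V W f"
  using assms by (auto simp: lin_on_def)

lemma lin_on_comp: "lin_on V W f \<Longrightarrow> lin_on W U g \<Longrightarrow> lin_on V U (\<lambda>x. g (f x))"
  by (auto simp: lin_on_def)

lemma lin_on_id: "lin_on V V (\<lambda>x. x)"
  by (auto simp: lin_on_def)

lemma lin_on_const_zero: "kmodule W \<Longrightarrow> lin_on V W (\<lambda>x. vzero W)"
  by (auto simp: lin_on_def)

lemma lin_on_plus: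
  assumes "kmodule W" "lin_on V W f" "lin_on V W g"
  shows "lin_on V W (\<lambda>x. vadd W (f x) (g x))"
  using assms by (auto simp: lin_on_def kmod_smult_add kmod_assoc kmod_lcomm)

lemma lin_on_scale:
  assumes "kmodule W" "lin_on V W f"
  shows "lin_on V W (\<lambda>x. vsmult W c (f x))"
  using assms
  by (auto simp: lin_on_def kmod_smult_add simp flip: kmod_mult_smult) (simp add: mult.commute)

definition bilin ::
  "('k::field, 'v, 'x) kmod_scheme \<Rightarrow> ('k, 'w, 'y) kmod_scheme \<Rightarrow> ('k, 'u, 'z) kmod_scheme \<Rightarrow>
   ('v \<Rightarrow> 'w \<Rightarrow> 'u) \<Rightarrow> bool" where
  "bilin V W U \<beta> \<longleftrightarrow>
     (\<forall>b\<in>car W. lin_on V U (\<lambda>a. \<beta> a b)) \<and> (\<forall>a\<in>car V. lin_on W U (\<beta> a))"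

lemma bilinI:
  assumes "\<And>b. b \<in> car W \<Longrightarrow> lin_on V U (\<lambda>a. \<beta> a b)" "\<And>a. a \<in> car V \<Longrightarrow> lin_on W U (\<beta> a)"
  shows "bilin V W U \<beta>"
  using assms by (simp add: bilin_def)


section \<open>Linear extension from a basis\<close>

text \<open>Addition is a record field rather than a type class operation, so finite sums are taken
  as \<open>finprod\<close> in this monoid.\<close>

definition add_monoid_of :: "('k, 'u, 'z) kmod_scheme \<Rightarrow> 'u monoid" where
  "add_monoid_of U = \<lparr>carrier = car U, monoid.mult = vadd U, one = vzero U\<rparr>"

lemma add_monoid_of_simps [simp]:
  "carrier (add_monoid_of U) = car U"
  "monoid.mult (add_monoid_of U) = vadd U"
  "one (add_monoid_of U) = vzero U"
  by (simp_all add: add_monoid_of_def)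

lemma comm_monoid_add_monoid_of: "kmodule U \<Longrightarrow> comm_monoid (add_monoid_of U)"
  by (rule comm_monoidI) (simp_all add: kmod_assoc, metis kmod_comm)

definition lin_ext :: "('k::field, 'u, 'z) kmod_scheme \<Rightarrow> ('b \<Rightarrow> 'u) \<Rightarrow> ('b \<Rightarrow>\<^sub>0 'k) \<Rightarrow> 'u" where
  "lin_ext U \<beta> p = finprod (add_monoid_of U)
     (\<lambda>b. vsmult U (Poly_Mapping.lookup p b) (\<beta> b)) (Poly_Mapping.keys p)"

context
  fixes U :: "('k::field, 'u, 'z) kmod_scheme" and \<beta> :: "'b \<Rightarrow> 'u" and B
  assumes U: "kmodule U" and \<beta>: "\<And>b. b \<in> B \<Longrightarrow> \<beta> b \<in> car U"
begin

interpretation comm_monoid "add_monoid_of U"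
  by (rule comm_monoid_add_monoid_of[OF U])

text \<open>Keys outside the support contribute zero; combinations with different supports can
  therefore be summed over one common index set.\<close>

lemma lin_ext_superset:
  assumes "finite S" "Poly_Mapping.keys p \<subseteq> S" "S \<subseteq> B"
  shows "lin_ext U \<beta> p =
    finprod (add_monoid_of U) (\<lambda>b. vsmult U (Poly_Mapping.lookup p b) (\<beta> b)) S"
  unfolding lin_ext_def
  by (rule finprod_mono_neutral_cong_left)
    (use assms U \<beta> in \<open>auto simp: Pi_def in_keys_iff\<close>)

lemma lin_ext_closed: "Poly_Mapping.keys p \<subseteq> B \<Longrightarrow> lin_ext U \<beta> p \<in> car U"
  unfolding lin_ext_def using finprod_closed[of "\<lambda>b. vsmult U (Poly_Mapping.lookup p b) (\<beta> b)" "Poly_Mapping.keys p"] U \<beta>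
  by (simp add: Pi_def subset_iff)

lemma lin_ext_add:
  assumes "Poly_Mapping.keys p \<subseteq> B" "Poly_Mapping.keys q \<subseteq> B"
  shows "lin_ext U \<beta> (p + q) = vadd U (lin_ext U \<beta> p) (lin_ext U \<beta> q)"
proof -
  define S where "S = Poly_Mapping.keys p \<union> Poly_Mapping.keys q"
  have S: "finite S" "S \<subseteq> B" "Poly_Mapping.keys (p + q) \<subseteq> S" "Poly_Mapping.keys p \<subseteq> S"
    "Poly_Mapping.keys q \<subseteq> S"
    using assms keys_add[of p q] by (auto simp: S_def)
  have *: "(\<lambda>b. vsmult U (Poly_Mapping.lookup r b) (\<beta> b)) \<in> S \<rightarrow> car U" for r
    using S U \<beta> by auto
  have "lin_ext U \<beta> (p + q) =
    finprod (add_monoid_of U) (\<lambda>b. vadd U (vsmult U (Poly_Mapping.lookup p b) (\<beta> b))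
      (vsmult U (Poly_Mapping.lookup q b) (\<beta> b))) S"
    using lin_ext_superset[OF S(1,3,2)]
    by (simp, intro finprod_cong') (use S U \<beta> in \<open>auto simp: lookup_add kmod_add_smult\<close>)
  also have "\<dots> = vadd U (lin_ext U \<beta> p) (lin_ext U \<beta> q)"
    using finprod_multf[of "\<lambda>b. vsmult U (Poly_Mapping.lookup p b) (\<beta> b)" S
        "\<lambda>b. vsmult U (Poly_Mapping.lookup q b) (\<beta> b)"] *
      lin_ext_superset[OF S(1,4,2)] lin_ext_superset[OF S(1,5,2)] by simp
  finally show ?thesis .
qed

lemma lin_ext_zero: "lin_ext U \<beta> 0 = vzero U"
  using finprod_empty by (simp add: lin_ext_def)

lemma lin_ext_single:
  assumes "b \<in> B"
  shows "lin_ext U \<beta> (Poly_Mapping.single b c) = vsmult U c (\<beta> b)"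
  using lin_ext_superset[of "{b}" "Poly_Mapping.single b c"] assms \<beta>[OF assms] U
    finprod_insert[of "{}" b] by (simp add: Pi_def)

lemma lin_ext_scale:
  assumes "Poly_Mapping.keys p \<subseteq> B"
  shows "lin_ext U \<beta> (pm_scale c p) = vsmult U c (lin_ext U \<beta> p)"
proof -
  have "finprod (add_monoid_of U) (\<lambda>b. vsmult U (c * Poly_Mapping.lookup p b) (\<beta> b)) S =
    vsmult U c (finprod (add_monoid_of U) (\<lambda>b. vsmult U (Poly_Mapping.lookup p b) (\<beta> b)) S)"
    if "finite S" "S \<subseteq> B" for S
    using that
  proof (induction S)
    case empty
    then show ?case using U finprod_empty by simp
  next
    case (insert b S)
    then have "(\<lambda>b. vsmult U (c * Poly_Mapping.lookup p b) (\<beta> b)) \<in> S \<rightarrow> car U"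
      "(\<lambda>b. vsmult U (Poly_Mapping.lookup p b) (\<beta> b)) \<in> S \<rightarrow> car U" "\<beta> b \<in> car U"
      using U \<beta> by auto
    with insert U show ?case
      using finprod_insert[of S b] finprod_closed[of "\<lambda>b. vsmult U (Poly_Mapping.lookup p b) (\<beta> b)" S]
      by (simp add: kmod_smult_add kmod_mult_smult)
  qed
  moreover have "Poly_Mapping.keys (pm_scale c p) \<subseteq> Poly_Mapping.keys p"
    by (auto simp: in_keys_iff)
  ultimately show ?thesis
    using lin_ext_superset[of "Poly_Mapping.keys p"] assms by simp
qed

end

text \<open>Subtracting the term at one key shrinks the support, so induction over a finite set
  containing the support applies, and every intermediate combination stays supported in
  \<open>B\<close>.\<close>

lemma poly_keys_induct [consumes 1, case_names zero add]:
  fixes p :: "'b \<Rightarrow>\<^sub>0 'k::ab_group_add"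
  assumes "Poly_Mapping.keys p \<subseteq> B" "P 0"
    and add: "\<And>p b c. Poly_Mapping.keys p \<subseteq> B \<Longrightarrow> b \<in> B \<Longrightarrow> P p \<Longrightarrow>
      P (p + Poly_Mapping.single b c)"
  shows "P p"
proof -
  have "finite S \<Longrightarrow> \<forall>p. Poly_Mapping.keys p \<subseteq> S \<longrightarrow> P p" if "S \<subseteq> B" for S
    using that
  proof (induction S rule: infinite_finite_induct)
    case (insert b S)
    show ?case
    proof (intro allI impI)
      fix p :: "'b \<Rightarrow>\<^sub>0 'k"
      assume p: "Poly_Mapping.keys p \<subseteq> insert b S"
      define q where "q = p - Poly_Mapping.single b (Poly_Mapping.lookup p b)"
      have "Poly_Mapping.keys q \<subseteq> S"
      proof
        fix x
        assume x: "x \<in> Poly_Mapping.keys q"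
        then have "x \<noteq> b"
          by (auto simp: q_def in_keys_iff lookup_minus)
        with x p show "x \<in> S"
          by (auto simp: q_def in_keys_iff lookup_minus lookup_single)
      qed
      with insert have "P (q + Poly_Mapping.single b (Poly_Mapping.lookup p b))"
        by (intro add) auto
      then show "P p" by (simp add: q_def)
    qed
  qed (use \<open>P 0\<close> in auto)
  with assms(1) show ?thesis by auto
qed

section \<open>Tensor products\<close>

lemma keys_pm_scale: "Poly_Mapping.keys (pm_scale c p) \<subseteq> Poly_Mapping.keys p"
  by (auto simp: in_keys_iff)

lemma keys_subset_add:
  "Poly_Mapping.keys p \<subseteq> B \<Longrightarrow> Poly_Mapping.keys q \<subseteq> B \<Longrightarrow> Poly_Mapping.keys (p + q) \<subseteq> B"
  using keys_add[of p q] by blast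

lemma keys_subset_diff:
  "Poly_Mapping.keys p \<subseteq> B \<Longrightarrow> Poly_Mapping.keys q \<subseteq> B \<Longrightarrow> Poly_Mapping.keys (p - q) \<subseteq> B"
  for p q :: "'b \<Rightarrow>\<^sub>0 'k::ab_group_add"
  using keys_diff[of p q] by blast

lemma keys_subset_single: "b \<in> B \<Longrightarrow> Poly_Mapping.keys (Poly_Mapping.single b c) \<subseteq> B"
  by simp

lemma pm_scale_single [simp]:
  "pm_scale c (Poly_Mapping.single b d) = Poly_Mapping.single b (c * d)"
  by (rule poly_mapping_eqI) (simp add: lookup_single when_def)

lemma keys_bilinear_relators:
  assumes "kmodule V" "kmodule W" "r \<in> bilinear_relators V W"
  shows "Poly_Mapping.keys r \<subseteq> car V \<times> car W"
  using assms unfolding bilinear_relators_def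
  by (elim UnE CollectE exE conjE; hypsubst; intro keys_subset_diff keys_subset_single) auto

lemma bilin_add_left: "bilin V W U \<beta> \<Longrightarrow> a \<in> car V \<Longrightarrow> a' \<in> car V \<Longrightarrow> b \<in> car W \<Longrightarrow>
    \<beta> (vadd V a a') b = vadd U (\<beta> a b) (\<beta> a' b)"
  and bilin_add_right: "bilin V W U \<beta> \<Longrightarrow> a \<in> car V \<Longrightarrow> b \<in> car W \<Longrightarrow> b' \<in> car W \<Longrightarrow>
    \<beta> a (vadd W b b') = vadd U (\<beta> a b) (\<beta> a b')"
  and bilin_smult_left: "bilin V W U \<beta> \<Longrightarrow> a \<in> car V \<Longrightarrow> b \<in> car W \<Longrightarrow>
    \<beta> (vsmult V c a) b = vsmult U c (\<beta> a b)"
  and bilin_smult_right: "bilin V W U \<beta> \<Longrightarrow> a \<in> car V \<Longrightarrow> b \<in> car W \<Longrightarrow>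
    \<beta> a (vsmult W c b) = vsmult U c (\<beta> a b)"
  and bilin_closed: "bilin V W U \<beta> \<Longrightarrow> a \<in> car V \<Longrightarrow> b \<in> car W \<Longrightarrow> \<beta> a b \<in> car U"
  by (auto simp: bilin_def lin_on_def)

context
  fixes V :: "('k::field, 'v, 'x) kmod_scheme" and W :: "('k, 'w, 'y) kmod_scheme"
  assumes V: "kmodule V" and W: "kmodule W"
begin

lemma tensor_class_self:
  "Poly_Mapping.keys p \<subseteq> car V \<times> car W \<Longrightarrow> p \<in> tensor_class V W p"
  by (simp add: tensor_class_def pm.span_zero)

lemma tensor_class_eqI:
  assumes "p - q \<in> pm.span (bilinear_relators V W)"
  shows "tensor_class V W p = tensor_class V W q"
proof -
  have "r - p \<in> pm.span (bilinear_relators V W) \<longleftrightarrow> r - q \<in> pm.span (bilinear_relators V W)" for r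
    using pm.span_add_eq2[OF assms, of "r - p"] by simp
  then show ?thesis by (simp add: tensor_class_def)
qed

text \<open>The operations of \<open>tensor\<close> pick representatives by choice. The chosen one
  differs from \<open>p\<close> by an element of the span of the relators, which makes the
  operations well defined.\<close>

lemma tensor_class_some:
  assumes "Poly_Mapping.keys p \<subseteq> car V \<times> car W"
  shows "Poly_Mapping.keys (SOME q. q \<in> tensor_class V W p) \<subseteq> car V \<times> car W"
    and "(SOME q. q \<in> tensor_class V W p) - p \<in> pm.span (bilinear_relators V W)"
  using someI[of "\<lambda>q. q \<in> tensor_class V W p", OF tensor_class_self[OF assms]]
  by (auto simp: tensor_class_def)

lemma tensor_cases:
  assumes "t \<in> car (tensor V W)"
  obtains p where "Poly_Mapping.keys p \<subseteq> car V \<times> car W" "t = tensor_class V W p"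
  using assms by (auto simp: tensor_def)

lemma tensor_class_in [simp]:
  "Poly_Mapping.keys p \<subseteq> car V \<times> car W \<Longrightarrow> tensor_class V W p \<in> car (tensor V W)"
  by (simp add: tensor_def)

lemma tensor_zero: "vzero (tensor V W) = tensor_class V W 0"
  by (simp add: tensor_def)

lemma tensor_add:
  assumes "Poly_Mapping.keys p \<subseteq> car V \<times> car W" "Poly_Mapping.keys q \<subseteq> car V \<times> car W"
  shows "vadd (tensor V W) (tensor_class V W p) (tensor_class V W q) = tensor_class V W (p + q)"
  using tensor_class_eqI[of "_ + _" "p + q"]
    pm.span_add[OF tensor_class_some(2)[OF assms(1)] tensor_class_some(2)[OF assms(2)]]
  by (simp add: tensor_def algebra_simps)

lemma tensor_smult:
  assumes "Poly_Mapping.keys p \<subseteq> car V \<times> car W"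
  shows "vsmult (tensor V W) c (tensor_class V W p) = tensor_class V W (pm_scale c p)"
  using tensor_class_eqI[of "pm_scale c _" "pm_scale c p"]
    pm.span_scale[OF tensor_class_some(2)[OF assms], of c]
  by (simp add: tensor_def pm.scale_right_diff_distrib)

lemma kmodule_tensor [simp]: "kmodule (tensor V W)"
proof -
  have neg: "\<exists>y\<in>car (tensor V W). vadd (tensor V W) x y = vzero (tensor V W)"
    if "x \<in> car (tensor V W)" for x
  proof -
    from that obtain p where "Poly_Mapping.keys p \<subseteq> car V \<times> car W" "x = tensor_class V W p"
      by (rule tensor_cases)
    then show ?thesis
      by (intro bexI[of _ "tensor_class V W (- p)"]) (auto simp: tensor_add tensor_zero)
  qed
  have scale: "Poly_Mapping.keys (pm_scale c p) \<subseteq> car V \<times> car W"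
    if "Poly_Mapping.keys p \<subseteq> car V \<times> car W" for c p
    using that keys_pm_scale[of c p] by blast
  show ?thesis
    unfolding kmodule_def using neg
    by (auto elim!: tensor_cases simp: tensor_zero tensor_add tensor_smult keys_subset_add scale
        add.assoc add.commute add.left_commute pm.scale_right_distrib pm.scale_left_distrib)
qed

lemma pure_in [simp]: "a \<in> car V \<Longrightarrow> b \<in> car W \<Longrightarrow> pure V W a b \<in> car (tensor V W)"
  by (simp add: pure_def)

lemma bilin_pure: "bilin V W (tensor V W) (pure V W)"
proof -
  note [simp] = tensor_add tensor_smult
  have 1: "pure V W (vadd V a a') b = vadd (tensor V W) (pure V W a b) (pure V W a' b)"
    if "a \<in> car V" "a' \<in> car V" "b \<in> car W" for a a' b
    unfolding pure_def using that
    by (simp add: keys_subset_single) (rule tensor_class_eqI, rule pm.span_base,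
        force simp: bilinear_relators_def diff_diff_eq)
  have 2: "pure V W a (vadd W b b') = vadd (tensor V W) (pure V W a b) (pure V W a b')"
    if "a \<in> car V" "b \<in> car W" "b' \<in> car W" for a b b'
    unfolding pure_def using that
    by (simp add: keys_subset_single) (rule tensor_class_eqI, rule pm.span_base,
        force simp: bilinear_relators_def diff_diff_eq)
  have 3: "pure V W (vsmult V c a) b = vsmult (tensor V W) c (pure V W a b)"
    if "a \<in> car V" "b \<in> car W" for a b c
    unfolding pure_def using that
    by (simp add: keys_subset_single) (rule tensor_class_eqI, rule pm.span_base,
        force simp: bilinear_relators_def diff_diff_eq)
  have 4: "pure V W a (vsmult W c b) = vsmult (tensor V W) c (pure V W a b)"
    if "a \<in> car V" "b \<in> car W" for a b c
    unfolding pure_def using that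
    by (simp add: keys_subset_single) (rule tensor_class_eqI, rule pm.span_base,
        force simp: bilinear_relators_def diff_diff_eq)
  show ?thesis
    by (intro bilinI lin_onI) (simp_all add: 1 2 3 4)
qed

text \<open>A scalar coefficient is absorbed into the left factor, so sums of pure tensors already
  exhaust the tensor product.\<close>

lemma tensor_induct [consumes 1, case_names zero pure add]:
  assumes "t \<in> car (tensor V W)" "P (vzero (tensor V W))"
    and pure: "\<And>a b. a \<in> car V \<Longrightarrow> b \<in> car W \<Longrightarrow> P (pure V W a b)"
    and add: "\<And>s t. s \<in> car (tensor V W) \<Longrightarrow> t \<in> car (tensor V W) \<Longrightarrow> P s \<Longrightarrow> P t \<Longrightarrow>
      P (vadd (tensor V W) s t)"
  shows "P t"
proof -
  obtain p where p: "Poly_Mapping.keys p \<subseteq> car V \<times> car W" "t = tensor_class V W p"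
    using assms(1) by (rule tensor_cases)
  from p(1) have "P (tensor_class V W p)"
  proof (induction rule: poly_keys_induct)
    case zero
    then show ?case using assms(2) by (simp add: tensor_zero)
  next
    case (add p z c)
    obtain a b where z: "z = (a, b)" "a \<in> car V" "b \<in> car W"
      using add by auto
    have "tensor_class V W (Poly_Mapping.single z c) = pure V W (vsmult V c a) b"
      using z bilin_smult_left[OF bilin_pure] by (simp add: pure_def tensor_smult)
    then have "P (vadd (tensor V W) (tensor_class V W p) (tensor_class V W (Poly_Mapping.single z c)))"
      using add z V by (intro assms(4)) (auto intro: pure)
    then show ?case
      using add z by (simp add: tensor_add)
  qed
  with p show ?thesis by simp
qed

lemma lin_on_tensor_eqI:
  assumes "kmodule U" "lin_on (tensor V W) U f" "lin_on (tensor V W) U g"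
    and "\<And>a b. a \<in> car V \<Longrightarrow> b \<in> car W \<Longrightarrow> f (pure V W a b) = g (pure V W a b)"
    and "t \<in> car (tensor V W)"
  shows "f t = g t"
  using assms(5)
  by (induction rule: tensor_induct)
    (use assms in \<open>auto simp: lin_on_zero[where V = "tensor V W"] lin_on_add[where V = "tensor V W"]\<close>)

section \<open>Universal property of the tensor product\<close>

context
  fixes U :: "('k, 'u, 'z) kmod_scheme" and \<beta>
  assumes U: "kmodule U" and \<beta>: "bilin V W U \<beta>"
begin

private lemma \<beta>_closed: "b \<in> car V \<times> car W \<Longrightarrow> (case b of (x, y) \<Rightarrow> \<beta> x y) \<in> car U"
  using bilin_closed[OF \<beta>] by auto

text \<open>The linear extension of a bilinear map kills every relator, hence their span, and so
  descends to the quotient. The bound on the keys is carried along because \<open>lin_ext\<close> is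
  known to be additive only on combinations supported in the carriers.\<close>

lemma lin_ext_relators:
  assumes "r \<in> pm.span (bilinear_relators V W)"
  shows "Poly_Mapping.keys r \<subseteq> car V \<times> car W \<and> lin_ext U (case_prod \<beta>) r = vzero U"
proof -
  note le = lin_ext_add[OF U \<beta>_closed] lin_ext_scale[OF U \<beta>_closed] lin_ext_zero[OF U \<beta>_closed]
    lin_ext_single[OF U \<beta>_closed] lin_ext_closed[OF U \<beta>_closed]
  \<comment> \<open>Modules have no subtraction operation, so the differences in the relators are
    rewritten as sums with a multiple by -1.\<close>
  have ms: "- Poly_Mapping.single b c = Poly_Mapping.single b (- c)" for b :: "'v \<times> 'w" and c :: 'k
    by (rule poly_mapping_eqI) (simp add: lookup_single when_def)
  have 3: "lin_ext U (case_prod \<beta>) (Poly_Mapping.single z 1 - Poly_Mapping.single u 1 -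
      Poly_Mapping.single v 1) = vzero U"
    if "z \<in> car V \<times> car W" "u \<in> car V \<times> car W" "v \<in> car V \<times> car W"
      "case_prod \<beta> z = vadd U (case_prod \<beta> u) (case_prod \<beta> v)" for z u v
  proof -
    have "lin_ext U (case_prod \<beta>) (Poly_Mapping.single z 1 + pm_scale (- 1) (Poly_Mapping.single u 1 +
        Poly_Mapping.single v 1)) = vzero U"
      using that \<beta>_closed[of u] \<beta>_closed[of v] U by (simp only: le keys_subset_add keys_subset_single
          keys_pm_scale[THEN subset_trans]) simp
    then show ?thesis
      by (simp add: diff_conv_add_uminus ms add.assoc pm.scale_right_distrib
          del: add_uminus_conv_diff)
  qed
  have 2: "lin_ext U (case_prod \<beta>) (Poly_Mapping.single z 1 - Poly_Mapping.single u c) = vzero U"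
    if "z \<in> car V \<times> car W" "u \<in> car V \<times> car W"
      "case_prod \<beta> z = vsmult U c (case_prod \<beta> u)" for z u c
  proof -
    have "lin_ext U (case_prod \<beta>) (Poly_Mapping.single z 1 + pm_scale (- 1) (Poly_Mapping.single u c)) = vzero U"
      using that \<beta>_closed[of u] U by (simp only: le keys_subset_add keys_subset_single
          keys_pm_scale[THEN subset_trans]) simp
    then show ?thesis
      by (simp add: diff_conv_add_uminus ms del: add_uminus_conv_diff)
  qed
  have base: "Poly_Mapping.keys r \<subseteq> car V \<times> car W \<and> lin_ext U (case_prod \<beta>) r = vzero U"
    if "r \<in> bilinear_relators V W" for r
  proof
    show "Poly_Mapping.keys r \<subseteq> car V \<times> car W"
      by (rule keys_bilinear_relators[OF V W that])
    show "lin_ext U (case_prod \<beta>) r = vzero U"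
      using that unfolding bilinear_relators_def
      by (auto intro!: 2 3 simp: V W bilin_add_left[OF \<beta>] bilin_add_right[OF \<beta>]
          bilin_smult_left[OF \<beta>] bilin_smult_right[OF \<beta>])
  qed
  show ?thesis
    using assms
  proof (induction rule: pm.span_induct_alt)
    case base
    then show ?case by (simp add: le)
  next
    case (step c x y)
    then have "Poly_Mapping.keys (pm_scale c x) \<subseteq> car V \<times> car W"
      using base[of x] keys_pm_scale[of c x] by blast
    with step base[of x] U show ?case
      by (simp add: le keys_subset_add)
  qed
qed

text \<open>This justifies the \<open>THE\<close> in \<open>tensor_lift\<close>. Existence comes
  from evaluating on a chosen representative; uniqueness holds because pure tensors generate and
  \<open>klinear\<close> fixes the values outside the carrier.\<close>

lemma tensor_lift_exists:
  "\<exists>!f. klinear (tensor V W) U f \<and> (\<forall>a\<in>car V. \<forall>b\<in>car W. f (pure V W a b) = \<beta> a b)"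
proof (rule ex_ex1I)
  note le = lin_ext_add[OF U \<beta>_closed] lin_ext_scale[OF U \<beta>_closed] lin_ext_zero[OF U \<beta>_closed]
    lin_ext_single[OF U \<beta>_closed] lin_ext_closed[OF U \<beta>_closed]
  define f where "f t = lin_ext U (case_prod \<beta>) (SOME p. p \<in> t)" for t
  have f: "f (tensor_class V W p) = lin_ext U (case_prod \<beta>) p"
    if p: "Poly_Mapping.keys p \<subseteq> car V \<times> car W" for p
  proof -
    let ?q = "SOME q. q \<in> tensor_class V W p"
    have "lin_ext U (case_prod \<beta>) ?q = lin_ext U (case_prod \<beta>) ((?q - p) + p)" by simp
    also have "\<dots> = vadd U (lin_ext U (case_prod \<beta>) (?q - p)) (lin_ext U (case_prod \<beta>) p)"
      using lin_ext_relators[OF tensor_class_some(2)[OF p]] p by (intro le) auto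
    also have "\<dots> = lin_ext U (case_prod \<beta>) p"
      using lin_ext_relators[OF tensor_class_some(2)[OF p]] U le(5)[OF _ p] by simp
    finally show ?thesis by (simp add: f_def)
  qed
  have scale: "Poly_Mapping.keys (pm_scale c p) \<subseteq> car V \<times> car W"
    if "Poly_Mapping.keys p \<subseteq> car V \<times> car W" for c p
    using that keys_pm_scale[of c p] by blast
  have "lin_on (tensor V W) U f"
    by (rule lin_onI) (auto elim!: tensor_cases simp: f le tensor_add tensor_smult keys_subset_add scale)
  moreover have "f (pure V W a b) = \<beta> a b" if "a \<in> car V" "b \<in> car W" for a b
    using that U bilin_closed[OF \<beta>] by (simp add: pure_def f le)
  ultimately show "\<exists>f. klinear (tensor V W) U f \<and>
      (\<forall>a\<in>car V. \<forall>b\<in>car W. f (pure V W a b) = \<beta> a b)"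
    by (intro exI[of _ "restrict f (car (tensor V W))"]) (simp add: klinear_restrict)
next
  fix f g
  assume f: "klinear (tensor V W) U f \<and> (\<forall>a\<in>car V. \<forall>b\<in>car W. f (pure V W a b) = \<beta> a b)"
    and g: "klinear (tensor V W) U g \<and> (\<forall>a\<in>car V. \<forall>b\<in>car W. g (pure V W a b) = \<beta> a b)"
  show "f = g"
    by (rule extensionalityI[of _ "car (tensor V W)"])
      (use f g lin_on_tensor_eqI[OF U, of f g] in \<open>auto simp: klinear_iff_lin_on\<close>)
qed

lemma klinear_tensor_lift: "klinear (tensor V W) U (tensor_lift V W U \<beta>)"
  and tensor_lift_pure [simp]:
    "a \<in> car V \<Longrightarrow> b \<in> car W \<Longrightarrow> tensor_lift V W U \<beta> (pure V W a b) = \<beta> a b"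
  using theI'[OF tensor_lift_exists] by (auto simp: tensor_lift_def)

lemma lin_on_tensor_lift: "lin_on (tensor V W) U (tensor_lift V W U \<beta>)"
  using klinear_tensor_lift by (rule klinear_lin_on)

lemma tensor_lift_in: "t \<in> car (tensor V W) \<Longrightarrow> tensor_lift V W U \<beta> t \<in> car U"
  using lin_on_tensor_lift by (rule lin_on_closed)

end

text \<open>Both sides of each linearity equation are linear in \<open>t\<close>, so it is enough to
  compare them on pure tensors. The lemma serves nested Sweedler expressions, where an inner lift
  must be linear in the variables of the outer one.\<close>

lemma lin_on_tensor_lift_param:
  fixes U :: "('k, 'u, 'z) kmod_scheme" and S :: "('k, 's, 'q) kmod_scheme"
  assumes U: "kmodule U" and S: "kmodule S"
    and \<beta>: "\<And>s. s \<in> car S \<Longrightarrow> bilin V W U (\<beta> s)"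
    and lin: "\<And>a b. a \<in> car V \<Longrightarrow> b \<in> car W \<Longrightarrow> lin_on S U (\<lambda>s. \<beta> s a b)"
    and t: "t \<in> car (tensor V W)"
  shows "lin_on S U (\<lambda>s. tensor_lift V W U (\<beta> s) t)"
proof (rule lin_onI)
  fix x y assume x: "x \<in> car S" and y: "y \<in> car S"
  have xy: "vadd S x y \<in> car S" using x y S by simp
  note * = lin_on_tensor_lift[OF U \<beta>]
  show "tensor_lift V W U (\<beta> (vadd S x y)) t =
      vadd U (tensor_lift V W U (\<beta> x) t) (tensor_lift V W U (\<beta> y) t)"
    using t by (rule lin_on_tensor_eqI[OF U *[OF xy] lin_on_plus[OF U *[OF x] *[OF y]], rotated])
      (simp add: tensor_lift_pure[OF U \<beta>] x y xy lin_on_add[OF lin])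
next
  fix c x assume x: "x \<in> car S"
  have cx: "vsmult S c x \<in> car S" using x S by simp
  note * = lin_on_tensor_lift[OF U \<beta>]
  show "tensor_lift V W U (\<beta> (vsmult S c x)) t = vsmult U c (tensor_lift V W U (\<beta> x) t)"
    using t by (rule lin_on_tensor_eqI[OF U *[OF cx] lin_on_scale[OF U *[OF x]], rotated])
      (simp add: tensor_lift_pure[OF U \<beta>] x cx lin_on_smult[OF lin])
qed (use tensor_lift_in[OF U \<beta>] t in auto)

lemma lin_on_pure_left: "b \<in> car W \<Longrightarrow> lin_on V (tensor V W) (\<lambda>a. pure V W a b)"
  and lin_on_pure_right: "a \<in> car V \<Longrightarrow> lin_on W (tensor V W) (pure V W a)"
  using bilin_pure by (auto simp: bilin_def)

end

section \<open>Tensor products with the group algebra\<close>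

lemma kG_module_simps [simp]:
  "car kG_module = UNIV" "vadd kG_module = (+)" "vzero kG_module = 0" "vsmult kG_module = pm_scale"
  by (simp_all add: kG_module_def)

lemma kmodule_kG [simp]: "kmodule (kG_module :: ('k::field, 'g::group_add \<Rightarrow>\<^sub>0 'k) kmod)"
  unfolding kmodule_def
  by (auto simp: add.assoc add.commute add.left_commute pm.scale_right_distrib pm.scale_left_distrib intro: exI[of _ "- _"])

abbreviation kbasis :: "'g \<Rightarrow> ('g \<Rightarrow>\<^sub>0 'k::field)" where
  "kbasis g \<equiv> Poly_Mapping.single g 1"

abbreviation kG_tensor where "kG_tensor X \<equiv> tensor kG_module X"

abbreviation kG_pure where "kG_pure X \<equiv> pure kG_module X"

lemma kG_induct [case_names zero add]:
  fixes a :: "'g \<Rightarrow>\<^sub>0 'k::field"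
  assumes "P 0" "\<And>a g c. P a \<Longrightarrow> P (a + pm_scale c (kbasis g))"
  shows "P a"
  using poly_keys_induct[of a UNIV P] assms by simp

lemma lin_on_kG_eqI:
  fixes f f' :: "('g::group_add \<Rightarrow>\<^sub>0 'k::field) \<Rightarrow> 'u"
  assumes U: "kmodule U" and f: "lin_on kG_module U f" and f': "lin_on kG_module U f'"
    and "\<And>g. f (kbasis g) = f' (kbasis g)"
  shows "f a = f' a"
proof (induction a rule: kG_induct)
  case zero
  then show ?case using lin_on_zero[OF f _ U] lin_on_zero[OF f' _ U] by simp
next
  case (add a g c)
  then show ?case
    using lin_on_add[OF f, of a "pm_scale c (kbasis g)"] lin_on_smult[OF f, of "kbasis g" c]
      lin_on_add[OF f', of a "pm_scale c (kbasis g)"] lin_on_smult[OF f', of "kbasis g" c] assms(4)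
    by (simp del: pm_scale_single)
qed

lemma lin_on_lin_ext:
  fixes U :: "('k::field, 'u, 'z) kmod_scheme" and \<beta> :: "'g::group_add \<Rightarrow> 'u"
  assumes "kmodule U" "\<And>g. \<beta> g \<in> car U"
  shows "lin_on kG_module U (lin_ext U \<beta>)"
  by (rule lin_onI) (simp_all add: lin_ext_closed[where B = UNIV] lin_ext_add[where B = UNIV]
      lin_ext_scale[where B = UNIV] assms)

section \<open>Coefficients with respect to the group basis\<close>

text \<open>The coefficient x_g when an element of k[G] \<otimes> X is written as a sum of g
  \<otimes> x_g over distinct g.\<close>

definition coef ::
  "('k::field, 'v, 'z) kmod_scheme \<Rightarrow> 'g::group_add \<Rightarrow> (('g \<Rightarrow>\<^sub>0 'k) \<times> 'v \<Rightarrow>\<^sub>0 'k) set \<Rightarrow> 'v" where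
  "coef X g = tensor_lift kG_module X X (\<lambda>a. vsmult X (Poly_Mapping.lookup a g))"

context
  fixes X :: "('k::field, 'v, 'z) kmod_scheme"
  assumes X: "kmodule X"
begin

private abbreviation T :: "('k, (('g::group_add \<Rightarrow>\<^sub>0 'k) \<times> 'v \<Rightarrow>\<^sub>0 'k) set) kmod"
  where "T \<equiv> kG_tensor X"

lemma kmodule_kG_tensor [simp]: "kmodule T"
  using X by simp

lemma kG_pure_in: "x \<in> car X \<Longrightarrow> kG_pure X a x \<in> car T"
  using X by simp

lemma bilin_coef:
  "bilin kG_module X X (\<lambda>a. vsmult X (Poly_Mapping.lookup (a :: 'g::group_add \<Rightarrow>\<^sub>0 'k) g))"
  using X by (intro bilinI lin_onI)
    (simp_all add: lookup_add kmod_add_smult kmod_mult_smult kmod_smult_add mult.commute flip: kmod_mult_smult)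

lemma lin_on_coef: "lin_on T X (coef X g)"
  using lin_on_tensor_lift[OF kmodule_kG X X bilin_coef] by (simp add: coef_def)

lemma coef_pure: "x \<in> car X \<Longrightarrow> coef X g (kG_pure X a x) = vsmult X (Poly_Mapping.lookup a g) x"
  unfolding coef_def using tensor_lift_pure[OF kmodule_kG X X bilin_coef] by simp

lemma coef_in: "t \<in> car T \<Longrightarrow> coef X g t \<in> car X"
  using lin_on_closed[OF lin_on_coef] .

lemma coef_zero: "coef X g (vzero T) = vzero X"
  using lin_on_zero[OF lin_on_coef kmodule_kG_tensor X] .

lemma coef_add: "s \<in> car T \<Longrightarrow> t \<in> car T \<Longrightarrow> coef X g (vadd T s t) = vadd X (coef X g s) (coef X g t)"
  using lin_on_add[OF lin_on_coef] .

lemma kG_pure_zero: "kG_pure X a (vzero X) = vzero T"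
  using lin_on_zero[OF lin_on_pure_right[OF kmodule_kG X] X kmodule_kG_tensor] by simp

lemma kG_pure_0: "x \<in> car X \<Longrightarrow> kG_pure X 0 x = vzero T"
  using lin_on_zero[OF lin_on_pure_left[OF kmodule_kG X] kmodule_kG kmodule_kG_tensor] by simp

text \<open>
  The normal forms are the sums of \<open>g \<otimes> x\<^sub>g\<close> over distinct \<open>g\<close>; every tensor is one.
\<close>

inductive normal_form :: "(('g::group_add \<Rightarrow>\<^sub>0 'k) \<times> 'v \<Rightarrow>\<^sub>0 'k) set \<Rightarrow> bool" where
  zero: "normal_form (vzero T)"
| add: "normal_form t \<Longrightarrow> x \<in> car X \<Longrightarrow> coef X g t = vzero X \<Longrightarrow>
    normal_form (vadd T t (kG_pure X (kbasis g) x))"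

lemma normal_form_in: "normal_form t \<Longrightarrow> t \<in> car T"
  by (induction rule: normal_form.induct) (auto intro: kG_pure_in kmod_zero kmod_add)

text \<open>A new term either merges with an existing term of the same degree or commutes past the
  last term into the shorter sum.\<close>

lemma normal_form_add_pure:
  assumes "normal_form t" "x \<in> car X"
  shows "normal_form (vadd T t (kG_pure X (kbasis g) x))"
  using assms
proof (induction arbitrary: x rule: normal_form.induct)
  case zero
  then show ?case by (auto intro: normal_form.intros simp: coef_zero)
next
  case (add t y h x)
  note t = normal_form_in[OF add.hyps(1)]
  note p = kG_pure_in[OF add.hyps(2), of "kbasis h"] kG_pure_in[OF add.prems, of "kbasis g"]
  show ?case
  proof (cases "g = h")
    case True
    have "vadd T (vadd T t (kG_pure X (kbasis h) y)) (kG_pure X (kbasis g) x) =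
        vadd T t (kG_pure X (kbasis h) (vadd X y x))"
      using t p True add.prems add.hyps
      by (simp add: kmod_assoc lin_on_add[OF lin_on_pure_right[OF kmodule_kG X]])
    also have "normal_form \<dots>"
      using add X by (intro normal_form.add) auto
    finally show ?thesis .
  next
    case False
    have "vadd T (vadd T t (kG_pure X (kbasis h) y)) (kG_pure X (kbasis g) x) =
        vadd T (vadd T t (kG_pure X (kbasis g) x)) (kG_pure X (kbasis h) y)"
      using t p kmod_comm[OF kmodule_kG_tensor p] by (simp add: kmod_assoc)
    also have "normal_form \<dots>"
      using add False X t p
      by (intro normal_form.add[OF add.IH]) (auto simp: coef_add coef_pure lookup_single when_def)
    finally show ?thesis .
  qed
qed

lemma normal_form_add_pure':
  fixes a :: "'g::group_add \<Rightarrow>\<^sub>0 'k"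
  assumes "x \<in> car X"
  shows "normal_form t \<Longrightarrow> normal_form (vadd T t (kG_pure X a x))"
proof (induction a arbitrary: t rule: kG_induct)
  case zero
  then show ?case
    using normal_form_in[OF zero] by (simp add: kG_pure_0 assms)
next
  case (add a g c)
  have "kG_pure X (pm_scale c (kbasis g)) x = kG_pure X (kbasis g) (vsmult X c x)"
    using lin_on_smult[OF lin_on_pure_left[OF kmodule_kG X assms], of "kbasis g" c]
      lin_on_smult[OF lin_on_pure_right[OF kmodule_kG X], of "kbasis g" x c] assms by simp
  then have "kG_pure X (a + pm_scale c (kbasis g)) x =
      vadd T (kG_pure X a x) (kG_pure X (kbasis g) (vsmult X c x))"
    using lin_on_add[OF lin_on_pure_left[OF kmodule_kG X assms], of a "pm_scale c (kbasis g)"] by simp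
  then have "vadd T t (kG_pure X (a + pm_scale c (kbasis g)) x) =
      vadd T (vadd T t (kG_pure X a x)) (kG_pure X (kbasis g) (vsmult X c x))"
    using normal_form_in[OF add.prems] kG_pure_in assms X by (simp add: kmod_assoc)
  then show ?case
    using normal_form_add_pure[OF add.IH[OF add.prems]] assms X by simp
qed

text \<open>Each added term has a degree whose coefficient was zero so far, so the coefficients of
  the sum can be read off without cancellation.\<close>

lemma kG_tensor_induct [consumes 1, case_names zero add]:
  assumes "t \<in> car T" "P (vzero T)"
    and "\<And>t g x. t \<in> car T \<Longrightarrow> x \<in> car X \<Longrightarrow> coef X g t = vzero X \<Longrightarrow> P t \<Longrightarrow>
      P (vadd T t (kG_pure X (kbasis g) x))"
  shows "P t"
proof -
  \<comment> \<open>Generalised over a normal form \<open>s\<close> on the left, so that the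
    summands of \<open>t\<close> can be attached to it one after the other.\<close>
  have "normal_form s \<longrightarrow> normal_form (vadd T s t)" for s
    using assms(1)
  proof (induction arbitrary: s rule: tensor_induct[OF kmodule_kG X, consumes 1, case_names zero pure add])
    case zero
    then show ?case using normal_form_in[of s] by simp
  next
    case (pure a b)
    then show ?case using normal_form_add_pure' by blast
  next
    case (add u v)
    then show ?case
      using normal_form_in[of s] by (auto simp flip: kmod_assoc)
  qed
  from this[of "vzero T"] have "normal_form t"
    using assms(1) by (simp add: normal_form.zero)
  then show ?thesis
    by (induction rule: normal_form.induct) (use assms normal_form_in in auto)
qed

lemma finite_coef: "t \<in> car T \<Longrightarrow> finite {g. coef X g t \<noteq> vzero X}"
proof (induction rule: kG_tensor_induct)
  case zero
  then show ?case by (simp add: coef_zero)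
next
  case (add t g x)
  have "{h. coef X h (vadd T t (kG_pure X (kbasis g) x)) \<noteq> vzero X} \<subseteq>
      insert g {g. coef X g t \<noteq> vzero X}"
    using add X by (auto simp: coef_add coef_pure kG_pure_in coef_in lookup_single when_def)
  with add show ?case by (meson finite_insert finite_subset)
qed

text \<open>The degree of the last term does not occur in the rest, so its coefficient is
  \<open>x\<close> itself. It must vanish, and the induction hypothesis handles the rest.\<close>

lemma coef_all_zero:
  assumes "t \<in> car T" "\<And>g. coef X g t = vzero X"
  shows "t = vzero T"
proof -
  from assms(1) have "(\<forall>g. coef X g t = vzero X) \<longrightarrow> t = vzero T"
  proof (induction rule: kG_tensor_induct)
    case (add t g x)
    show ?case
    proof
      assume *: "\<forall>h. coef X h (vadd T t (kG_pure X (kbasis g) x)) = vzero X"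
      have "x = vzero X"
        using *[rule_format, of g] add X by (simp add: coef_add coef_pure kG_pure_in)
      with * add show "vadd T t (kG_pure X (kbasis g) x) = vzero T"
        by (simp add: kG_pure_zero)
    qed
  qed simp
  with assms show ?thesis by simp
qed

text \<open>The main tool for all later tensor identities: equality over k[G] is tested coefficient
  by coefficient in X.\<close>

lemma coef_eqI:
  assumes s: "s \<in> car T" and t: "t \<in> car T" and eq: "\<And>g. coef X g s = coef X g t"
  shows "s = t"
proof -
  have "vadd T s (vsmult T (- 1) t) = vzero T"
    using assms X coef_in[OF t]
    by (intro coef_all_zero) (auto simp: coef_add lin_on_smult[OF lin_on_coef])
  then have "vadd T (vsmult T (- 1) t) s = vadd T (vsmult T (- 1) t) t"
    using s t by (simp add: kmod_comm[of T _ s])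
  then show ?thesis
    using kmod_cancel[of T s t "vsmult T (-1) t"] s t by simp
qed

text \<open>Together with \<open>finite_coef\<close> and \<open>coef_eqI\<close> this identifies
  k[G] \<otimes> X with the finitely supported families G \<rightarrow> X.\<close>

lemma coef_surj:
  fixes p :: "'g::group_add \<Rightarrow> 'v"
  assumes "\<And>g. p g \<in> car X" "finite {g. p g \<noteq> vzero X}"
  shows "\<exists>t\<in>car T. \<forall>g. coef X g t = p g"
proof -
  have "finite S \<Longrightarrow> \<exists>t\<in>car T. \<forall>g. coef X g t = (if g \<in> S then p g else vzero X)" for S
  proof (induction S rule: finite_induct)
    case empty
    show ?case by (rule bexI[of _ "vzero T"]) (auto simp: coef_zero)
  next
    case (insert h S)
    then obtain t where "t \<in> car T" "\<forall>g. coef X g t = (if g \<in> S then p g else vzero X)"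
      by auto
    with insert assms(1) X show ?case
      by (intro bexI[of _ "vadd T t (kG_pure X (kbasis h) (p h))"])
        (auto simp: coef_add coef_pure kG_pure_in lookup_single when_def)
  qed
  from this[OF assms(2)] obtain t where "t \<in> car T"
    and t: "\<And>g. coef X g t = (if p g \<noteq> vzero X then p g else vzero X)"
    by auto
  moreover have "coef X g t = p g" for g
    using t[of g] by (cases "p g = vzero X") simp_all
  ultimately show ?thesis by blast
qed

end


section \<open>The Hopf algebra structure of the group algebra\<close>

lemma comult_group_hopf:
  "lin_on kG_module (kG_tensor kG_module)
     (comult (group_hopf :: ('k::field, 'g::group_add \<Rightarrow>\<^sub>0 'k) hopf))"
  "comult group_hopf (kbasis g :: 'g \<Rightarrow>\<^sub>0 'k) = kG_pure kG_module (kbasis g) (kbasis g)"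
proof -
  define d :: "('g \<Rightarrow>\<^sub>0 'k) \<Rightarrow> ('g \<Rightarrow>\<^sub>0 'k) \<times> ('g \<Rightarrow>\<^sub>0 'k) \<Rightarrow>\<^sub>0 'k" where
    "d a = (\<Sum>g\<in>Poly_Mapping.keys a. Poly_Mapping.single
             (Poly_Mapping.single g 1, Poly_Mapping.single g 1) (Poly_Mapping.lookup a g))" for a
  have dS: "d a = (\<Sum>g\<in>S. Poly_Mapping.single
      (Poly_Mapping.single g 1, Poly_Mapping.single g 1) (Poly_Mapping.lookup a g))"
    if "finite S" "Poly_Mapping.keys a \<subseteq> S" for a S
    unfolding d_def by (rule sum.mono_neutral_left) (use that in \<open>auto simp: in_keys_iff\<close>)
  have comult: "comult group_hopf a = tensor_class kG_module kG_module (d a)" for a :: "'g \<Rightarrow>\<^sub>0 'k"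
    by (simp add: group_hopf_def d_def)
  have add: "d (a + b) = d a + d b" for a b
    using dS[of "Poly_Mapping.keys a \<union> Poly_Mapping.keys b"] keys_add[of a b]
    by (simp add: lookup_add single_add sum.distrib)
  have scale: "d (pm_scale c a) = pm_scale c (d a)" for c a
    using dS[of "Poly_Mapping.keys a" "pm_scale c a"] keys_pm_scale[of c a]
    by (simp add: d_def pm.scale_sum_right)
  show "lin_on kG_module (kG_tensor kG_module) (comult (group_hopf :: ('k, 'g \<Rightarrow>\<^sub>0 'k) hopf))"
    by (rule lin_onI) (simp_all add: comult add scale tensor_add tensor_smult)
  show "comult group_hopf (kbasis g :: 'g \<Rightarrow>\<^sub>0 'k) = kG_pure kG_module (kbasis g) (kbasis g)"
    by (simp add: comult d_def pure_def)
qed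

lemma counit_group_hopf:
  "counit group_hopf (a + b :: 'g::group_add \<Rightarrow>\<^sub>0 'k::field) = counit group_hopf a + counit group_hopf b"
  "counit group_hopf (pm_scale c a :: 'g::group_add \<Rightarrow>\<^sub>0 'k::field) = c * counit group_hopf a"
  "counit group_hopf (kbasis g :: 'g::group_add \<Rightarrow>\<^sub>0 'k::field) = 1"
proof -
  have S: "counit group_hopf a = (\<Sum>g\<in>S. Poly_Mapping.lookup a g)"
    if "finite S" "Poly_Mapping.keys a \<subseteq> S" for a :: "'g \<Rightarrow>\<^sub>0 'k" and S
    unfolding group_hopf_def by (simp, rule sum.mono_neutral_left) (use that in \<open>auto simp: in_keys_iff\<close>)
  show "counit group_hopf (a + b :: 'g::group_add \<Rightarrow>\<^sub>0 'k::field) = counit group_hopf a + counit group_hopf b"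
    using S[of "Poly_Mapping.keys a \<union> Poly_Mapping.keys b"] keys_add[of a b]
    by (simp add: lookup_add sum.distrib)
  show "counit group_hopf (pm_scale c a :: 'g::group_add \<Rightarrow>\<^sub>0 'k::field) = c * counit group_hopf a"
    using S[of "Poly_Mapping.keys a" "pm_scale c a"] keys_pm_scale[of c a] S[of "Poly_Mapping.keys a" a]
    by (simp add: sum_distrib_left)
  show "counit group_hopf (kbasis g :: 'g::group_add \<Rightarrow>\<^sub>0 'k::field) = 1"
    by (simp add: group_hopf_def)
qed

lemma antipode_group_hopf:
  "antipode group_hopf (a + b :: 'g::group_add \<Rightarrow>\<^sub>0 'k::field) = antipode group_hopf a + antipode group_hopf b"
  "antipode group_hopf (pm_scale c a :: 'g::group_add \<Rightarrow>\<^sub>0 'k::field) = pm_scale c (antipode group_hopf a)"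
  "antipode group_hopf (kbasis g :: 'g::group_add \<Rightarrow>\<^sub>0 'k::field) = kbasis (- g)"
proof -
  have S: "antipode group_hopf a = (\<Sum>g\<in>S. Poly_Mapping.single (- g) (Poly_Mapping.lookup a g))"
    if "finite S" "Poly_Mapping.keys a \<subseteq> S" for a :: "'g \<Rightarrow>\<^sub>0 'k" and S
    unfolding group_hopf_def by (simp, rule sum.mono_neutral_left) (use that in \<open>auto simp: in_keys_iff\<close>)
  show "antipode group_hopf (a + b :: 'g::group_add \<Rightarrow>\<^sub>0 'k::field) = antipode group_hopf a + antipode group_hopf b"
    using S[of "Poly_Mapping.keys a \<union> Poly_Mapping.keys b"] keys_add[of a b]
    by (simp add: lookup_add single_add sum.distrib)
  show "antipode group_hopf (pm_scale c a :: 'g::group_add \<Rightarrow>\<^sub>0 'k::field) = pm_scale c (antipode group_hopf a)"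
    using S[of "Poly_Mapping.keys a" "pm_scale c a"] keys_pm_scale[of c a] S[of "Poly_Mapping.keys a" a]
    by (simp add: pm.scale_sum_right)
  show "antipode group_hopf (kbasis g :: 'g::group_add \<Rightarrow>\<^sub>0 'k::field) = kbasis (- g)"
    by (simp add: group_hopf_def)
qed

section \<open>Yetter-Drinfeld modules over a group algebra\<close>

lemma pm_scale_mult_left: "pm_scale c a * b = pm_scale c (a * b)"
  and pm_scale_mult_right: "a * pm_scale c b = pm_scale c (a * b)"
  for a b :: "'g::group_add \<Rightarrow>\<^sub>0 'k::field"
proof -
  have 1: "pm_scale c (kbasis g) * b = pm_scale c (kbasis g * b)"
    "kbasis g * pm_scale c b = pm_scale c (kbasis g * b)" for b :: "'g \<Rightarrow>\<^sub>0 'k" and g c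
    by (induction b rule: kG_induct)
      (simp_all add: distrib_left pm.scale_right_distrib mult_single mult.commute)
  show "pm_scale c a * b = pm_scale c (a * b)"
  proof (induction a rule: kG_induct)
    case (add a g d)
    have "pm_scale c (pm_scale d (kbasis g)) * b = pm_scale c (pm_scale d (kbasis g) * b)"
      using 1(1)[of "c * d" g b] 1(1)[of d g b] by (simp add: mult.assoc)
    with add show ?case by (simp add: distrib_right pm.scale_right_distrib del: pm_scale_single)
  qed simp
  show "a * pm_scale c b = pm_scale c (a * b)"
  proof (induction a rule: kG_induct)
    case (add a g d)
    have "pm_scale d (kbasis g) * pm_scale c b = pm_scale c (pm_scale d (kbasis g) * b)"
      using 1(1)[of d g b] 1(1)[of d g "pm_scale c b"] 1(2)[of g c b]
      by (simp add: mult.commute del: pm_scale_single)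
    with add show ?case by (simp add: distrib_right pm.scale_right_distrib del: pm_scale_single)
  qed simp
qed

lemma lin_on_mult_left: "lin_on S kG_module f \<Longrightarrow> lin_on S kG_module (\<lambda>s. f s * b)"
  and lin_on_mult_right: "lin_on S kG_module f \<Longrightarrow> lin_on S kG_module (\<lambda>s. b * f s)"
  by (auto simp: lin_on_def distrib_left distrib_right pm_scale_mult_left pm_scale_mult_right)

lemma lookup_conjugate:
  fixes a :: "'g::group_add \<Rightarrow>\<^sub>0 'k::field"
  shows "Poly_Mapping.lookup (kbasis g * a * kbasis (- g)) k = Poly_Mapping.lookup a (- g + k + g)"
proof (induction a rule: kG_induct)
  case zero
  then show ?case by simp
next
  case (add a h c)
  have "g + h - g = k \<longleftrightarrow> h = - g + k + g"
    by (metis add.assoc add_diff_cancel diff_add_cancel minus_add_cancel add_minus_cancel)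
  then show ?case
    using add by (simp add: distrib_left distrib_right lookup_add mult_single lookup_single when_def)
qed

lemma lin_on_kG_tensor_eqI:
  fixes f f' :: "(('g::group_add \<Rightarrow>\<^sub>0 'k::field) \<times> 'v \<Rightarrow>\<^sub>0 'k) set \<Rightarrow> 'u"
  assumes X: "kmodule X" and U: "kmodule U"
    and f: "lin_on (kG_tensor X) U f" and f': "lin_on (kG_tensor X) U f'"
    and eq: "\<And>g x. x \<in> car X \<Longrightarrow> f (kG_pure X (kbasis g) x) = f' (kG_pure X (kbasis g) x)"
    and t: "t \<in> car (kG_tensor X)"
  shows "f t = f' t"
proof (rule lin_on_tensor_eqI[OF kmodule_kG X U f f' _ t])
  fix a x assume x: "x \<in> car X"
  show "f (kG_pure X a x) = f' (kG_pure X a x)"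
    using lin_on_kG_eqI[OF U lin_on_comp[OF lin_on_pure_left[OF kmodule_kG X x] f]
      lin_on_comp[OF lin_on_pure_left[OF kmodule_kG X x] f']] eq[OF x] by blast
qed

section \<open>The Yetter-Drinfeld axioms in coordinates\<close>

text \<open>The coordinates of the coaction: \<open>coact X x\<close> is the sum of g \<otimes>
  \<open>gr X g x\<close>.\<close>

definition gr :: "('k::field, 'g::group_add \<Rightarrow>\<^sub>0 'k, 'v) ydmod \<Rightarrow> 'g \<Rightarrow> 'v \<Rightarrow> 'v" where
  "gr X g x = coef X g (coact X x)"

definition rho :: "('k::field, 'g::group_add \<Rightarrow>\<^sub>0 'k, 'v) ydmod \<Rightarrow> 'g \<Rightarrow> 'v \<Rightarrow> 'v" where
  "rho X g x = act X (kbasis g) x"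

context
  fixes X :: "('k::field, 'g::group_add \<Rightarrow>\<^sub>0 'k, 'v) ydmod"
  assumes X: "kmodule X"
begin

private abbreviation KX where "KX \<equiv> kG_tensor X"
private abbreviation A :: "('k, 'g \<Rightarrow>\<^sub>0 'k) kmod" where "A \<equiv> kG_module"

lemma bilin_counit: "bilin A X X (\<lambda>h. vsmult X (counit group_hopf h))"
  using X by (intro bilinI lin_onI)
    (simp_all add: counit_group_hopf kmod_add_smult kmod_smult_add mult.commute flip: kmod_mult_smult)

lemma bilin_coact_right:
  assumes "lin_on X KX (coact X)"
  shows "bilin A X (kG_tensor KX) (\<lambda>h y. pure A KX h (coact X y))"
  using X assms
  by (intro bilinI) (auto intro: lin_on_pure_left lin_on_comp[OF assms lin_on_pure_right] lin_on_closed)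

lemma coef_coact_right:
  assumes "lin_on X KX (coact X)" "t \<in> car KX"
  shows "coef KX g (tensor_lift A X (kG_tensor KX) (\<lambda>h y. pure A KX h (coact X y)) t) =
    coact X (coef X g t)"
proof -
  note \<beta> = bilin_coact_right[OF assms(1)]
  have KX: "kmodule KX" "kmodule (kG_tensor KX)" using X by simp_all
  show ?thesis
  proof (rule lin_on_tensor_eqI[OF kmodule_kG X KX(1) _ _ _ assms(2)])
    show "lin_on KX KX (\<lambda>t. coef KX g (tensor_lift A X (kG_tensor KX) (\<lambda>h y. pure A KX h (coact X y)) t))"
      using lin_on_tensor_lift[OF kmodule_kG X KX(2) \<beta>] lin_on_coef[OF KX(1)] by (rule lin_on_comp)
    show "lin_on KX KX (\<lambda>t. coact X (coef X g t))"
      using lin_on_coef[OF X] assms(1) by (rule lin_on_comp)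
  qed (simp add: tensor_lift_pure[OF kmodule_kG X KX(2) \<beta>] coef_pure X KX(1)
      lin_on_closed[OF assms(1)] lin_on_smult[OF assms(1)])
qed

lemma bilin_pure_pure:
  assumes "y \<in> car X"
  shows "bilin A A (kG_tensor KX) (\<lambda>a b. pure A KX a (pure A X b y))"
  using X assms
  by (intro bilinI) (auto intro: lin_on_pure_left lin_on_comp[OF lin_on_pure_left lin_on_pure_right])

lemma bilin_comult_left:
  "bilin A X (kG_tensor KX)
     (\<lambda>h y. tensor_lift A A (kG_tensor KX) (\<lambda>a b. pure A KX a (pure A X b y)) (comult group_hopf h))"
proof (rule bilinI)
  fix y assume "y \<in> car X"
  then show "lin_on A (kG_tensor KX) (\<lambda>h. tensor_lift A A (kG_tensor KX)
      (\<lambda>a b. pure A KX a (pure A X b y)) (comult group_hopf h))"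
    using X by (intro lin_on_comp[OF comult_group_hopf(1)] lin_on_tensor_lift bilin_pure_pure) auto
next
  fix h :: "'g \<Rightarrow>\<^sub>0 'k"
  show "lin_on X (kG_tensor KX) (\<lambda>y. tensor_lift A A (kG_tensor KX)
      (\<lambda>a b. pure A KX a (pure A X b y)) (comult group_hopf h))"
    using X lin_on_closed[OF comult_group_hopf(1), of h]
    by (intro lin_on_tensor_lift_param bilin_pure_pure)
      (auto intro: lin_on_comp[OF lin_on_pure_right lin_on_pure_right])
qed

text \<open>Because \<Delta> g = g \<otimes> g, applying \<Delta> to the left factor produces a
  tensor concentrated on the diagonal of the two degrees.\<close>

lemma coef_coef_comult_left:
  assumes "t \<in> car KX"
  shows "coef X k (coef KX g (tensor_lift A X (kG_tensor KX)
     (\<lambda>h y. tensor_lift A A (kG_tensor KX) (\<lambda>a b. pure A KX a (pure A X b y)) (comult group_hopf h)) t)) =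
    (if k = g then coef X g t else vzero X)"
proof -
  note \<beta> = bilin_comult_left
  have KX: "kmodule KX" "kmodule (kG_tensor KX)" using X by simp_all
  show ?thesis
  proof (rule lin_on_kG_tensor_eqI[OF X X _ _ _ assms])
    show "lin_on KX X (\<lambda>t. coef X k (coef KX g (tensor_lift A X (kG_tensor KX) (\<lambda>h y.
        tensor_lift A A (kG_tensor KX) (\<lambda>a b. pure A KX a (pure A X b y)) (comult group_hopf h)) t)))"
      using lin_on_tensor_lift[OF kmodule_kG X KX(2) \<beta>] lin_on_comp[OF lin_on_coef[OF KX(1)] lin_on_coef[OF X]]
      by (rule lin_on_comp)
    show "lin_on KX X (\<lambda>t. if k = g then coef X g t else vzero X)"
      using lin_on_coef[OF X] lin_on_const_zero[OF X] by (cases "k = g") auto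
  qed (use X KX in \<open>auto simp: tensor_lift_pure[OF kmodule_kG X KX(2) \<beta>] comult_group_hopf(2)
      tensor_lift_pure[OF kmodule_kG kmodule_kG KX(2) bilin_pure_pure] coef_pure[OF X] coef_pure[OF KX(1)]
      coef_zero lookup_single when_def\<close>)
qed

text \<open>Taking coefficients twice turns coassociativity into the statement that the maps
  \<open>gr X g\<close> are pairwise orthogonal idempotents.\<close>

lemma left_comodule_group_hopf_iff:
  "left_comodule group_hopf X \<longleftrightarrow> klinear X KX (coact X) \<and>
     (\<forall>x\<in>car X. tensor_lift A X X (\<lambda>h. vsmult X (counit group_hopf h)) (coact X x) = x) \<and>
     (\<forall>x\<in>car X. \<forall>g k. gr X k (gr X g x) = (if k = g then gr X g x else vzero X))"
proof -
  have KX: "kmodule KX" "kmodule (kG_tensor KX)" using X by simp_all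
  have "tensor_lift A X (kG_tensor KX) (\<lambda>h y. pure A KX h (coact X y)) (coact X x) =
    tensor_lift A X (kG_tensor KX) (\<lambda>h y. tensor_lift A A (kG_tensor KX)
      (\<lambda>a b. pure A KX a (pure A X b y)) (comult group_hopf h)) (coact X x) \<longleftrightarrow>
    (\<forall>g k. gr X k (gr X g x) = (if k = g then gr X g x else vzero X))" (is "?l = ?r \<longleftrightarrow> _")
    if lin: "lin_on X KX (coact X)" and x: "x \<in> car X" for x
  proof -
    note cx = lin_on_closed[OF lin x]
    have l: "?l \<in> car (kG_tensor KX)" and r: "?r \<in> car (kG_tensor KX)"
      using tensor_lift_in[OF kmodule_kG X KX(2) bilin_coact_right[OF lin] cx]
        tensor_lift_in[OF kmodule_kG X KX(2) bilin_comult_left cx] by auto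
    have "?l = ?r \<longleftrightarrow> (\<forall>g. coef KX g ?l = coef KX g ?r)"
      using coef_eqI[OF KX(1) l r] by auto
    also have "\<dots> \<longleftrightarrow> (\<forall>g k. coef X k (coef KX g ?l) = coef X k (coef KX g ?r))"
      using coef_eqI[OF X coef_in[OF KX(1) l] coef_in[OF KX(1) r]] by auto
    also have "\<dots> \<longleftrightarrow> (\<forall>g k. gr X k (gr X g x) = (if k = g then gr X g x else vzero X))"
      by (simp add: coef_coact_right[OF lin cx] coef_coef_comult_left[OF cx] gr_def)
    finally show ?thesis .
  qed
  then show ?thesis
    unfolding left_comodule_def Let_def hmod_group_hopf by (meson klinear_lin_on)
qed

text \<open>Conjugation by \<open>g\<close> moves the coefficient at degree
  \<open>- g + k + g\<close> to degree \<open>k\<close>.\<close>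

lemma coef_lift_conjugate:
  assumes f: "lin_on X X f" and t: "t \<in> car KX"
  shows "coef X k (tensor_lift A X KX (\<lambda>a y. pure A X (kbasis g * a * kbasis (- g)) (f y)) t) =
    f (coef X (- g + k + g) t)"
proof -
  have KX: "kmodule KX" using X by simp
  have \<beta>: "bilin A X KX (\<lambda>a y. pure A X (kbasis g * a * kbasis (- g)) (f y))"
    using lin_on_closed[OF f] X
    by (intro bilinI lin_on_comp[OF f] lin_on_pure_right lin_on_comp[OF _ lin_on_pure_left]
        lin_on_mult_left lin_on_mult_right lin_on_id) auto
  show ?thesis
  proof (rule lin_on_tensor_eqI[OF kmodule_kG X X _ _ _ t])
    show "lin_on KX X (\<lambda>t. coef X k (tensor_lift A X KX (\<lambda>a y. pure A X (kbasis g * a * kbasis (- g)) (f y)) t))"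
      using lin_on_tensor_lift[OF kmodule_kG X KX \<beta>] lin_on_coef[OF X] by (rule lin_on_comp)
    show "lin_on KX X (\<lambda>t. f (coef X (- g + k + g) t))"
      using lin_on_coef[OF X] f by (rule lin_on_comp)
  qed (simp add: tensor_lift_pure[OF kmodule_kG X KX \<beta>] coef_pure X lookup_conjugate
      lin_on_closed[OF f] lin_on_smult[OF f])
qed

lemma lin_on_act_left:
  assumes "left_module group_hopf X" "x \<in> car X"
  shows "lin_on A X (\<lambda>h. act X h x)"
  using assms by (intro lin_onI) (auto simp: left_module_def klinear_def group_hopf_def)

lemma lin_on_act_right:
  assumes "left_module group_hopf X"
  shows "lin_on X X (act X h)"
  using assms by (auto simp: left_module_def klinear_lin_on)

lemma lin_on_antipode: "lin_on A A (antipode group_hopf)"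
  by (rule lin_onI) (simp_all add: antipode_group_hopf)

text \<open>Both sides of the compatibility condition are linear in \<open>h\<close>, so basis
  elements suffice. There all three Sweedler legs equal \<open>g\<close>, and the right-hand side
  becomes conjugation by \<open>g\<close>.\<close>

lemma yd_compatible_group_hopf_iff:
  assumes m: "left_module group_hopf X" and lin: "lin_on X KX (coact X)"
  shows "yd_compatible group_hopf X \<longleftrightarrow>
    (\<forall>x\<in>car X. \<forall>g k. gr X k (rho X g x) = rho X g (gr X (- g + k + g) x))"
proof -
  have KX: "kmodule KX" using X by simp
  note act_closed = lin_on_closed[OF lin_on_act_right[OF m]]
  \<comment> \<open>The legs are kept as independent arguments, so that linearity in each can be
    proved before all of them are specialised to \<open>g\<close>.\<close>
  define conj3 where "conj3 x h1 h2 h3 = tensor_lift A X KX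
      (\<lambda>a y. pure A X (h1 * a * antipode group_hopf h3) (act X h2 y)) (coact X x)" for x h1 h2 h3
  define rhs where "rhs x h = tensor_lift A A KX (\<lambda>h1 h'. tensor_lift A A KX (conj3 x h1)
      (comult group_hopf h')) (comult group_hopf h)" for x h
  have compat: "yd_compatible group_hopf X \<longleftrightarrow>
      (\<forall>h. \<forall>x\<in>car X. coact X (act X h x) = rhs x h)"
    unfolding yd_compatible_def Let_def hmod_group_hopf rhs_def conj3_def ..
  have \<beta>1: "bilin A X KX (\<lambda>a y. pure A X (h1 * a * antipode group_hopf h3) (act X h2 y))" for h1 h2 h3
    using X by (intro bilinI lin_on_comp[OF lin_on_act_right[OF m]] lin_on_pure_right
        lin_on_comp[OF _ lin_on_pure_left] lin_on_mult_left lin_on_mult_right lin_on_id) (auto intro: act_closed)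
  have \<beta>2: "bilin A A KX (conj3 x h1)" if "x \<in> car X" for x h1
    unfolding conj3_def using X KX lin_on_closed[OF lin that]
    by (intro bilinI lin_on_tensor_lift_param \<beta>1 lin_on_comp[OF lin_on_act_left[OF m]] lin_on_pure_right
        lin_on_comp[OF _ lin_on_pure_left] lin_on_mult_left lin_on_mult_right lin_on_antipode) (auto intro: act_closed)
  have c: "comult group_hopf h \<in> car (kG_tensor A)" for h :: "'g \<Rightarrow>\<^sub>0 'k"
    using lin_on_closed[OF comult_group_hopf(1)] by simp
  have conj3_1: "lin_on A KX (\<lambda>h1. conj3 x h1 h2 h3)" if "x \<in> car X" for x h2 h3
    unfolding conj3_def using X KX lin_on_closed[OF lin that]
    by (intro lin_on_tensor_lift_param \<beta>1
        lin_on_comp[OF _ lin_on_pure_left] lin_on_mult_left lin_on_id) (auto intro: act_closed)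
  have \<beta>3: "bilin A A KX (\<lambda>h1 h'. tensor_lift A A KX (conj3 x h1) (comult group_hopf h'))"
    if "x \<in> car X" for x
    using KX that by (intro bilinI lin_on_comp[OF comult_group_hopf(1)] lin_on_tensor_lift
        lin_on_tensor_lift_param \<beta>2 c conj3_1) auto
  have rhs_lin: "lin_on A KX (rhs x)" if "x \<in> car X" for x
    unfolding rhs_def using KX that
    by (intro lin_on_comp[OF comult_group_hopf(1)] lin_on_tensor_lift \<beta>3) auto
  have rhs_basis: "rhs x (kbasis g) = tensor_lift A X KX
      (\<lambda>a y. pure A X (kbasis g * a * kbasis (- g)) (act X (kbasis g) y)) (coact X x)"
    if "x \<in> car X" for x g
    using that KX
    by (simp add: rhs_def comult_group_hopf(2) tensor_lift_pure[OF kmodule_kG kmodule_kG KX \<beta>3]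
        tensor_lift_pure[OF kmodule_kG kmodule_kG KX \<beta>2] conj3_def antipode_group_hopf)
  have "(\<forall>h. coact X (act X h x) = rhs x h) \<longleftrightarrow>
      (\<forall>g k. gr X k (rho X g x) = rho X g (gr X (- g + k + g) x))" if x: "x \<in> car X" for x
  proof -
    note cx = lin_on_closed[OF lin x]
    have "(\<forall>h. coact X (act X h x) = rhs x h) \<longleftrightarrow> (\<forall>g. coact X (act X (kbasis g) x) = rhs x (kbasis g))"
      using lin_on_kG_eqI[OF KX lin_on_comp[OF lin_on_act_left[OF m x] lin] rhs_lin[OF x]] by auto
    also have "\<dots> \<longleftrightarrow> (\<forall>g k. coef X k (coact X (act X (kbasis g) x)) = coef X k (rhs x (kbasis g)))"
      using coef_eqI[OF X lin_on_closed[OF lin act_closed[OF x]] lin_on_closed[OF rhs_lin[OF x]]] by auto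
    also have "\<dots> \<longleftrightarrow> (\<forall>g k. gr X k (rho X g x) = rho X g (gr X (- g + k + g) x))"
      by (simp add: rhs_basis x coef_lift_conjugate[OF lin_on_act_right[OF m] cx] gr_def rho_def)
    finally show ?thesis .
  qed
  with compat show ?thesis by blast
qed

text \<open>The counit lift adds up the coefficients of \<open>t\<close>. If each coefficient is
  homogeneous of its own degree, they are the homogeneous components of that sum. Applied to
  \<open>coact X x\<close>, this recovers the counit axiom from injectivity of the family of
  projections.\<close>

lemma counit_lift_homogeneous:
  assumes lin: "\<And>g. lin_on X X (gr X g)"
    and t: "t \<in> car KX" "\<And>g k. gr X k (coef X g t) = (if k = g then coef X g t else vzero X)"
  shows "gr X k (tensor_lift A X X (\<lambda>h. vsmult X (counit group_hopf h)) t) = coef X k t"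
proof -
  let ?L = "tensor_lift A X X (\<lambda>h. vsmult X (counit group_hopf h))"
  note L = lin_on_tensor_lift[OF kmodule_kG X X bilin_counit]
  from t(1) have "(\<forall>g k. gr X k (coef X g t) = (if k = g then coef X g t else vzero X)) \<longrightarrow>
      gr X k (?L t) = coef X k t"
  proof (induction rule: kG_tensor_induct[OF X, consumes 1, case_names zero add])
    case zero
    then show ?case
      using X lin_on_zero[OF L _ X] lin_on_zero[OF lin X X] by (simp add: coef_zero)
  next
    case (add t g x)
    show ?case
    proof
      assume *: "\<forall>h k. gr X k (coef X h (vadd KX t (kG_pure X (kbasis g) x))) =
        (if k = h then coef X h (vadd KX t (kG_pure X (kbasis g) x)) else vzero X)"
      have c: "coef X h (vadd KX t (kG_pure X (kbasis g) x)) = (if h = g then x else coef X h t)" for h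
        using add X by (auto simp: coef_add coef_pure coef_in lookup_single when_def)
      have x: "gr X k x = (if k = g then x else vzero X)"
        using *[rule_format, of k g] by (simp add: c)
      have "gr X k (coef X h t) = (if k = h then coef X h t else vzero X)" for h k
        using *[rule_format, of k h] lin_on_zero[OF lin X X] add(3) by (cases "h = g") (auto simp: c)
      with add have IH: "gr X k (?L t) = coef X k t" by blast
      have "?L (vadd KX t (kG_pure X (kbasis g) x)) = vadd X (?L t) x"
        using add X lin_on_add[OF L]
        by (simp add: tensor_lift_pure[OF kmodule_kG X X bilin_counit] counit_group_hopf)
      then show "gr X k (?L (vadd KX t (kG_pure X (kbasis g) x))) =
          coef X k (vadd KX t (kG_pure X (kbasis g) x))"
        using add X lin_on_closed[OF L] lin_on_add[OF lin]
        by (auto simp: IH x c coef_in)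
    qed
  qed
  with t(2) show ?thesis by blast
qed

lemma lin_on_coact_iff:
  assumes "\<And>x. x \<in> car X \<Longrightarrow> coact X x \<in> car KX"
  shows "lin_on X KX (coact X) \<longleftrightarrow> (\<forall>g. lin_on X X (gr X g))"
proof
  assume "lin_on X KX (coact X)"
  then show "\<forall>g. lin_on X X (gr X g)"
    by (auto simp: gr_def[abs_def] intro: lin_on_comp[OF _ lin_on_coef[OF X]])
next
  assume lin: "\<forall>g. lin_on X X (gr X g)"
  have KX: "kmodule KX" using X by simp
  show "lin_on X KX (coact X)"
  proof (rule lin_onI)
    fix x y assume xy: "x \<in> car X" "y \<in> car X"
    show "coact X (vadd X x y) = vadd KX (coact X x) (coact X y)"
      using assms xy X KX lin_on_add[OF spec[OF lin] xy]
      by (intro coef_eqI[OF X]) (auto simp: coef_add gr_def)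
  next
    fix x c assume x: "x \<in> car X"
    show "coact X (vsmult X c x) = vsmult KX c (coact X x)"
      using assms x X KX lin_on_smult[OF spec[OF lin] x]
      by (intro coef_eqI[OF X]) (auto simp: lin_on_smult[OF lin_on_coef[OF X]] gr_def)
  qed (rule assms)
qed

end

text \<open>
  A Yetter-Drinfeld module over \<open>k[G]\<close> amounts to a \<open>G\<close>-graded module with a \<open>G\<close>-action such that
  \<open>g\<close> maps degree \<open>h\<close> to degree \<open>g h g\<^sup>-\<^sup>1\<close>; \<open>gr X g\<close> is the projection onto degree \<open>g\<close>.
\<close>

lemma yd_module_group_hopf_iff:
  fixes X :: "('k::field, 'g::group_add \<Rightarrow>\<^sub>0 'k, 'v) ydmod"
  shows "yd_module group_hopf X \<longleftrightarrow>
    ext_kmodule X \<and> left_module group_hopf X \<and> coact X \<in> car X \<rightarrow>\<^sub>E car (kG_tensor X) \<and>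
    (\<forall>g. lin_on X X (gr X g)) \<and>
    (\<forall>x\<in>car X. \<forall>g k. gr X k (gr X g x) = (if k = g then gr X g x else vzero X)) \<and>
    (\<forall>x\<in>car X. \<forall>g k. gr X k (rho X g x) = rho X g (gr X (- g + k + g) x)) \<and>
    (\<forall>x\<in>car X. \<forall>y\<in>car X. (\<forall>g. gr X g x = gr X g y) \<longrightarrow> x = y)" (is "_ \<longleftrightarrow> ?R")
proof
  assume yd: "yd_module group_hopf X"
  then have X: "kmodule X" and m: "left_module group_hopf X"
    by (auto simp: yd_module_def ext_kmodule_def)
  from yd have k: "klinear X (kG_tensor X) (coact X)"
    by (simp add: yd_module_def left_comodule_group_hopf_iff[OF X])
  \<comment> \<open>Equal components give equal coactions, and the counit axiom recovers an element
    from its coaction.\<close>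
  have "x = y" if xy: "x \<in> car X" "y \<in> car X" "\<forall>g. gr X g x = gr X g y" for x y
  proof -
    have "coact X x = coact X y"
      using xy lin_on_closed[OF klinear_lin_on[OF k]] by (intro coef_eqI[OF X]) (auto simp: gr_def)
    then show ?thesis
      using yd xy by (metis yd_module_def left_comodule_group_hopf_iff[OF X])
  qed
  moreover have "coact X \<in> car X \<rightarrow>\<^sub>E car (kG_tensor X)"
    using k by (simp add: klinear_def)
  moreover from this have "\<forall>g. lin_on X X (gr X g)"
    using lin_on_coact_iff[OF X] klinear_lin_on[OF k] by blast
  ultimately show ?R
    using yd yd_compatible_group_hopf_iff[OF X m klinear_lin_on[OF k]]
    by (auto simp: yd_module_def left_comodule_group_hopf_iff[OF X])
next
  assume R: ?R
  then have X: "kmodule X" by (auto simp: ext_kmodule_def)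
  have lin: "lin_on X (kG_tensor X) (coact X)"
    using R lin_on_coact_iff[OF X] by (auto simp: PiE_def Pi_def)
  \<comment> \<open>Both sides have the same components, so the separation clause of the right-hand
    side yields the counit axiom.\<close>
  have "tensor_lift kG_module X X (\<lambda>h. vsmult X (counit group_hopf h)) (coact X x) = x"
    if x: "x \<in> car X" for x
  proof -
    have "gr X k (tensor_lift kG_module X X (\<lambda>h. vsmult X (counit group_hopf h)) (coact X x)) = gr X k x" for k
      using counit_lift_homogeneous[OF X _ lin_on_closed[OF lin x]] R x by (simp add: gr_def)
    then show ?thesis
      using R x tensor_lift_in[OF kmodule_kG X X bilin_counit[OF X] lin_on_closed[OF lin x]] by blast
  qed
  then show "yd_module group_hopf X"
    using R lin yd_compatible_group_hopf_iff[OF X _ lin]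
    by (auto simp: yd_module_def left_comodule_group_hopf_iff[OF X] klinear_iff_lin_on PiE_def)
qed

text \<open>Linearity in \<open>h\<close> reduces equivariance to group elements, and comparison of
  coefficients reduces colinearity to compatibility with the projections.\<close>

lemma yd_morphism_group_hopf_iff:
  fixes X Y :: "('k::field, 'g::group_add \<Rightarrow>\<^sub>0 'k, 'v) ydmod"
  assumes X: "yd_module group_hopf X" and Y: "yd_module group_hopf Y"
  shows "yd_morphism group_hopf X Y f \<longleftrightarrow> klinear X Y f \<and>
    (\<forall>g. \<forall>x\<in>car X. f (rho X g x) = rho Y g (f x)) \<and>
    (\<forall>g. \<forall>x\<in>car X. f (gr X g x) = gr Y g (f x))"
proof (cases "klinear X Y f")
  case True
  then have f: "lin_on X Y f" by (rule klinear_lin_on)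
  have kX: "kmodule X" and kY: "kmodule Y" and mX: "left_module group_hopf X"
    and mY: "left_module group_hopf Y"
    using X Y by (auto simp: yd_module_def ext_kmodule_def)
  then have TX: "kmodule (kG_tensor X)" and TY: "kmodule (kG_tensor Y)"
    by simp_all
  have cX: "coact X x \<in> car (kG_tensor X)" if "x \<in> car X" for x
    using X that by (auto simp: yd_module_group_hopf_iff)
  have cY: "coact Y x \<in> car (kG_tensor Y)" if "x \<in> car Y" for x
    using Y that by (auto simp: yd_module_group_hopf_iff)
  have 1: "(\<forall>h. f (act X h x) = act Y h (f x)) \<longleftrightarrow> (\<forall>g. f (rho X g x) = rho Y g (f x))"
    if x: "x \<in> car X" for x
    using lin_on_kG_eqI[OF kY lin_on_comp[OF lin_on_act_left[OF kX mX x] f]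
        lin_on_act_left[OF kY mY lin_on_closed[OF f x]]] by (auto simp: rho_def)
  have \<beta>: "bilin kG_module X (kG_tensor Y) (\<lambda>h y. kG_pure Y h (f y))"
    using kX kY lin_on_closed[OF f] by (intro bilinI lin_on_comp[OF f] lin_on_pure_right lin_on_pure_left) auto
  have coef: "coef Y g (tensor_lift kG_module X (kG_tensor Y) (\<lambda>h y. kG_pure Y h (f y)) t) = f (coef X g t)"
    if t: "t \<in> car (kG_tensor X)" for g t
  proof (rule lin_on_tensor_eqI[OF kmodule_kG kX kY _ _ _ t])
    show "lin_on (kG_tensor X) Y (\<lambda>t. coef Y g (tensor_lift kG_module X (kG_tensor Y) (\<lambda>h y. kG_pure Y h (f y)) t))"
      using lin_on_tensor_lift[OF kmodule_kG kX TY \<beta>] lin_on_coef[OF kY] by (rule lin_on_comp)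
    show "lin_on (kG_tensor X) Y (\<lambda>t. f (coef X g t))"
      using lin_on_coef[OF kX] f by (rule lin_on_comp)
  qed (simp add: tensor_lift_pure[OF kmodule_kG kX TY \<beta>] coef_pure kX kY
      lin_on_closed[OF f] lin_on_smult[OF f])
  have 2: "tensor_lift kG_module X (kG_tensor Y) (\<lambda>h y. kG_pure Y h (f y)) (coact X x) = coact Y (f x) \<longleftrightarrow>
      (\<forall>g. f (gr X g x) = gr Y g (f x))" (is "?l = ?r \<longleftrightarrow> _") if x: "x \<in> car X" for x
  proof -
    have "?l = ?r \<longleftrightarrow> (\<forall>g. coef Y g ?l = coef Y g ?r)"
      using coef_eqI[OF kY tensor_lift_in[OF kmodule_kG kX TY \<beta> cX[OF x]] cY[OF lin_on_closed[OF f x]]]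
      by auto
    then show ?thesis by (simp add: coef cX x gr_def)
  qed
  show ?thesis
    unfolding yd_morphism_def hmod_group_hopf using True 1 2 by blast
qed (simp add: yd_morphism_def)

section \<open>Consequences of the graded description\<close>

context
  fixes X :: "('k::field, 'g::group_add \<Rightarrow>\<^sub>0 'k, 'v) ydmod"
  assumes yd: "yd_module group_hopf X"
begin

lemma yd_ext_kmodule: "ext_kmodule X"
  and yd_kmodule: "kmodule X"
  and yd_left_module: "left_module group_hopf X"
  and yd_coact: "coact X \<in> car X \<rightarrow>\<^sub>E car (kG_tensor X)"
  and yd_lin_on_gr: "lin_on X X (gr X g)"
  and yd_gr_gr: "x \<in> car X \<Longrightarrow> gr X k (gr X g x) = (if k = g then gr X g x else vzero X)"
  and yd_gr_rho: "x \<in> car X \<Longrightarrow> gr X k (rho X g x) = rho X g (gr X (- g + k + g) x)"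
  and yd_eqI: "x \<in> car X \<Longrightarrow> y \<in> car X \<Longrightarrow> (\<And>g. gr X g x = gr X g y) \<Longrightarrow> x = y"
  using yd by (auto simp: yd_module_group_hopf_iff ext_kmodule_def)

lemma yd_lin_on_rho: "lin_on X X (rho X g)"
  unfolding rho_def[abs_def] by (rule lin_on_act_right[OF yd_kmodule yd_left_module])

lemma yd_rho_zero: "x \<in> car X \<Longrightarrow> rho X 0 x = x"
  using yd_left_module by (simp add: rho_def left_module_def flip: single_one)

lemma yd_rho_add: "x \<in> car X \<Longrightarrow> rho X (g + h) x = rho X g (rho X h x)"
  using yd_left_module
  by (metis (no_types, lifting) left_module_def mult.right_neutral mult_single rho_def)

lemma yd_gr_in: "x \<in> car X \<Longrightarrow> gr X g x \<in> car X"
  and yd_rho_in: "x \<in> car X \<Longrightarrow> rho X g x \<in> car X"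
  using lin_on_closed[OF yd_lin_on_gr] lin_on_closed[OF yd_lin_on_rho] by auto

lemma yd_gr_zero: "gr X g (vzero X) = vzero X"
  using lin_on_zero[OF yd_lin_on_gr yd_kmodule yd_kmodule] .

lemma yd_finite_gr: "x \<in> car X \<Longrightarrow> finite {g. gr X g x \<noteq> vzero X}"
  using finite_coef[OF yd_kmodule] yd_coact by (auto simp: gr_def)

lemma yd_gr_homogeneous:
  assumes "x \<in> car X" "gr X g x = x"
  shows "gr X k x = (if k = g then x else vzero X)"
  using yd_gr_gr[OF assms(1), of k g] assms(2) by simp

text \<open>The element is the sum of the family, built one degree at a time; it is unique because
  the projections separate points.\<close>

lemma yd_assemble:
  assumes "\<And>g. p g \<in> car X" "\<And>g. gr X g (p g) = p g" "finite {g. p g \<noteq> vzero X}"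
  shows "\<exists>!x. x \<in> car X \<and> (\<forall>g. gr X g x = p g)"
proof (rule ex_ex1I)
  have "finite S \<Longrightarrow> \<exists>x\<in>car X. \<forall>g. gr X g x = (if g \<in> S then p g else vzero X)" for S
  proof (induction S rule: finite_induct)
    case empty
    show ?case by (rule bexI[of _ "vzero X"]) (auto simp: yd_gr_zero yd_kmodule)
  next
    case (insert h S)
    then obtain x where "x \<in> car X" "\<forall>g. gr X g x = (if g \<in> S then p g else vzero X)"
      by auto
    with insert assms(1,2) yd_kmodule show ?case
      by (intro bexI[of _ "vadd X x (p h)"])
        (auto simp: lin_on_add[OF yd_lin_on_gr] yd_gr_homogeneous[of "p h" h])
  qed
  from this[OF assms(3)] obtain x where "x \<in> car X"
    and x: "\<And>g. gr X g x = (if p g \<noteq> vzero X then p g else vzero X)"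
    by auto
  moreover have "gr X g x = p g" for g
    using x[of g] by (cases "p g = vzero X") simp_all
  ultimately show "\<exists>x. x \<in> car X \<and> (\<forall>g. gr X g x = p g)" by blast
qed (auto intro: yd_eqI)

end

section \<open>Equality and construction of Yetter-Drinfeld modules\<close>

text \<open>Tensor products see only the underlying module. This allows facts about a module to be
  used for a \<open>ydmod\<close> record built on it.\<close>

lemma tensor_truncate: "tensor V (kmod.truncate W) = tensor V W"
  by (simp add: kmod.truncate_def tensor_def tensor_class_def bilinear_relators_def)

lemma coef_truncate: "coef (kmod.truncate W) = coef W"
  by (intro ext) (simp add: coef_def tensor_lift_def tensor_truncate klinear_def pure_def
      tensor_class_def bilinear_relators_def, simp add: kmod.truncate_def)

lemma kmod_truncate_eq_iff:
  "kmod.truncate V = kmod.truncate W \<longleftrightarrow>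
    car V = car W \<and> vadd V = vadd W \<and> vzero V = vzero W \<and> vsmult V = vsmult W"
  by (auto simp: kmod.truncate_def)

text \<open>An action is determined by the group elements and a coaction by its coefficients;
  outside the carrier both are \<open>undefined\<close>. This gives literal equality of records, as
  equality of objects demands.\<close>

lemma yd_module_eqI:
  fixes X Y :: "('k::field, 'g::group_add \<Rightarrow>\<^sub>0 'k, 'v) ydmod"
  assumes X: "yd_module group_hopf X" and Y: "yd_module group_hopf Y"
    and eq: "kmod.truncate X = kmod.truncate Y"
    and rho: "\<And>g x. x \<in> car X \<Longrightarrow> rho X g x = rho Y g x"
    and gr: "\<And>g x. x \<in> car X \<Longrightarrow> gr X g x = gr Y g x"
  shows "X = Y"
proof -
  note eqs = eq[unfolded kmod_truncate_eq_iff]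
  note kX = yd_kmodule[OF X] and kY = yd_kmodule[OF Y]
  have Y': "lin_on kG_module X (\<lambda>h. act Y h x)" if "x \<in> car X" for x
    using lin_on_act_left[OF kY yd_left_module[OF Y], of x] that eqs by (simp add: lin_on_def)
  have act: "act X h = act Y h" for h
  proof (rule extensionalityI[of _ "car X"])
    show "act X h \<in> extensional (car X)" "act Y h \<in> extensional (car X)"
      using yd_left_module[OF X] yd_left_module[OF Y] eqs
      by (auto simp: left_module_def klinear_iff_lin_on)
    show "act X h x = act Y h x" if x: "x \<in> car X" for x
      using lin_on_kG_eqI[OF kX lin_on_act_left[OF kX yd_left_module[OF X] x] Y'[OF x]] rho[OF x]
      by (simp add: rho_def)
  qed
  have T: "kG_tensor X = (kG_tensor Y :: ('k, (('g \<Rightarrow>\<^sub>0 'k) \<times> 'v \<Rightarrow>\<^sub>0 'k) set) kmod)"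
    and c: "coef X = (coef Y :: 'g \<Rightarrow> _)"
    by (metis eq tensor_truncate, metis eq coef_truncate)
  have coact: "coact X = coact Y"
  proof (rule extensionalityI[of _ "car X"])
    show "coact X \<in> extensional (car X)" "coact Y \<in> extensional (car X)"
      using yd_coact[OF X] yd_coact[OF Y] eqs by (auto simp: PiE_def)
    show "coact X x = coact Y x" if x: "x \<in> car X" for x
      using yd_coact[OF X] yd_coact[OF Y] eqs T gr[OF x] x
      by (intro coef_eqI[OF kX]) (auto simp: gr_def c)
  qed
  have "act X = act Y" using act by (rule ext)
  with coact eqs show ?thesis by (cases X, cases Y) simp
qed

text \<open>The coaction is prescribed through its coefficients: a tensor with coefficients
  \<open>\<pi> g x\<close> exists by \<open>coef_surj\<close> if they are finitely supported, and is
  unique by \<open>coef_eqI\<close>.\<close>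

definition mkyd ::
  "('k::field, 'v) kmod \<Rightarrow> ('g::group_add \<Rightarrow> 'v \<Rightarrow> 'v) \<Rightarrow> ('g \<Rightarrow> 'v \<Rightarrow> 'v) \<Rightarrow>
   ('k, 'g \<Rightarrow>\<^sub>0 'k, 'v) ydmod" where
  "mkyd V \<rho> \<pi> =
     \<lparr> car = car V, vadd = vadd V, vzero = vzero V, vsmult = vsmult V,
       act = (\<lambda>a. \<lambda>x\<in>car V. lin_ext V (\<lambda>g. \<rho> g x) a),
       coact = (\<lambda>x\<in>car V. THE t. t \<in> car (kG_tensor V) \<and> (\<forall>g. coef V g t = \<pi> g x)) \<rparr>"

lemma truncate_mkyd: "kmod.truncate (mkyd V \<rho> \<pi>) = V"
  by (simp add: mkyd_def kmod.truncate_def)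

lemma tensor_mkyd: "tensor W (mkyd V \<rho> \<pi>) = tensor W V"
  by (simp only: tensor_truncate[of W "mkyd V \<rho> \<pi>", symmetric] truncate_mkyd)

lemma coef_mkyd: "coef (mkyd V \<rho> \<pi>) = coef V"
  by (simp only: coef_truncate[of "mkyd V \<rho> \<pi>", symmetric] truncate_mkyd)

lemma mkyd_simps [simp]:
  "car (mkyd V \<rho> \<pi>) = car V" "vadd (mkyd V \<rho> \<pi>) = vadd V"
  "vzero (mkyd V \<rho> \<pi>) = vzero V" "vsmult (mkyd V \<rho> \<pi>) = vsmult V"
  by (simp_all add: mkyd_def)

context
  fixes V :: "('k::field, 'v) kmod" and \<rho> \<pi> :: "'g::group_add \<Rightarrow> 'v \<Rightarrow> 'v"
  assumes ext: "ext_kmodule V"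
    and \<rho>: "\<And>g. lin_on V V (\<rho> g)"
    and \<rho>_zero: "\<And>x. x \<in> car V \<Longrightarrow> \<rho> 0 x = x"
    and \<rho>_add: "\<And>g h x. x \<in> car V \<Longrightarrow> \<rho> (g + h) x = \<rho> g (\<rho> h x)"
    and \<pi>: "\<And>g. lin_on V V (\<pi> g)"
    and \<pi>_finite: "\<And>x. x \<in> car V \<Longrightarrow> finite {g. \<pi> g x \<noteq> vzero V}"
    and \<pi>_\<pi>: "\<And>x k g. x \<in> car V \<Longrightarrow> \<pi> k (\<pi> g x) = (if k = g then \<pi> g x else vzero V)"
    and \<pi>_\<rho>: "\<And>x k g. x \<in> car V \<Longrightarrow> \<pi> k (\<rho> g x) = \<rho> g (\<pi> (- g + k + g) x)"
    and \<pi>_inj: "\<And>x y. x \<in> car V \<Longrightarrow> y \<in> car V \<Longrightarrow> (\<And>g. \<pi> g x = \<pi> g y) \<Longrightarrow> x = y"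
begin

private lemma V: "kmodule V" using ext by (simp add: ext_kmodule_def)

lemma rho_mkyd: "x \<in> car V \<Longrightarrow> rho (mkyd V \<rho> \<pi>) g x = \<rho> g x"
  using lin_ext_single[OF V, of UNIV "\<lambda>g. \<rho> g x"] lin_on_closed[OF \<rho>] V
  by (simp add: rho_def mkyd_def)

lemma coact_mkyd:
  assumes "x \<in> car V"
  shows "coact (mkyd V \<rho> \<pi>) x \<in> car (kG_tensor V)" "coef V g (coact (mkyd V \<rho> \<pi>) x) = \<pi> g x"
proof -
  obtain t where "t \<in> car (kG_tensor V)" "\<forall>g. coef V g t = \<pi> g x"
    using coef_surj[OF V, of "\<lambda>g. \<pi> g x", OF lin_on_closed[OF \<pi> assms] \<pi>_finite[OF assms]]
    by blast
  then have "\<exists>!t. t \<in> car (kG_tensor V) \<and> (\<forall>g. coef V g t = \<pi> g x)"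
    by (intro ex1I[of _ t]) (simp_all add: coef_eqI[OF V])
  from theI'[OF this] assms
  show "coact (mkyd V \<rho> \<pi>) x \<in> car (kG_tensor V)" "coef V g (coact (mkyd V \<rho> \<pi>) x) = \<pi> g x"
    by (auto simp: mkyd_def)
qed

lemma gr_mkyd: "x \<in> car V \<Longrightarrow> gr (mkyd V \<rho> \<pi>) g x = \<pi> g x"
  by (simp add: gr_def coef_mkyd coact_mkyd(2))

private lemma act_mkyd_basis: "x \<in> car V \<Longrightarrow> act (mkyd V \<rho> \<pi>) (kbasis g) x = \<rho> g x"
  using rho_mkyd by (simp add: rho_def)

private lemma act_mkyd_left: "x \<in> car V \<Longrightarrow> lin_on kG_module V (\<lambda>h. act (mkyd V \<rho> \<pi>) h x)"
  using lin_on_lin_ext[OF V, of "\<lambda>g. \<rho> g x"] lin_on_closed[OF \<rho>] by (simp add: mkyd_def)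

private lemma act_mkyd_right: "lin_on V V (act (mkyd V \<rho> \<pi>) h)"
proof -
  have cl: "act (mkyd V \<rho> \<pi>) h x \<in> car V" if "x \<in> car V" for h x
    using lin_on_closed[OF act_mkyd_left[OF that]] by simp
  show ?thesis
  proof (rule lin_onI)
    fix x y assume xy: "x \<in> car V" "y \<in> car V"
    then show "act (mkyd V \<rho> \<pi>) h (vadd V x y) = vadd V (act (mkyd V \<rho> \<pi>) h x) (act (mkyd V \<rho> \<pi>) h y)"
      using V lin_on_kG_eqI[OF V act_mkyd_left[of "vadd V x y"]
          lin_on_plus[OF V act_mkyd_left[of x] act_mkyd_left[of y]], of h]
      by (simp add: act_mkyd_basis lin_on_add[OF \<rho>])
  next
    fix c x assume x: "x \<in> car V"
    then show "act (mkyd V \<rho> \<pi>) h (vsmult V c x) = vsmult V c (act (mkyd V \<rho> \<pi>) h x)"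
      using V lin_on_kG_eqI[OF V act_mkyd_left[of "vsmult V c x"] lin_on_scale[OF V act_mkyd_left[of x]], of c h]
      by (simp add: act_mkyd_basis lin_on_smult[OF \<rho>])
  qed (rule cl)
qed

lemma left_module_mkyd: "left_module group_hopf (mkyd V \<rho> \<pi>)"
proof -
  let ?a = "act (mkyd V \<rho> \<pi>)"
  have cl: "?a h x \<in> car V" if "x \<in> car V" for h x
    using lin_on_closed[OF act_mkyd_right that] .
  have "?a (h * h') x = ?a h (?a h' x)" if x: "x \<in> car V" for h h' x
  proof (rule lin_on_kG_eqI[OF V, of "\<lambda>h. ?a (h * h') x" "\<lambda>h. ?a h (?a h' x)" h])
    show "lin_on kG_module V (\<lambda>h. ?a (h * h') x)"
      by (rule lin_on_comp[OF _ act_mkyd_left[OF x]]) (intro lin_on_mult_left lin_on_id)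
    show "lin_on kG_module V (\<lambda>h. ?a h (?a h' x))"
      by (rule act_mkyd_left[OF cl[OF x]])
    fix g
    show "?a (kbasis g * h') x = ?a (kbasis g) (?a h' x)"
    proof (rule lin_on_kG_eqI[OF V, of "\<lambda>h'. ?a (kbasis g * h') x" "\<lambda>h'. ?a (kbasis g) (?a h' x)" h'])
      show "lin_on kG_module V (\<lambda>h'. ?a (kbasis g * h') x)"
        by (rule lin_on_comp[OF _ act_mkyd_left[OF x]]) (intro lin_on_mult_right lin_on_id)
      show "lin_on kG_module V (\<lambda>h'. ?a (kbasis g) (?a h' x))"
        by (rule lin_on_comp[OF act_mkyd_left[OF x] act_mkyd_right])
    qed (simp add: mult_single act_mkyd_basis x lin_on_closed[OF \<rho>] \<rho>_add)
  qed
  moreover have "klinear (mkyd V \<rho> \<pi>) (mkyd V \<rho> \<pi>) (?a h)" for h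
    using act_mkyd_right[of h] by (simp add: klinear_iff_lin_on lin_on_def) (simp add: mkyd_def)
  moreover have "?a 1 x = x" if "x \<in> car V" for x
    using act_mkyd_basis[OF that, of 0] \<rho>_zero[OF that] by (simp flip: single_one)
  ultimately show ?thesis
    using lin_on_add[OF act_mkyd_left] lin_on_smult[OF act_mkyd_left]
    by (simp add: left_module_def) (simp add: group_hopf_def)
qed

lemma yd_module_mkyd: "yd_module group_hopf (mkyd V \<rho> \<pi>)"
proof -
  have "coact (mkyd V \<rho> \<pi>) \<in> extensional (car V)"
    by (simp add: mkyd_def)
  moreover have "lin_on (mkyd V \<rho> \<pi>) (mkyd V \<rho> \<pi>) (gr (mkyd V \<rho> \<pi>) g)" for g
    using \<pi>[of g] V by (simp add: lin_on_def gr_mkyd)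
  moreover have "ext_kmodule (mkyd V \<rho> \<pi>)"
    using ext unfolding ext_kmodule_def kmodule_def mkyd_simps .
  ultimately show ?thesis
    using \<pi>_inj lin_on_closed[OF \<rho>] lin_on_closed[OF \<pi>] \<pi>_\<pi> \<pi>_\<rho>
    by (auto simp: yd_module_group_hopf_iff left_module_mkyd gr_mkyd rho_mkyd coact_mkyd(1) tensor_mkyd PiE_def Pi_def)
qed

end


section \<open>The categories\<close>

lemma is_categoryI:
  assumes "\<And>f. f \<in> arr C \<Longrightarrow> dom C f \<in> ob C \<and> cod C f \<in> ob C"
    and "\<And>a. a \<in> ob C \<Longrightarrow> ident C a \<in> arr C \<and> dom C (ident C a) = a \<and> cod C (ident C a) = a"
    and "\<And>f g. f \<in> arr C \<Longrightarrow> g \<in> arr C \<Longrightarrow> cod C f = dom C g \<Longrightarrow>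
      comp C g f \<in> arr C \<and> dom C (comp C g f) = dom C f \<and> cod C (comp C g f) = cod C g"
    and "\<And>f. f \<in> arr C \<Longrightarrow> comp C f (ident C (dom C f)) = f \<and> comp C (ident C (cod C f)) f = f"
    and "\<And>f g h. f \<in> arr C \<Longrightarrow> g \<in> arr C \<Longrightarrow> h \<in> arr C \<Longrightarrow> cod C f = dom C g \<Longrightarrow> cod C g = dom C h \<Longrightarrow>
      comp C h (comp C g f) = comp C (comp C h g) f"
  shows "is_category C"
  using assms unfolding is_category_def by blast

context
  fixes C :: "('o, 'm) category"
  assumes C: "is_category C"
begin

lemma cat_dom: "f \<in> arr C \<Longrightarrow> dom C f \<in> ob C"
  and cat_cod: "f \<in> arr C \<Longrightarrow> cod C f \<in> ob C"
  and cat_ident: "a \<in> ob C \<Longrightarrow> ident C a \<in> arr C"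
  and cat_dom_ident: "a \<in> ob C \<Longrightarrow> dom C (ident C a) = a"
  and cat_cod_ident: "a \<in> ob C \<Longrightarrow> cod C (ident C a) = a"
  and cat_comp: "f \<in> arr C \<Longrightarrow> g \<in> arr C \<Longrightarrow> cod C f = dom C g \<Longrightarrow> comp C g f \<in> arr C"
  and cat_dom_comp: "f \<in> arr C \<Longrightarrow> g \<in> arr C \<Longrightarrow> cod C f = dom C g \<Longrightarrow> dom C (comp C g f) = dom C f"
  and cat_cod_comp: "f \<in> arr C \<Longrightarrow> g \<in> arr C \<Longrightarrow> cod C f = dom C g \<Longrightarrow> cod C (comp C g f) = cod C g"
  and cat_ident_right: "f \<in> arr C \<Longrightarrow> dom C f = a \<Longrightarrow> comp C f (ident C a) = f"
  and cat_ident_left: "f \<in> arr C \<Longrightarrow> cod C f = a \<Longrightarrow> comp C (ident C a) f = f"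
  using C unfolding is_category_def by blast+

lemma cat_assoc: "f \<in> arr C \<Longrightarrow> g \<in> arr C \<Longrightarrow> h \<in> arr C \<Longrightarrow> cod C f = dom C g \<Longrightarrow>
    cod C g = dom C h \<Longrightarrow> comp C (comp C h g) f = comp C h (comp C g f)"
  using C unfolding is_category_def by metis

lemmas cat_simps = cat_dom cat_cod cat_ident cat_dom_ident cat_cod_ident cat_comp cat_dom_comp
  cat_cod_comp cat_ident_right cat_ident_left

end

lemma is_category_functor_category:
  assumes "is_category C" "is_category D"
  shows "is_category (functor_category C D)"
proof -
  note C = cat_simps[OF assms(1)] and D = cat_simps[OF assms(2)] and assoc = cat_assoc[OF assms(2)]
  show ?thesis
  proof (rule is_categoryI)
    fix f assume "f \<in> arr (functor_category C D)"
    then show "dom (functor_category C D) f \<in> ob (functor_category C D) \<and>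
        cod (functor_category C D) f \<in> ob (functor_category C D)"
      by (auto simp: functor_category_def is_nat_trans_def)
  next
    fix F assume "F \<in> ob (functor_category C D)"
    then have "is_functor C D F" by (simp add: functor_category_def)
    then show "ident (functor_category C D) F \<in> arr (functor_category C D) \<and>
        dom (functor_category C D) (ident (functor_category C D) F) = F \<and>
        cod (functor_category C D) (ident (functor_category C D) F) = F"
      by (auto simp: functor_category_def is_nat_trans_def is_functor_def PiE_iff C D)
  next
    fix f g assume "f \<in> arr (functor_category C D)" "g \<in> arr (functor_category C D)"
      "cod (functor_category C D) f = dom (functor_category C D) g"
    then obtain F \<eta> F' \<theta> F'' where f: "f = (F, \<eta>, F')" "is_nat_trans C D F \<eta> F'"
      and g: "g = (F', \<theta>, F'')" "is_nat_trans C D F' \<theta> F''"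
      by (auto simp: functor_category_def)
    have \<eta>: "\<And>a. a \<in> ob C \<Longrightarrow> \<eta> a \<in> arr D \<and> dom D (\<eta> a) = fob F a \<and> cod D (\<eta> a) = fob F' a"
      and \<eta>n: "\<And>h. h \<in> arr C \<Longrightarrow> comp D (\<eta> (cod C h)) (farr F h) = comp D (farr F' h) (\<eta> (dom C h))"
      and F: "\<And>h. h \<in> arr C \<Longrightarrow> farr F h \<in> arr D \<and> dom D (farr F h) = fob F (dom C h) \<and> cod D (farr F h) = fob F (cod C h)"
      and F': "\<And>h. h \<in> arr C \<Longrightarrow> farr F' h \<in> arr D \<and> dom D (farr F' h) = fob F' (dom C h) \<and> cod D (farr F' h) = fob F' (cod C h)"
      using f(2) by (auto simp: is_nat_trans_def is_functor_def PiE_iff)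
    have \<theta>: "\<And>a. a \<in> ob C \<Longrightarrow> \<theta> a \<in> arr D \<and> dom D (\<theta> a) = fob F' a \<and> cod D (\<theta> a) = fob F'' a"
      and \<theta>n: "\<And>h. h \<in> arr C \<Longrightarrow> comp D (\<theta> (cod C h)) (farr F' h) = comp D (farr F'' h) (\<theta> (dom C h))"
      and F'': "\<And>h. h \<in> arr C \<Longrightarrow> farr F'' h \<in> arr D \<and> dom D (farr F'' h) = fob F'' (dom C h) \<and> cod D (farr F'' h) = fob F'' (cod C h)"
      using g(2) by (auto simp: is_nat_trans_def is_functor_def PiE_iff)
    have "comp D (comp D (\<theta> (cod C h)) (\<eta> (cod C h))) (farr F h) =
        comp D (farr F'' h) (comp D (\<theta> (dom C h)) (\<eta> (dom C h)))" if h: "h \<in> arr C" for h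
    proof -
      note [simp] = \<eta>[OF C(1)[OF h]] \<eta>[OF C(2)[OF h]] \<theta>[OF C(1)[OF h]] \<theta>[OF C(2)[OF h]] F[OF h] F'[OF h] F''[OF h]
      have "comp D (comp D (\<theta> (cod C h)) (\<eta> (cod C h))) (farr F h) =
          comp D (comp D (\<theta> (cod C h)) (farr F' h)) (\<eta> (dom C h))"
        by (simp add: assoc \<eta>n h)
      also have "\<dots> = comp D (farr F'' h) (comp D (\<theta> (dom C h)) (\<eta> (dom C h)))"
        unfolding \<theta>n[OF h] by (simp add: assoc)
      finally show ?thesis .
    qed
    then show "comp (functor_category C D) g f \<in> arr (functor_category C D) \<and>
        dom (functor_category C D) (comp (functor_category C D) g f) = dom (functor_category C D) f \<and>
        cod (functor_category C D) (comp (functor_category C D) g f) = cod (functor_category C D) g"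
      using f g \<eta> \<theta> by (auto simp: functor_category_def is_nat_trans_def C D)
  next
    fix f assume "f \<in> arr (functor_category C D)"
    then obtain F \<eta> F' where f: "f = (F, \<eta>, F')" "is_nat_trans C D F \<eta> F'"
      by (auto simp: functor_category_def)
    then have \<eta>: "\<eta> \<in> ob C \<rightarrow>\<^sub>E arr D"
      and 1: "\<And>a. a \<in> ob C \<Longrightarrow> comp D (\<eta> a) (ident D (fob F a)) = \<eta> a"
      "\<And>a. a \<in> ob C \<Longrightarrow> comp D (ident D (fob F' a)) (\<eta> a) = \<eta> a"
      by (auto simp: is_nat_trans_def PiE_iff D)
    have "(\<lambda>a\<in>ob C. comp D (\<eta> a) (ident D (fob F a))) = \<eta>"
      "(\<lambda>a\<in>ob C. comp D (ident D (fob F' a)) (\<eta> a)) = \<eta>"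
      using \<eta> 1 by (auto simp: PiE_iff extensional_def restrict_def fun_eq_iff)
    then show "comp (functor_category C D) f (ident (functor_category C D) (dom (functor_category C D) f)) = f \<and>
        comp (functor_category C D) (ident (functor_category C D) (cod (functor_category C D) f)) f = f"
      using f by (simp add: functor_category_def cong: restrict_cong)
  next
    fix f g h assume "f \<in> arr (functor_category C D)" "g \<in> arr (functor_category C D)"
      "h \<in> arr (functor_category C D)"
      "cod (functor_category C D) f = dom (functor_category C D) g"
      "cod (functor_category C D) g = dom (functor_category C D) h"
    then show "comp (functor_category C D) h (comp (functor_category C D) g f) =
        comp (functor_category C D) (comp (functor_category C D) h g) f"
      by (auto simp: functor_category_def is_nat_trans_def PiE_iff assoc intro!: restrict_ext)
  qed
qed

section \<open>The categories of modules and of Yetter-Drinfeld modules\<close>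

lemma compose_id_right: "f \<in> extensional A \<Longrightarrow> compose A f (\<lambda>x\<in>A. x) = f"
  by (auto simp: compose_def extensional_def)

lemma compose_id_left: "f \<in> A \<rightarrow>\<^sub>E B \<Longrightarrow> compose A (\<lambda>x\<in>B. x) f = f"
  by (rule ext) (auto simp: compose_def PiE_iff extensional_def)

lemma klinear_PiE: "klinear V W f \<Longrightarrow> f \<in> car V \<rightarrow>\<^sub>E car W"
  by (simp add: klinear_def)

lemma klinear_ident: "kmodule V \<Longrightarrow> klinear V V (\<lambda>x\<in>car V. x)"
  by (simp add: klinear_restrict lin_on_id)

lemma klinear_compose:
  assumes "kmodule V" "klinear V W f" "klinear W U g"
  shows "klinear V U (compose (car V) g f)"
  unfolding compose_def using assms by (auto simp: klinear_restrict intro: lin_on_comp[OF klinear_lin_on klinear_lin_on])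

lemma is_category_kmod_category: "is_category (kmod_category :: (('k::field, 'v) kmod, _) category)"
proof (rule is_categoryI)
  fix f g h :: "('k, 'v) kmod \<times> ('v \<Rightarrow> 'v) \<times> ('k, 'v) kmod"
  assume "f \<in> arr kmod_category" "g \<in> arr kmod_category" "h \<in> arr kmod_category"
    "cod kmod_category f = dom kmod_category g" "cod kmod_category g = dom kmod_category h"
  then show "comp kmod_category h (comp kmod_category g f) = comp kmod_category (comp kmod_category h g) f"
    by (auto simp: kmod_category_def dest!: klinear_PiE
        simp: compose_def PiE_iff fun_eq_iff)
qed (auto simp: kmod_category_def ext_kmodule_def klinear_ident klinear_compose
    compose_id_right compose_id_left[OF klinear_PiE] klinear_iff_lin_on[THEN iffD1])

lemma yd_morphism_ident:
  fixes X :: "('k::field, 'g::group_add \<Rightarrow>\<^sub>0 'k, 'v) ydmod"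
  assumes "yd_module group_hopf X"
  shows "yd_morphism group_hopf X X (\<lambda>x\<in>car X. x)"
  using assms yd_kmodule[OF assms]
  by (auto simp: yd_morphism_group_hopf_iff klinear_ident yd_gr_in yd_rho_in)

lemma yd_morphism_compose:
  fixes X Y Z :: "('k::field, 'g::group_add \<Rightarrow>\<^sub>0 'k, 'v) ydmod"
  assumes "yd_module group_hopf X" "yd_module group_hopf Y" "yd_module group_hopf Z"
    and "yd_morphism group_hopf X Y f" "yd_morphism group_hopf Y Z g"
  shows "yd_morphism group_hopf X Z (compose (car X) g f)"
  using assms klinear_compose[OF yd_kmodule[OF assms(1)], of Y f Z g] klinear_PiE[of X Y f]
  by (auto simp: yd_morphism_group_hopf_iff compose_eq yd_gr_in yd_rho_in PiE_iff)

lemma is_category_yd_category: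
  "is_category (yd_category (group_hopf :: ('k::field, 'g::group_add \<Rightarrow>\<^sub>0 'k) hopf)
    :: (('k, 'g \<Rightarrow>\<^sub>0 'k, 'v) ydmod, _) category)"
  (is "is_category ?C")
proof (rule is_categoryI)
  fix f g h assume "f \<in> arr ?C" "g \<in> arr ?C" "h \<in> arr ?C"
    "cod ?C f = dom ?C g" "cod ?C g = dom ?C h"
  then show "comp ?C h (comp ?C g f) = comp ?C (comp ?C h g) f"
    by (auto simp: yd_category_def yd_morphism_def dest!: klinear_PiE
        simp: compose_def PiE_iff fun_eq_iff)
next
  fix f assume "f \<in> arr ?C"
  then show "comp ?C f (ident ?C (dom ?C f)) = f \<and> comp ?C (ident ?C (cod ?C f)) f = f"
    by (auto simp: yd_category_def yd_morphism_def compose_id_right compose_id_left[OF klinear_PiE]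
        klinear_iff_lin_on[THEN iffD1])
qed (auto simp: yd_category_def yd_morphism_ident intro: yd_morphism_compose)

section \<open>Isomorphism from equivalence\<close>

text \<open>The second conclusion is the point: at each \<open>x\<close> the bijection is given by
  \<open>f\<close> or by inverting \<open>g\<close>, so a relation between \<open>x\<close> and its
  value that holds for both injections passes to the bijection.\<close>

lemma Schroeder_Bernstein_piecewise:
  assumes f: "inj_on f A" "f ` A \<subseteq> B" and g: "inj_on g B" "g ` B \<subseteq> A"
  shows "\<exists>h. bij_betw h A B \<and> (\<forall>x\<in>A. h x = f x \<or> g (h x) = x)"
proof -
  \<comment> \<open>The points of \<open>A\<close> reached by iterating \<open>g\<close> after
    \<open>f\<close> from points outside the image of \<open>g\<close>. On them \<open>f\<close> is
    used; elsewhere \<open>g\<close> is inverted.\<close>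
  define X where "X = lfp (\<lambda>X. A - g ` (B - f ` X))"
  define h where "h z = (if z \<in> X then f z else the_inv_into B g z)" for z
  have X: "X = A - g ` (B - f ` X)"
    unfolding X_def by (rule lfp_unfold) (blast intro: monoI)
  have inv: "the_inv_into B g (g b) = b" if "b \<in> B" for b
    using g(1) that by (rule the_inv_into_f_f)
  have out: "\<exists>b\<in>B - f ` X. x = g b \<and> h x = b" if "x \<in> A" "x \<notin> X" for x
  proof -
    from that X obtain b where "b \<in> B - f ` X" "x = g b" by blast
    with that inv show ?thesis by (auto simp: h_def)
  qed
  have XA: "X \<subseteq> A" using X by blast
  have inj: "inj_on h A"
  proof (rule inj_onI)
    fix x y assume xy: "x \<in> A" "y \<in> A" "h x = h y"
    show "x = y"
    proof (cases "x \<in> X"; cases "y \<in> X")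
      assume "x \<in> X" "y \<in> X"
      then show ?thesis using xy f(1) by (auto simp: h_def inj_on_def)
    next
      assume *: "x \<in> X" "y \<notin> X"
      then show ?thesis using out[of y] xy by (metis DiffD2 h_def imageI)
    next
      assume *: "x \<notin> X" "y \<in> X"
      then show ?thesis using out[of x] xy by (metis DiffD2 h_def imageI)
    next
      assume *: "x \<notin> X" "y \<notin> X"
      then show ?thesis using out[of x] out[of y] xy by auto
    qed
  qed
  have "b \<in> h ` A" if b: "b \<in> B" for b
  proof (cases "b \<in> f ` X")
    case True
    then show ?thesis using XA by (auto simp: h_def)
  next
    case False
    with b g(2) X have "g b \<in> A" "g b \<notin> X" by blast+
    with inv[OF b] show ?thesis by (intro image_eqI[of _ _ "g b"]) (auto simp: h_def)
  qed
  moreover have "h x \<in> B" if "x \<in> A" for x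
    using that out[OF that] f(2) by (cases "x \<in> X") (auto simp: h_def)
  ultimately have "bij_betw h A B"
    using inj by (auto simp: bij_betw_def)
  moreover have "\<forall>x\<in>A. h x = f x \<or> g (h x) = x"
    using out by (auto simp: h_def)
  ultimately show ?thesis by blast
qed

section \<open>From full and faithful functors to strict isomorphisms\<close>

definition isomorphic_objects :: "('o, 'm) category \<Rightarrow> 'o \<Rightarrow> 'o \<Rightarrow> bool" where
  "isomorphic_objects D a b \<longleftrightarrow> (\<exists>u\<in>arr D. \<exists>v\<in>arr D.
     dom D u = a \<and> cod D u = b \<and> dom D v = b \<and> cod D v = a \<and>
     comp D v u = ident D a \<and> comp D u v = ident D b)"

lemma functorD:
  assumes "is_functor C D F"
  shows "a \<in> ob C \<Longrightarrow> fob F a \<in> ob D"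
    and "f \<in> arr C \<Longrightarrow> farr F f \<in> arr D"
    and "f \<in> arr C \<Longrightarrow> dom D (farr F f) = fob F (dom C f)"
    and "f \<in> arr C \<Longrightarrow> cod D (farr F f) = fob F (cod C f)"
    and "a \<in> ob C \<Longrightarrow> farr F (ident C a) = ident D (fob F a)"
    and "f \<in> arr C \<Longrightarrow> g \<in> arr C \<Longrightarrow> cod C f = dom C g \<Longrightarrow>
      farr F (comp C g f) = comp D (farr F g) (farr F f)"
  using assms unfolding is_functor_def by auto

lemma isomorphic_categoriesI_bij:
  assumes C: "is_category C" and D: "is_category D" and F: "is_functor C D F"
    and ob: "bij_betw (fob F) (ob C) (ob D)" and arr: "bij_betw (farr F) (arr C) (arr D)"
  shows "isomorphic_categories C D"
proof -
  define fo where "fo = inv_into (ob C) (fob F)"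
  define fa where "fa = inv_into (arr C) (farr F)"
  define F' where "F' = \<lparr> fob = restrict fo (ob D), farr = restrict fa (arr D) \<rparr>"
  note ff = functorD[OF F] and c = cat_simps[OF C] and d = cat_simps[OF D]
  have o1: "fo (fob F a) = a" if "a \<in> ob C" for a
    using that ob by (simp add: fo_def bij_betw_inv_into_left)
  have o2: "fo b \<in> ob C" "fob F (fo b) = b" if "b \<in> ob D" for b
    using that ob by (simp_all add: fo_def bij_betw_inv_into_right bij_betw_apply[OF bij_betw_inv_into])
  have a1: "fa (farr F f) = f" if "f \<in> arr C" for f
    using that arr by (simp add: fa_def bij_betw_inv_into_left)
  have a2: "fa g \<in> arr C" "farr F (fa g) = g" if "g \<in> arr D" for g
    using that arr by (simp_all add: fa_def bij_betw_inv_into_right bij_betw_apply[OF bij_betw_inv_into])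
  have a3: "dom C (fa g) = fo (dom D g)" "cod C (fa g) = fo (cod D g)" if "g \<in> arr D" for g
    using a2[OF that] ff(3,4)[of "fa g"] o1[of "dom C (fa g)"] o1[of "cod C (fa g)"] c(1,2) by auto
  have i: "fa (ident D b) = ident C (fo b)" if "b \<in> ob D" for b
    using a1[of "ident C (fo b)"] o2[OF that] ff(5)[of "fo b"] c(3) by simp
  have m: "fa (comp D g f) = comp C (fa g) (fa f)"
    if "f \<in> arr D" "g \<in> arr D" "cod D f = dom D g" for f g
    using a1[of "comp C (fa g) (fa f)"] ff(6)[of "fa f" "fa g"] that a2 a3 c by simp
  have "is_functor D C F'"
    unfolding is_functor_def F'_def using o2 a2 a3 i m d by auto
  then show ?thesis
    unfolding isomorphic_categories_def using C D F o1 o2 a1 a2 d ff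
    by (intro conjI exI[of _ F] exI[of _ F']) (auto simp: F'_def)
qed

text \<open>A Schroeder-Bernstein bijection \<open>h\<close> on objects replaces the object map of
  \<open>E\<close>, with \<open>h X\<close> isomorphic to \<open>fob E X\<close>. Conjugating
  \<open>farr E f\<close> by chosen isomorphisms gives arrows between the new objects, and full
  faithfulness makes this bijective on arrows.\<close>

lemma isomorphic_categoriesI:
  assumes C: "is_category C" and D: "is_category D" and E: "is_functor C D E"
    and faithful: "\<And>f f'. f \<in> arr C \<Longrightarrow> f' \<in> arr C \<Longrightarrow> dom C f = dom C f' \<Longrightarrow> cod C f = cod C f' \<Longrightarrow>
      farr E f = farr E f' \<Longrightarrow> f = f'"
    and full: "\<And>X Y g. X \<in> ob C \<Longrightarrow> Y \<in> ob C \<Longrightarrow> g \<in> arr D \<Longrightarrow> dom D g = fob E X \<Longrightarrow> cod D g = fob E Y \<Longrightarrow>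
      \<exists>f\<in>arr C. dom C f = X \<and> cod C f = Y \<and> farr E f = g"
    and i: "inj_on i (ob C)" "\<And>X. X \<in> ob C \<Longrightarrow> i X \<in> ob D"
      "\<And>X. X \<in> ob C \<Longrightarrow> isomorphic_objects D (fob E X) (i X)"
    and j: "inj_on j (ob D)" "\<And>b. b \<in> ob D \<Longrightarrow> j b \<in> ob C"
      "\<And>b. b \<in> ob D \<Longrightarrow> isomorphic_objects D (fob E (j b)) b"
  shows "isomorphic_categories C D"
proof -
  note e = functorD[OF E] and c = cat_simps[OF C] and d = cat_simps[OF D]
    and assoc = cat_assoc[OF D]
  obtain h where h: "bij_betw h (ob C) (ob D)" "\<And>X. X \<in> ob C \<Longrightarrow> h X = i X \<or> j (h X) = X"
    using Schroeder_Bernstein_piecewise[of i "ob C" "ob D" j] i j by blast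
  have hD: "h X \<in> ob D" if "X \<in> ob C" for X
    using h(1) that by (rule bij_betw_apply)
  \<comment> \<open>If \<open>h X = i X\<close>, this is the property of \<open>i\<close>; if
    \<open>j (h X) = X\<close>, it is the property of \<open>j\<close> at the object
    \<open>h X\<close>.\<close>
  have "isomorphic_objects D (fob E X) (h X)" if "X \<in> ob C" for X
    using h(2)[OF that] i(3)[OF that] j(3)[OF hD[OF that]] by auto
  then have "\<forall>X. \<exists>u v. X \<in> ob C \<longrightarrow> u \<in> arr D \<and> v \<in> arr D \<and>
      dom D u = fob E X \<and> cod D u = h X \<and> dom D v = h X \<and> cod D v = fob E X \<and>
      comp D v u = ident D (fob E X) \<and> comp D u v = ident D (h X)"
    unfolding isomorphic_objects_def by blast
  then obtain u v where *: "\<And>X. X \<in> ob C \<Longrightarrow> u X \<in> arr D \<and> v X \<in> arr D \<and>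
      dom D (u X) = fob E X \<and> cod D (u X) = h X \<and> dom D (v X) = h X \<and> cod D (v X) = fob E X \<and>
      comp D (v X) (u X) = ident D (fob E X) \<and> comp D (u X) (v X) = ident D (h X)"
    by metis
  then have uv: "\<And>X. X \<in> ob C \<Longrightarrow> u X \<in> arr D \<and> v X \<in> arr D \<and>
      dom D (u X) = fob E X \<and> cod D (u X) = h X \<and> dom D (v X) = h X \<and> cod D (v X) = fob E X"
    and vu_id: "\<And>X. X \<in> ob C \<Longrightarrow> comp D (v X) (u X) = ident D (fob E X)"
    and uv_id: "\<And>X. X \<in> ob C \<Longrightarrow> comp D (u X) (v X) = ident D (h X)"
    by simp_all
  \<comment> \<open>Going back along \<open>v\<close>, applying \<open>E f\<close> and going forward
    along \<open>u\<close> gives an arrow from \<open>h (dom C f)\<close> to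
    \<open>h (cod C f)\<close>.\<close>
  define T where "T f = comp D (u (cod C f)) (comp D (farr E f) (v (dom C f)))" for f
  have T: "T f \<in> arr D" "dom D (T f) = h (dom C f)" "cod D (T f) = h (cod C f)" if "f \<in> arr C" for f
    using uv[OF c(1)[OF that]] uv[OF c(2)[OF that]] that e d by (auto simp: T_def)
  have T_inv: "comp D (v (cod C f)) (comp D (T f) (u (dom C f))) = farr E f" if f: "f \<in> arr C" for f
  proof -
    note [simp] = uv[OF c(1)[OF f]] uv[OF c(2)[OF f]] e(2-4)[OF f]
    have "comp D (v (cod C f)) (comp D (T f) (u (dom C f))) =
        comp D (comp D (v (cod C f)) (u (cod C f))) (comp D (farr E f) (comp D (v (dom C f)) (u (dom C f))))"
      unfolding T_def
      by (simp add: assoc d)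
    also have "\<dots> = farr E f" by (simp add: d f c vu_id)
    finally show ?thesis .
  qed
  have T_comp: "T (comp C g f) = comp D (T g) (T f)"
    if f: "f \<in> arr C" and g: "g \<in> arr C" and fg: "cod C f = dom C g" for f g
  proof -
    note uv' = uv[OF c(1)[OF f]] uv[OF c(2)[OF f]] uv[OF c(1)[OF g]] uv[OF c(2)[OF g]]
    have "comp D (T g) (T f) = comp D (u (cod C g)) (comp D (farr E g)
        (comp D (comp D (v (dom C g)) (u (cod C f))) (comp D (farr E f) (v (dom C f)))))"
      unfolding T_def using uv' e(2-4)[OF f] e(2-4)[OF g] fg by (simp add: assoc d)
    also have "comp D (v (dom C g)) (u (cod C f)) = ident D (fob E (cod C f))"
      using fg vu_id[OF c(1)[OF g]] by simp
    also have "comp D (u (cod C g)) (comp D (farr E g)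
        (comp D (ident D (fob E (cod C f))) (comp D (farr E f) (v (dom C f))))) = T (comp C g f)"
      unfolding T_def using uv' e(2-4)[OF f] e(2-4)[OF g] e(6)[OF f g fg] fg f g by (simp add: assoc d c)
    finally show ?thesis ..
  qed
  have T_ident: "T (ident C X) = ident D (h X)" if "X \<in> ob C" for X
    using uv[OF that] that e c d by (simp add: T_def uv_id)
  have T_inj: "inj_on T (arr C)"
  proof (rule inj_onI)
    fix f f' assume f: "f \<in> arr C" and f': "f' \<in> arr C" and eq: "T f = T f'"
    have "dom C f = dom C f'" "cod C f = cod C f'"
      using T(2,3)[OF f] T(2,3)[OF f'] eq c(1,2)[OF f] c(1,2)[OF f'] h(1)
      by (auto simp: bij_betw_def inj_on_def)
    moreover from this have "farr E f = farr E f'"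
      using T_inv[OF f] T_inv[OF f'] eq by simp
    ultimately show "f = f'" using faithful f f' by blast
  qed
  have T_surj: "g \<in> T ` arr C" if g: "g \<in> arr D" for g
  proof -
    have "dom D g \<in> h ` ob C" "cod D g \<in> h ` ob C"
      using d(1,2)[OF g] h(1) by (auto simp: bij_betw_def)
    then obtain X Y where X: "X \<in> ob C" "h X = dom D g" and Y: "Y \<in> ob C" "h Y = cod D g"
      by (metis imageE)
    \<comment> \<open>Undoing the conjugation gives an arrow between values of \<open>E\<close>,
      where fullness applies.\<close>
    let ?g = "comp D (v Y) (comp D g (u X))"
    have "?g \<in> arr D" "dom D ?g = fob E X" "cod D ?g = fob E Y"
      using uv[OF X(1)] uv[OF Y(1)] g X(2) Y(2) by (auto simp: d)
    then obtain f where f: "f \<in> arr C" "dom C f = X" "cod C f = Y" "farr E f = ?g"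
      using full[OF X(1) Y(1)] by blast
    have "T f = comp D (comp D (u Y) (v Y)) (comp D g (comp D (u X) (v X)))"
      unfolding T_def f(2-4) using uv[OF X(1)] uv[OF Y(1)] g X(2) Y(2) by (simp add: assoc d)
    also have "\<dots> = g" using uv[OF X(1)] uv[OF Y(1)] g X Y by (simp add: d uv_id)
    finally show ?thesis using f(1) by blast
  qed
  define F where "F = \<lparr> fob = restrict h (ob C), farr = restrict T (arr C) \<rparr>"
  have "is_functor C D F"
    unfolding is_functor_def F_def using T T_comp T_ident hD c by auto
  moreover have "bij_betw (fob F) (ob C) (ob D)"
    using h(1) by (simp add: F_def cong: bij_betw_cong)
  moreover have "bij_betw (farr F) (arr C) (arr D)"
    using T_inj T(1) T_surj by (auto simp: F_def bij_betw_def inj_on_def)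
  ultimately show ?thesis
    by (rule isomorphic_categoriesI_bij[OF C D])
qed

section \<open>Transport of module structure\<close>

text \<open>Transport of structure along \<open>\<psi>\<close>. The operations are
  \<open>undefined\<close> outside the image, so that the result can be an
  \<open>ext_kmodule\<close> and hence an object of \<open>kmod_category\<close>.\<close>

definition rename_mod :: "('k::field, 'v) kmod \<Rightarrow> ('v \<Rightarrow> 'w) \<Rightarrow> ('k, 'w) kmod" where
  "rename_mod V \<psi> =
     \<lparr> car = \<psi> ` car V,
       vadd = (\<lambda>x y. if x \<in> \<psi> ` car V \<and> y \<in> \<psi> ` car V
          then \<psi> (vadd V (inv_into (car V) \<psi> x) (inv_into (car V) \<psi> y)) else undefined),
       vzero = \<psi> (vzero V),
       vsmult = (\<lambda>c. \<lambda>x\<in>\<psi> ` car V. \<psi> (vsmult V c (inv_into (car V) \<psi> x))) \<rparr>"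

lemma car_rename_mod [simp]: "car (rename_mod V \<psi>) = \<psi> ` car V"
  and vzero_rename_mod [simp]: "vzero (rename_mod V \<psi>) = \<psi> (vzero V)"
  by (simp_all add: rename_mod_def)

context
  fixes V :: "('k::field, 'v) kmod" and \<psi> :: "'v \<Rightarrow> 'w"
  assumes V: "kmodule V" and \<psi>: "inj_on \<psi> (car V)"
begin

lemma vadd_rename_mod [simp]:
    "x \<in> car V \<Longrightarrow> y \<in> car V \<Longrightarrow> vadd (rename_mod V \<psi>) (\<psi> x) (\<psi> y) = \<psi> (vadd V x y)"
  and vsmult_rename_mod [simp]: "x \<in> car V \<Longrightarrow> vsmult (rename_mod V \<psi>) c (\<psi> x) = \<psi> (vsmult V c x)"
  using \<psi> by (auto simp: rename_mod_def)

lemma ext_kmodule_rename_mod: "ext_kmodule (rename_mod V \<psi>)"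
proof -
  have "\<exists>y\<in>car V. \<psi> (vadd V x y) = \<psi> (vzero V)" if "x \<in> car V" for x
    using kmod_inverse[OF V that] by metis
  then have "kmodule (rename_mod V \<psi>)"
    unfolding kmodule_def using V
    by (simp add: kmod_assoc kmod_smult_add kmod_add_smult kmod_mult_smult)
      (metis kmod_comm)
  then show ?thesis
    by (auto simp: ext_kmodule_def rename_mod_def)
qed

lemma lin_on_rename_mod: "lin_on V (rename_mod V \<psi>) \<psi>"
  by (rule lin_onI) simp_all

lemma lin_on_inv_rename_mod: "lin_on (rename_mod V \<psi>) V (inv_into (car V) \<psi>)"
  using V \<psi> by (intro lin_onI) auto

end

text \<open>A linear bijection transports the structure of \<open>V\<close> to that of
  \<open>W\<close> on the carrier, and extensionality of \<open>W\<close> settles the values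
  elsewhere; hence equality rather than mere isomorphism.\<close>

lemma rename_mod_eqI:
  assumes V: "kmodule V" and W: "ext_kmodule W" and lin: "lin_on V W m" and bij: "bij_betw m (car V) (car W)"
  shows "rename_mod V m = W"
proof -
  have car: "m ` car V = car W" and inj: "inj_on m (car V)"
    using bij by (auto simp: bij_betw_def)
  have 1: "vadd (rename_mod V m) x y = vadd W x y" for x y
  proof (cases "x \<in> car W \<and> y \<in> car W")
    case True
    then obtain x' y' where "x' \<in> car V" "y' \<in> car V" "x = m x'" "y = m y'"
      using car by blast
    then show ?thesis using V inj lin by (simp add: lin_on_add)
  next
    case False
    then show ?thesis using W car by (auto simp: rename_mod_def ext_kmodule_def)
  qed
  have 2: "vsmult (rename_mod V m) c x = vsmult W c x" for c x
  proof (cases "x \<in> car W")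
    case True
    then obtain x' where "x' \<in> car V" "x = m x'"
      using car by blast
    then show ?thesis using V inj lin by (simp add: lin_on_smult)
  next
    case False
    then show ?thesis using W car by (auto simp: rename_mod_def ext_kmodule_def extensional_def)
  qed
  have "vzero (rename_mod V m) = vzero W"
    using lin_on_zero[OF lin V] W by (simp add: ext_kmodule_def)
  with car have "car (rename_mod V m) = car W" "vadd (rename_mod V m) = vadd W"
    "vzero (rename_mod V m) = vzero W" "vsmult (rename_mod V m) = vsmult W"
    using 1 2 by (simp_all add: fun_eq_iff)
  then show ?thesis by simp
qed


section \<open>Functors on the conjugation groupoid\<close>

type_synonym ('k, 'g, 'v) kmod_func = "('g, 'g \<times> 'g, ('k, 'v) kmod,
  ('k, 'v) kmod \<times> ('v \<Rightarrow> 'v) \<times> ('k, 'v) kmod) func"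

abbreviation kmod_functor :: "('k::field, 'g::group_add, 'v) kmod_func \<Rightarrow> bool" where
  "kmod_functor \<equiv> is_functor conj_groupoid kmod_category"

abbreviation kmod_functor_category :: "(('k::field, 'g::group_add, 'v) kmod_func, _) category" where
  "kmod_functor_category \<equiv> functor_category conj_groupoid kmod_category"

definition fmap :: "('g, 'g \<times> 'g, 'p, 'a \<times> 'b \<times> 'c) func \<Rightarrow> 'g \<Rightarrow> 'g \<Rightarrow> 'b" where
  "fmap F h g = fst (snd (farr F (h, g)))"

lemma conj_add: "h' + (h + g - h) - h' = (h' + h) + g - (h' + h)" for h :: "'g::group_add"
  by (simp add: add.assoc diff_conv_add_uminus minus_add del: add_uminus_conv_diff)

lemma kmod_functor_iff:
  "kmod_functor F \<longleftrightarrow>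
    (\<forall>g. ext_kmodule (fob F g)) \<and>
    (\<forall>h g. farr F (h, g) = (fob F g, fmap F h g, fob F (h + g - h))) \<and>
    (\<forall>h g. klinear (fob F g) (fob F (h + g - h)) (fmap F h g)) \<and>
    (\<forall>g. \<forall>x\<in>car (fob F g). fmap F 0 g x = x) \<and>
    (\<forall>h' h g. \<forall>x\<in>car (fob F g). fmap F (h' + h) g x = fmap F h' (h + g - h) (fmap F h g x))"
  (is "_ \<longleftrightarrow> ?R")
proof
  assume F: "kmod_functor F"
  have ob: "ext_kmodule (fob F g)" for g
    using functorD(1)[OF F, of g] by (simp add: conj_groupoid_def kmod_category_def)
  have arr: "farr F (h, g) = (fob F g, fmap F h g, fob F (h + g - h)) \<and>
      klinear (fob F g) (fob F (h + g - h)) (fmap F h g)" for h g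
    using functorD(2-4)[OF F, of "(h, g)"]
    by (auto simp: conj_groupoid_def kmod_category_def fmap_def split: prod.splits)
  have "fmap F 0 g x = x" if "x \<in> car (fob F g)" for g x
    using functorD(5)[OF F, of g] that
    by (simp add: conj_groupoid_def kmod_category_def fmap_def)
  moreover have "fmap F (h' + h) g x = fmap F h' (h + g - h) (fmap F h g x)"
    if "x \<in> car (fob F g)" for h' h g x
    using functorD(6)[OF F, of "(h, g)" "(h', h + g - h)"] that
      arr[THEN conjunct1, of h g] arr[THEN conjunct1, of h' "h + g - h"]
      arr[THEN conjunct1, of "h' + h" g]
    by (simp add: conj_groupoid_def kmod_category_def compose_eq)
  ultimately show ?R using ob arr by blast
next
  assume R: ?R
  then have ob: "\<And>g. ext_kmodule (fob F g)"
    and arr: "\<And>h g. farr F (h, g) = (fob F g, fmap F h g, fob F (h + g - h))"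
    and lin: "\<And>h g. klinear (fob F g) (fob F (h + g - h)) (fmap F h g)"
    and id: "\<And>g x. x \<in> car (fob F g) \<Longrightarrow> fmap F 0 g x = x"
    and add: "\<And>h' h g x. x \<in> car (fob F g) \<Longrightarrow>
      fmap F (h' + h) g x = fmap F h' (h + g - h) (fmap F h g x)"
    by blast+
  have ext: "fmap F h g \<in> extensional (car (fob F g))" for h g
    using lin[of g h] by (simp add: klinear_iff_lin_on)
  have "fmap F 0 g = (\<lambda>x\<in>car (fob F g). x)" for g
    using ext id by (intro extensionalityI[of _ "car (fob F g)"]) auto
  moreover have "fmap F (h' + h) g = compose (car (fob F g)) (fmap F h' (h + g - h)) (fmap F h g)" for h' h g
    using ext add by (intro extensionalityI[of _ "car (fob F g)"]) (auto simp: compose_eq)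
  ultimately show "kmod_functor F"
    unfolding is_functor_def using ob lin
    by (auto simp: conj_groupoid_def kmod_category_def arr conj_add)
qed

context
  fixes F :: "('k::field, 'g::group_add, 'v) kmod_func"
  assumes F: "kmod_functor F"
begin

lemma fob_ext_kmodule: "ext_kmodule (fob F g)"
  and fob_kmodule: "kmodule (fob F g)"
  and farr_eq: "farr F (h, g) = (fob F g, fmap F h g, fob F (h + g - h))"
  and klinear_fmap: "klinear (fob F g) (fob F (h + g - h)) (fmap F h g)"
  and fmap_zero: "x \<in> car (fob F g) \<Longrightarrow> fmap F 0 g x = x"
  and fmap_add: "x \<in> car (fob F g) \<Longrightarrow> fmap F (h' + h) g x = fmap F h' (h + g - h) (fmap F h g x)"
  using F by (auto simp: kmod_functor_iff ext_kmodule_def)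

lemma lin_on_fmap: "lin_on (fob F g) (fob F (h + g - h)) (fmap F h g)"
  using klinear_fmap by (rule klinear_lin_on)

lemma fmap_in: "x \<in> car (fob F g) \<Longrightarrow> fmap F h g x \<in> car (fob F (h + g - h))"
  using lin_on_fmap by (rule lin_on_closed)

end

lemma kmod_nat_trans_iff:
  assumes F: "kmod_functor F" and F': "kmod_functor F'"
  shows "is_nat_trans conj_groupoid kmod_category F \<eta> F' \<longleftrightarrow>
    (\<exists>m. \<eta> = (\<lambda>g. (fob F g, m g, fob F' g)) \<and> (\<forall>g. klinear (fob F g) (fob F' g) (m g)) \<and>
      (\<forall>h g. \<forall>x\<in>car (fob F g). m (h + g - h) (fmap F h g x) = fmap F' h g (m g x)))"
  (is "_ \<longleftrightarrow> ?R")
proof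
  assume n: "is_nat_trans conj_groupoid kmod_category F \<eta> F'"
  define m where "m g = fst (snd (\<eta> g))" for g
  have \<eta>: "\<eta> g = (fob F g, m g, fob F' g) \<and> klinear (fob F g) (fob F' g) (m g)" for g
  proof -
    have "\<eta> g \<in> arr kmod_category \<and> dom kmod_category (\<eta> g) = fob F g \<and>
        cod kmod_category (\<eta> g) = fob F' g"
      using n by (auto simp: is_nat_trans_def conj_groupoid_def)
    then show ?thesis
      by (cases "\<eta> g") (auto simp: kmod_category_def m_def)
  qed
  have "m (h + g - h) (fmap F h g x) = fmap F' h g (m g x)" if x: "x \<in> car (fob F g)" for h g x
  proof -
    have "comp kmod_category (\<eta> (h + g - h)) (farr F (h, g)) = comp kmod_category (farr F' (h, g)) (\<eta> g)"
      using n by (auto simp: is_nat_trans_def conj_groupoid_def)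
    then have "compose (car (fob F g)) (m (h + g - h)) (fmap F h g) =
        compose (car (fob F g)) (fmap F' h g) (m g)"
      by (simp add: \<eta> farr_eq[OF F] farr_eq[OF F'] kmod_category_def)
    from fun_cong[OF this, of x] show ?thesis using x by (simp add: compose_eq)
  qed
  with \<eta> show ?R by (intro exI[of _ m]) auto
next
  assume ?R
  then obtain m where m: "\<eta> = (\<lambda>g. (fob F g, m g, fob F' g))" "\<And>g. klinear (fob F g) (fob F' g) (m g)"
    "\<And>h g x. x \<in> car (fob F g) \<Longrightarrow> m (h + g - h) (fmap F h g x) = fmap F' h g (m g x)"
    by blast
  have "compose (car (fob F g)) (m (h + g - h)) (fmap F h g) = compose (car (fob F g)) (fmap F' h g) (m g)" for h g
    using m(3) by (auto simp: compose_def)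
  then show "is_nat_trans conj_groupoid kmod_category F \<eta> F'"
    using F F' m fob_ext_kmodule[OF F] fob_ext_kmodule[OF F']
    by (auto simp: is_nat_trans_def conj_groupoid_def kmod_category_def farr_eq)
qed

section \<open>Renaming the elements of the values of a functor\<close>

definition rename_functor :: "('k::field, 'g::group_add, 'v) kmod_func \<Rightarrow> ('g \<Rightarrow> 'v \<Rightarrow> 'v) \<Rightarrow>
    ('k, 'g, 'v) kmod_func" where
  "rename_functor F \<psi> =
    \<lparr> fob = (\<lambda>g. rename_mod (fob F g) (\<psi> g)),
      farr = (\<lambda>(h, g). (rename_mod (fob F g) (\<psi> g),
        \<lambda>x\<in>\<psi> g ` car (fob F g). \<psi> (h + g - h) (fmap F h g (inv_into (car (fob F g)) (\<psi> g) x)),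
        rename_mod (fob F (h + g - h)) (\<psi> (h + g - h)))) \<rparr>"

lemma fob_rename_functor [simp]: "fob (rename_functor F \<psi>) g = rename_mod (fob F g) (\<psi> g)"
  by (simp add: rename_functor_def)

context
  fixes F :: "('k::field, 'g::group_add, 'v) kmod_func" and \<psi> :: "'g \<Rightarrow> 'v \<Rightarrow> 'v"
  assumes F: "kmod_functor F" and \<psi>: "\<And>g. inj_on (\<psi> g) (car (fob F g))"
begin

lemma fmap_rename_functor: "x \<in> car (fob F g) \<Longrightarrow> fmap (rename_functor F \<psi>) h g (\<psi> g x) = \<psi> (h + g - h) (fmap F h g x)"
  using \<psi> by (simp add: rename_functor_def fmap_def)

lemma kmod_functor_rename_functor: "kmod_functor (rename_functor F \<psi>)"
proof -
  note V = fob_kmodule[OF F]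
  have "klinear (rename_mod (fob F g) (\<psi> g)) (rename_mod (fob F (h + g - h)) (\<psi> (h + g - h)))
      (fmap (rename_functor F \<psi>) h g)" for h g
  proof -
    have "fmap (rename_functor F \<psi>) h g \<in> extensional (\<psi> g ` car (fob F g))"
      by (simp add: rename_functor_def fmap_def)
    moreover have "lin_on (rename_mod (fob F g) (\<psi> g)) (rename_mod (fob F (h + g - h)) (\<psi> (h + g - h)))
        (fmap (rename_functor F \<psi>) h g)"
      using fmap_in[OF F] lin_on_fmap[OF F, of g h] V
      by (intro lin_onI) (auto simp: fmap_rename_functor \<psi> lin_on_add lin_on_smult)
    ultimately show ?thesis by (simp add: klinear_iff_lin_on)
  qed
  moreover have "farr (rename_functor F \<psi>) (h, g) = (fob (rename_functor F \<psi>) g, fmap (rename_functor F \<psi>) h g, fob (rename_functor F \<psi>) (h + g - h))" for h g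
    by (simp add: rename_functor_def fmap_def)
  ultimately show ?thesis
    using ext_kmodule_rename_mod[OF V \<psi>] fmap_in[OF F]
    by (auto simp: kmod_functor_iff fmap_rename_functor fmap_zero[OF F] fmap_add[OF F] conj_add)
qed

text \<open>The renaming maps are themselves the components of a natural isomorphism.\<close>

lemma isomorphic_objects_rename_functor: "isomorphic_objects kmod_functor_category F (rename_functor F \<psi>)"
proof -
  note V = fob_kmodule[OF F] and R = kmod_functor_rename_functor
  let ?u = "\<lambda>g. (fob F g, \<lambda>x\<in>car (fob F g). \<psi> g x, fob (rename_functor F \<psi>) g)"
  let ?v = "\<lambda>g. (fob (rename_functor F \<psi>) g, \<lambda>x\<in>\<psi> g ` car (fob F g). inv_into (car (fob F g)) (\<psi> g) x, fob F g)"
  have kl: "klinear (fob F g) (fob (rename_functor F \<psi>) g) (\<lambda>x\<in>car (fob F g). \<psi> g x)"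
    "klinear (fob (rename_functor F \<psi>) g) (fob F g) (\<lambda>x\<in>\<psi> g ` car (fob F g). inv_into (car (fob F g)) (\<psi> g) x)" for g
    using lin_on_rename_mod[OF V \<psi>, of g] lin_on_inv_rename_mod[OF V \<psi>, of g] klinear_restrict[OF V, of g "rename_mod (fob F g) (\<psi> g)"]
      klinear_restrict[OF fob_kmodule[OF R], of g "fob F g"] by simp_all
  have "is_nat_trans conj_groupoid kmod_category F ?u (rename_functor F \<psi>)"
    unfolding kmod_nat_trans_iff[OF F R] using kl fmap_in[OF F]
    by (intro exI[of _ "\<lambda>g. \<lambda>x\<in>car (fob F g). \<psi> g x"]) (simp add: fmap_rename_functor)
  moreover have "is_nat_trans conj_groupoid kmod_category (rename_functor F \<psi>) ?v F"
    unfolding kmod_nat_trans_iff[OF R F] using kl fmap_in[OF F] \<psi>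
    by (intro exI[of _ "\<lambda>g. \<lambda>x\<in>\<psi> g ` car (fob F g). inv_into (car (fob F g)) (\<psi> g) x"])
      (auto simp: fmap_rename_functor)
  moreover have "compose (car (fob F g)) (\<lambda>x\<in>\<psi> g ` car (fob F g). inv_into (car (fob F g)) (\<psi> g) x)
      (\<lambda>x\<in>car (fob F g). \<psi> g x) = (\<lambda>x\<in>car (fob F g). x)" for g
    using \<psi> by (auto simp: compose_def)
  moreover have "compose (\<psi> g ` car (fob F g)) (\<lambda>x\<in>car (fob F g). \<psi> g x)
      (\<lambda>x\<in>\<psi> g ` car (fob F g). inv_into (car (fob F g)) (\<psi> g) x) = (\<lambda>x\<in>\<psi> g ` car (fob F g). x)" for g
    unfolding compose_def by (rule restrict_ext) (auto simp: inv_into_into f_inv_into_f)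
  ultimately show ?thesis
    unfolding isomorphic_objects_def
    by (intro bexI[of _ "(F, ?u, rename_functor F \<psi>)"] bexI[of _ "(rename_functor F \<psi>, ?v, F)"])
      (simp_all add: functor_category_def conj_groupoid_def kmod_category_def)
qed

lemma rename_functor_eqI:
  assumes G: "kmod_functor G" and lin: "\<And>g. lin_on (fob F g) (fob G g) (\<psi> g)"
    and bij: "\<And>g. bij_betw (\<psi> g) (car (fob F g)) (car (fob G g))"
    and nat: "\<And>h g x. x \<in> car (fob F g) \<Longrightarrow> \<psi> (h + g - h) (fmap F h g x) = fmap G h g (\<psi> g x)"
  shows "rename_functor F \<psi> = G"
proof -
  note R = kmod_functor_rename_functor
  have ob: "fob (rename_functor F \<psi>) g = fob G g" for g
    using rename_mod_eqI[OF fob_kmodule[OF F] fob_ext_kmodule[OF G] lin bij] by simp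
  have "fmap (rename_functor F \<psi>) h g = fmap G h g" for h g
  proof (rule extensionalityI[of _ "car (fob G g)"])
    show "fmap (rename_functor F \<psi>) h g \<in> extensional (car (fob G g))" "fmap G h g \<in> extensional (car (fob G g))"
      using klinear_fmap[OF R, of g h] klinear_fmap[OF G, of g h] unfolding ob
      by (simp_all add: klinear_iff_lin_on)
    fix y assume "y \<in> car (fob G g)"
    then obtain x where "x \<in> car (fob F g)" "y = \<psi> g x"
      using bij[of g] by (auto simp: bij_betw_def)
    then show "fmap (rename_functor F \<psi>) h g y = fmap G h g y" by (simp add: fmap_rename_functor nat)
  qed
  then have "farr (rename_functor F \<psi>) (h, g) = farr G (h, g)" for h g
    by (simp only: farr_eq[OF R] farr_eq[OF G] ob)
  then have "farr (rename_functor F \<psi>) = farr G" "fob (rename_functor F \<psi>) = fob G"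
    using ob by (auto simp: fun_eq_iff)
  then show ?thesis by simp
qed

end

text \<open>Renaming back along a left inverse. If one decoding \<open>\<phi>\<close> serves a whole
  class of functors, each of them is recovered from its renamed copy alone.\<close>

lemma rename_functor_inverse:
  assumes F: "kmod_functor F" and \<phi>: "\<And>g x. x \<in> car (fob F g) \<Longrightarrow> \<phi> g (\<psi> g x) = x"
  shows "rename_functor (rename_functor F \<psi>) \<phi> = F"
proof -
  have \<psi>: "inj_on (\<psi> g) (car (fob F g))" for g
    using \<phi> by (rule inj_on_inverseI)
  note R = kmod_functor_rename_functor[OF F \<psi>] and V = fob_kmodule[OF F]
  have \<phi>_inj: "inj_on (\<phi> g) (\<psi> g ` car (fob F g))" for g
    using \<phi> by (auto simp: inj_on_def)
  show ?thesis
  proof (rule rename_functor_eqI[OF R _ F])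
    fix g
    show "lin_on (fob (rename_functor F \<psi>) g) (fob F g) (\<phi> g)"
      using \<psi> V by (intro lin_onI) (auto simp: \<phi>)
    show "bij_betw (\<phi> g) (car (fob (rename_functor F \<psi>) g)) (car (fob F g))"
      using \<phi>_inj[of g] \<phi> by (force simp: bij_betw_def)
  qed (use \<phi>_inj fmap_in[OF F] in \<open>auto simp: fmap_rename_functor[OF F \<psi>] \<phi>\<close>)
qed

section \<open>Direct sums\<close>

definition sum_mod :: "('g, 'm, ('k::field, 'v) kmod, 'n) func \<Rightarrow> ('k, 'g \<Rightarrow> 'v) kmod" where
  "sum_mod F =
    \<lparr> car = {p. (\<forall>g. p g \<in> car (fob F g)) \<and> finite {g. p g \<noteq> vzero (fob F g)}},
      vadd = (\<lambda>p q g. vadd (fob F g) (p g) (q g)),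
      vzero = (\<lambda>g. vzero (fob F g)),
      vsmult = (\<lambda>c p g. vsmult (fob F g) c (p g)) \<rparr>"

lemma car_sum_mod:
  "p \<in> car (sum_mod F) \<longleftrightarrow> (\<forall>g. p g \<in> car (fob F g)) \<and> finite {g. p g \<noteq> vzero (fob F g)}"
  by (simp add: sum_mod_def)

lemma sum_mod_simps [simp]:
  "vadd (sum_mod F) p q g = vadd (fob F g) (p g) (q g)"
  "vzero (sum_mod F) g = vzero (fob F g)"
  "vsmult (sum_mod F) c p g = vsmult (fob F g) c (p g)"
  by (simp_all add: sum_mod_def)

definition proj :: "('g, 'm, ('k::field, 'v) kmod, 'n) func \<Rightarrow> 'g \<Rightarrow> ('g \<Rightarrow> 'v) \<Rightarrow> 'g \<Rightarrow> 'v" where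
  "proj F g p = (\<lambda>k. if k = g then p k else vzero (fob F k))"

text \<open>The action of \<open>h\<close> on the direct sum: the entry in degree \<open>k\<close>
  comes from degree \<open>- h + k + h\<close>, which \<open>h\<close> conjugates to
  \<open>k\<close>.\<close>

definition shift :: "('g::group_add, 'g \<times> 'g, 'p, 'a \<times> ('v \<Rightarrow> 'v) \<times> 'c) func \<Rightarrow> 'g \<Rightarrow> ('g \<Rightarrow> 'v) \<Rightarrow> 'g \<Rightarrow> 'v" where
  "shift F h p = (\<lambda>k. fmap F h (- h + k + h) (p (- h + k + h)))"

lemma conj_minus [simp]: "h + (- h + k + h) - h = k" for h :: "'g::group_add"
  by (simp add: add.assoc diff_conv_add_uminus del: add_uminus_conv_diff)

lemma minus_conj [simp]: "- h + (h + k - h) + h = k" for h :: "'g::group_add"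
  by (simp add: add.assoc diff_conv_add_uminus del: add_uminus_conv_diff)

text \<open>The families live in \<open>'g \<Rightarrow> 'v\<close>, and \<open>s\<close> gives them
  names in the universe 'v. It is a parameter because two namings matter: an injection of the full
  function space, and \<open>assemble X\<close>, for which the direct sum of the components is X
  itself.\<close>

definition direct_sum :: "('k::field, 'g::group_add, 'v) kmod_func \<Rightarrow> (('g \<Rightarrow> 'v) \<Rightarrow> 'v) \<Rightarrow>
    ('k, 'g \<Rightarrow>\<^sub>0 'k, 'v) ydmod" where
  "direct_sum F s = mkyd (rename_mod (sum_mod F) s)
     (\<lambda>h x. s (shift F h (inv_into (car (sum_mod F)) s x)))
     (\<lambda>g x. s (proj F g (inv_into (car (sum_mod F)) s x)))"

lemma truncate_direct_sum: "kmod.truncate (direct_sum F s) = rename_mod (sum_mod F) s"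
  by (simp add: direct_sum_def truncate_mkyd)

lemma car_direct_sum [simp]: "car (direct_sum F s) = s ` car (sum_mod F)"
  and vadd_direct_sum: "vadd (direct_sum F s) = vadd (rename_mod (sum_mod F) s)"
  and vsmult_direct_sum: "vsmult (direct_sum F s) = vsmult (rename_mod (sum_mod F) s)"
  by (simp_all add: direct_sum_def)

context
  fixes F :: "('k::field, 'g::group_add, 'v) kmod_func"
  assumes F: "kmod_functor F"
begin

lemma kmodule_sum_mod: "kmodule (sum_mod F)"
proof -
  note V = fob_kmodule[OF F]
  have add: "finite {g. vadd (fob F g) (p g) (q g) \<noteq> vzero (fob F g)}"
    if "finite {g. p g \<noteq> vzero (fob F g)}" "finite {g. q g \<noteq> vzero (fob F g)}" for p q :: "'g \<Rightarrow> 'v"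
    by (rule finite_subset[OF _ finite_UnI[OF that]]) (use V in auto)
  have scale: "finite {g. vsmult (fob F g) c (p g) \<noteq> vzero (fob F g)}"
    if "finite {g. p g \<noteq> vzero (fob F g)}" for p :: "'g \<Rightarrow> 'v" and c
    by (rule finite_subset[OF _ that]) (use V in auto)
  have neg: "\<exists>q\<in>car (sum_mod F). vadd (sum_mod F) p q = vzero (sum_mod F)"
    if "p \<in> car (sum_mod F)" for p
    using that V
    by (intro bexI[of _ "vsmult (sum_mod F) (- 1) p"]) (auto simp: car_sum_mod scale fun_eq_iff)
  show ?thesis
    unfolding kmodule_def using V neg
    by (auto simp: car_sum_mod fun_eq_iff add scale kmod_assoc kmod_smult_add kmod_add_smult kmod_mult_smult
        intro: kmod_comm)
qed

lemma lin_on_proj: "lin_on (sum_mod F) (sum_mod F) (proj F g)"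
proof (rule lin_onI)
  fix p assume p: "p \<in> car (sum_mod F)"
  have "finite {k. proj F g p k \<noteq> vzero (fob F k)}"
    by (rule finite_subset[of _ "{g}"]) (auto simp: proj_def)
  then show "proj F g p \<in> car (sum_mod F)"
    using p fob_kmodule[OF F] by (simp add: car_sum_mod proj_def)
qed (use fob_kmodule[OF F] in \<open>auto simp: proj_def fun_eq_iff\<close>)

lemma shift_in_fob: "p \<in> car (sum_mod F) \<Longrightarrow> shift F h p k \<in> car (fob F k)"
  using fmap_in[OF F, of "p (- h + k + h)" "- h + k + h" h] by (simp add: shift_def car_sum_mod)

lemma lin_on_shift: "lin_on (sum_mod F) (sum_mod F) (shift F h)"
proof (rule lin_onI)
  have lin: "lin_on (fob F (- h + k + h)) (fob F k) (fmap F h (- h + k + h))" for k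
    using lin_on_fmap[OF F, of "- h + k + h" h] by simp
  note V = fob_kmodule[OF F]
  fix p assume p: "p \<in> car (sum_mod F)"
  have "{k. shift F h p k \<noteq> vzero (fob F k)} \<subseteq> (\<lambda>g. h + g - h) ` {g. p g \<noteq> vzero (fob F g)}"
  proof
    fix k assume k: "k \<in> {k. shift F h p k \<noteq> vzero (fob F k)}"
    then have "p (- h + k + h) \<noteq> vzero (fob F (- h + k + h))"
      using lin_on_zero[OF lin V V, of k] by (auto simp: shift_def)
    then show "k \<in> (\<lambda>g. h + g - h) ` {g. p g \<noteq> vzero (fob F g)}"
      by (intro image_eqI[of _ _ "- h + k + h"]) auto
  qed
  then have "finite {k. shift F h p k \<noteq> vzero (fob F k)}"
    using p by (auto simp: car_sum_mod intro: finite_subset)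
  then show "shift F h p \<in> car (sum_mod F)"
    using shift_in_fob[OF p] by (simp add: car_sum_mod)
  show "shift F h (vsmult (sum_mod F) c p) = vsmult (sum_mod F) c (shift F h p)" for c
    using p by (auto simp: shift_def fun_eq_iff car_sum_mod lin_on_smult[OF lin])
  show "shift F h (vadd (sum_mod F) p q) = vadd (sum_mod F) (shift F h p) (shift F h q)"
    if "q \<in> car (sum_mod F)" for q
    using p that by (auto simp: shift_def fun_eq_iff car_sum_mod lin_on_add[OF lin])
qed

lemma shift_zero: "p \<in> car (sum_mod F) \<Longrightarrow> shift F 0 p = p"
  by (simp add: shift_def fun_eq_iff car_sum_mod fmap_zero[OF F])

lemma shift_add:
  assumes "p \<in> car (sum_mod F)"
  shows "shift F (h' + h) p = shift F h' (shift F h p)"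
proof
  fix k
  have k: "- (h' + h) + k + (h' + h) = - h + (- h' + k + h') + h"
    by (simp add: add.assoc diff_conv_add_uminus minus_add del: add_uminus_conv_diff)
  show "shift F (h' + h) p k = shift F h' (shift F h p) k"
    using fmap_add[OF F, of "p (- h + (- h' + k + h') + h)" "- h + (- h' + k + h') + h" h' h] assms
    by (simp add: shift_def k car_sum_mod)
qed

lemma proj_proj: "proj F k (proj F g p) = (if k = g then proj F g p else vzero (sum_mod F))"
  by (auto simp: proj_def fun_eq_iff)

lemma proj_shift: "proj F k (shift F h p) = shift F h (proj F (- h + k + h) p)"
proof
  fix j
  have "- h + j + h = - h + k + h \<longleftrightarrow> j = k" by simp
  moreover have "fmap F h (- h + j + h) (vzero (fob F (- h + j + h))) = vzero (fob F j)"
    using lin_on_zero[OF lin_on_fmap[OF F, of "- h + j + h" h] fob_kmodule[OF F] fob_kmodule[OF F]] by simp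
  ultimately show "proj F k (shift F h p) j = shift F h (proj F (- h + k + h) p) j"
    by (simp add: proj_def shift_def)
qed

context
  fixes s :: "('g \<Rightarrow> 'v) \<Rightarrow> 'v"
  assumes s: "inj_on s (car (sum_mod F))"
begin

private lemma lin_on_conjugate:
  assumes "lin_on (sum_mod F) (sum_mod F) f"
  shows "lin_on (rename_mod (sum_mod F) s) (rename_mod (sum_mod F) s) (\<lambda>x. s (f (inv_into (car (sum_mod F)) s x)))"
  using lin_on_comp[OF lin_on_comp[OF lin_on_inv_rename_mod[OF kmodule_sum_mod s] assms]
      lin_on_rename_mod[OF kmodule_sum_mod s]] .

private lemmas inv_s = inv_into_f_f[OF s]
private lemmas in_S = lin_on_closed[OF lin_on_proj] lin_on_closed[OF lin_on_shift]
  kmod_zero[OF kmodule_sum_mod]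

text \<open>The assumptions of the context of \<open>mkyd\<close>, in the same order, so that its
  lemmas can be discharged by these facts.\<close>

private lemma direct_sum_facts:
  shows "ext_kmodule (rename_mod (sum_mod F) s)"
    "\<And>h. lin_on (rename_mod (sum_mod F) s) (rename_mod (sum_mod F) s) (\<lambda>x. s (shift F h (inv_into (car (sum_mod F)) s x)))"
    "\<And>x. x \<in> car (rename_mod (sum_mod F) s) \<Longrightarrow> s (shift F 0 (inv_into (car (sum_mod F)) s x)) = x"
    "\<And>g h x. x \<in> car (rename_mod (sum_mod F) s) \<Longrightarrow> s (shift F (g + h) (inv_into (car (sum_mod F)) s x)) =
      s (shift F g (inv_into (car (sum_mod F)) s (s (shift F h (inv_into (car (sum_mod F)) s x)))))"
    "\<And>g. lin_on (rename_mod (sum_mod F) s) (rename_mod (sum_mod F) s) (\<lambda>x. s (proj F g (inv_into (car (sum_mod F)) s x)))"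
    "\<And>x. x \<in> car (rename_mod (sum_mod F) s) \<Longrightarrow>
      finite {g. s (proj F g (inv_into (car (sum_mod F)) s x)) \<noteq> vzero (rename_mod (sum_mod F) s)}"
    "\<And>x k g. x \<in> car (rename_mod (sum_mod F) s) \<Longrightarrow>
      s (proj F k (inv_into (car (sum_mod F)) s (s (proj F g (inv_into (car (sum_mod F)) s x))))) =
      (if k = g then s (proj F g (inv_into (car (sum_mod F)) s x)) else vzero (rename_mod (sum_mod F) s))"
    "\<And>x k g. x \<in> car (rename_mod (sum_mod F) s) \<Longrightarrow>
      s (proj F k (inv_into (car (sum_mod F)) s (s (shift F g (inv_into (car (sum_mod F)) s x))))) =
      s (shift F g (inv_into (car (sum_mod F)) s (s (proj F (- g + k + g) (inv_into (car (sum_mod F)) s x)))))"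
    "\<And>x y. x \<in> car (rename_mod (sum_mod F) s) \<Longrightarrow> y \<in> car (rename_mod (sum_mod F) s) \<Longrightarrow>
      (\<And>g. s (proj F g (inv_into (car (sum_mod F)) s x)) = s (proj F g (inv_into (car (sum_mod F)) s y))) \<Longrightarrow> x = y"
proof -
  fix x assume "x \<in> car (rename_mod (sum_mod F) s)"
  then obtain p where p: "p \<in> car (sum_mod F)" "x = s p" by auto
  have "{g. s (proj F g p) \<noteq> s (vzero (sum_mod F))} \<subseteq> {g. p g \<noteq> vzero (fob F g)}"
    by (auto simp: proj_def fun_eq_iff intro!: arg_cong[of _ _ s])
  then show "finite {g. s (proj F g (inv_into (car (sum_mod F)) s x)) \<noteq> vzero (rename_mod (sum_mod F) s)}"
    using p by (auto simp: inv_s car_sum_mod intro: finite_subset)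
next
  fix x y assume "x \<in> car (rename_mod (sum_mod F) s)" "y \<in> car (rename_mod (sum_mod F) s)"
  then obtain p q where p: "p \<in> car (sum_mod F)" "x = s p" and q: "q \<in> car (sum_mod F)" "y = s q" by auto
  assume "\<And>g. s (proj F g (inv_into (car (sum_mod F)) s x)) = s (proj F g (inv_into (car (sum_mod F)) s y))"
  then have "proj F g p = proj F g q" for g
    using inj_onD[OF s, of "proj F g p" "proj F g q"] p q by (simp add: inv_s in_S)
  then have "p = q"
    by (metis proj_def ext)
  then show "x = y" using p q by simp
qed (use ext_kmodule_rename_mod[OF kmodule_sum_mod s] in
    \<open>auto simp: inv_s in_S shift_zero shift_add proj_proj proj_shift intro: lin_on_conjugate lin_on_proj lin_on_shift\<close>)

lemma yd_module_direct_sum: "yd_module group_hopf (direct_sum F s)"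
  unfolding direct_sum_def by (rule yd_module_mkyd) (fact direct_sum_facts)+

lemma rho_direct_sum:
  assumes p: "p \<in> car (sum_mod F)"
  shows "rho (direct_sum F s) g (s p) = s (shift F g p)"
proof -
  have "s p \<in> car (rename_mod (sum_mod F) s)" using p by simp
  then have "rho (direct_sum F s) g (s p) = s (shift F g (inv_into (car (sum_mod F)) s (s p)))"
    unfolding direct_sum_def by (rule rho_mkyd[rotated -1]) (fact direct_sum_facts)+
  then show ?thesis using p by (simp add: inv_s)
qed

lemma gr_direct_sum:
  assumes p: "p \<in> car (sum_mod F)"
  shows "gr (direct_sum F s) g (s p) = s (proj F g p)"
proof -
  have "s p \<in> car (rename_mod (sum_mod F) s)" using p by simp
  then have "gr (direct_sum F s) g (s p) = s (proj F g (inv_into (car (sum_mod F)) s (s p)))"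
    unfolding direct_sum_def by (rule gr_mkyd[rotated -1]) (fact direct_sum_facts)+
  then show ?thesis using p by (simp add: inv_s)
qed

end

end


section \<open>Homogeneous components\<close>

text \<open>The submodule of degree \<open>g\<close>. Its operations are cut down to the smaller
  carrier, since X's own operations are not extensional there.\<close>

definition hcomp :: "('k::field, 'g::group_add \<Rightarrow>\<^sub>0 'k, 'v) ydmod \<Rightarrow> 'g \<Rightarrow> ('k, 'v) kmod" where
  "hcomp X g =
    \<lparr> car = {x\<in>car X. gr X g x = x},
      vadd = (\<lambda>x y. if x \<in> {x\<in>car X. gr X g x = x} \<and> y \<in> {x\<in>car X. gr X g x = x}
        then vadd X x y else undefined),
      vzero = vzero X,
      vsmult = (\<lambda>c. \<lambda>x\<in>{x\<in>car X. gr X g x = x}. vsmult X c x) \<rparr>"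

lemma hcomp_simps:
  "x \<in> car (hcomp X g) \<longleftrightarrow> x \<in> car X \<and> gr X g x = x"
  "x \<in> car (hcomp X g) \<Longrightarrow> y \<in> car (hcomp X g) \<Longrightarrow> vadd (hcomp X g) x y = vadd X x y"
  "vzero (hcomp X g) = vzero X"
  "x \<in> car (hcomp X g) \<Longrightarrow> vsmult (hcomp X g) c x = vsmult X c x"
  by (auto simp: hcomp_def)

definition components :: "('k::field, 'g::group_add \<Rightarrow>\<^sub>0 'k, 'v) ydmod \<Rightarrow> ('k, 'g, 'v) kmod_func" where
  "components X =
    \<lparr> fob = hcomp X,
      farr = (\<lambda>(h, g). (hcomp X g, \<lambda>x\<in>car (hcomp X g). rho X h x, hcomp X (h + g - h))) \<rparr>"

lemma fob_components [simp]: "fob (components X) = hcomp X"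
  by (simp add: components_def)

lemma fmap_components [simp]: "x \<in> car (hcomp X g) \<Longrightarrow> fmap (components X) h g x = rho X h x"
  by (simp add: components_def fmap_def)

text \<open>The addition map from the external direct sum of the components to X. It is extensional,
  so that equality of two such maps follows from equality on the carrier.\<close>

definition assemble :: "('k::field, 'g::group_add \<Rightarrow>\<^sub>0 'k, 'v) ydmod \<Rightarrow> ('g \<Rightarrow> 'v) \<Rightarrow> 'v" where
  "assemble X = (\<lambda>p\<in>car (sum_mod (components X)). THE x. x \<in> car X \<and> (\<forall>g. gr X g x = p g))"

context
  fixes X :: "('k::field, 'g::group_add \<Rightarrow>\<^sub>0 'k, 'v) ydmod"
  assumes yd: "yd_module group_hopf X"
begin

lemma rho_hcomp: "x \<in> car (hcomp X g) \<Longrightarrow> rho X h x \<in> car (hcomp X (h + g - h))"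
  using yd_gr_rho[OF yd, of x "h + g - h" h] by (simp add: hcomp_simps yd_rho_in[OF yd])

lemma ext_kmodule_hcomp: "ext_kmodule (hcomp X g)"
proof -
  note X = yd_kmodule[OF yd] and lin = yd_lin_on_gr[OF yd]
  have add: "vadd X x y \<in> car (hcomp X g)" if "x \<in> car (hcomp X g)" "y \<in> car (hcomp X g)" for x y
    using that X by (simp add: hcomp_simps lin_on_add[OF lin])
  have scale: "vsmult X c x \<in> car (hcomp X g)" if "x \<in> car (hcomp X g)" for c x
    using that X by (simp add: hcomp_simps lin_on_smult[OF lin])
  have zero: "vzero X \<in> car (hcomp X g)"
    using X by (simp add: hcomp_simps yd_gr_zero[OF yd])
  have sub: "x \<in> car X" if "x \<in> car (hcomp X g)" for x
    using that by (simp add: hcomp_simps)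
  have neg: "\<exists>y\<in>car (hcomp X g). vadd (hcomp X g) x y = vzero X" if "x \<in> car (hcomp X g)" for x
    using that X scale sub by (intro bexI[of _ "vsmult X (- 1) x"]) (simp_all add: hcomp_simps(2))
  have "kmodule (hcomp X g)"
    unfolding kmodule_def using X neg
    by (auto simp: hcomp_simps(2-) add scale zero sub kmod_assoc kmod_smult_add kmod_add_smult
        kmod_mult_smult intro: kmod_comm)
  then show ?thesis
    by (auto simp: ext_kmodule_def hcomp_def)
qed

lemma kmodule_hcomp: "kmodule (hcomp X g)"
  using ext_kmodule_hcomp by (simp add: ext_kmodule_def)

lemma lin_on_hcomp:
  assumes "lin_on X W f" "\<And>x. x \<in> car (hcomp X g) \<Longrightarrow> f x \<in> car (hcomp Y g')" "kmod.truncate W = kmod.truncate Y"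
  shows "lin_on (hcomp X g) (hcomp Y g') f"
  using assms by (intro lin_onI) (auto simp: hcomp_simps lin_on_add lin_on_smult kmod_truncate_eq_iff)

lemma kmod_functor_components: "kmod_functor (components X)"
proof -
  have "klinear (hcomp X g) (hcomp X (h + g - h)) (fmap (components X) h g)" for h g
  proof -
    have "fmap (components X) h g = restrict (rho X h) (car (hcomp X g))"
      by (simp add: components_def fmap_def)
    then show ?thesis
      using klinear_restrict[OF kmodule_hcomp, of g "hcomp X (h + g - h)" "rho X h"]
        lin_on_hcomp[OF yd_lin_on_rho[OF yd], of g h X "h + g - h"] rho_hcomp by simp
  qed
  moreover have "farr (components X) (h, g) = (hcomp X g, fmap (components X) h g, hcomp X (h + g - h))" for h g
    by (simp add: components_def fmap_def)
  ultimately show ?thesis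
    using rho_hcomp
    by (auto simp: kmod_functor_iff ext_kmodule_hcomp)
      (simp_all add: hcomp_simps yd_rho_zero[OF yd] yd_rho_add[OF yd])
qed

lemma gr_in_hcomp: "x \<in> car X \<Longrightarrow> gr X g x \<in> car (hcomp X g)"
  by (simp add: hcomp_simps yd_gr_in[OF yd] yd_gr_gr[OF yd])

lemma gr_in_sum_mod: "x \<in> car X \<Longrightarrow> (\<lambda>g. gr X g x) \<in> car (sum_mod (components X))"
  by (simp add: car_sum_mod gr_in_hcomp hcomp_simps(3) yd_finite_gr[OF yd])

lemma assemble:
  assumes "p \<in> car (sum_mod (components X))"
  shows "assemble X p \<in> car X" "gr X g (assemble X p) = p g"
proof -
  have "\<exists>!x. x \<in> car X \<and> (\<forall>g. gr X g x = p g)"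
    using assms by (intro yd_assemble[OF yd]) (auto simp: car_sum_mod hcomp_simps)
  from theI'[OF this] assms show "assemble X p \<in> car X" "gr X g (assemble X p) = p g"
    by (auto simp: assemble_def)
qed

lemma assemble_gr: "x \<in> car X \<Longrightarrow> assemble X (\<lambda>g. gr X g x) = x"
  by (rule yd_eqI[OF yd]) (simp_all add: assemble gr_in_sum_mod)

lemma inj_on_assemble: "inj_on (assemble X) (car (sum_mod (components X)))"
proof (rule inj_onI)
  fix p q assume "p \<in> car (sum_mod (components X))" "q \<in> car (sum_mod (components X))"
    "assemble X p = assemble X q"
  then show "p = q" using assemble(2)[of p] assemble(2)[of q] by (simp add: fun_eq_iff)
qed

lemma bij_betw_assemble: "bij_betw (assemble X) (car (sum_mod (components X))) (car X)"
proof -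
  have "x \<in> assemble X ` car (sum_mod (components X))" if "x \<in> car X" for x
    using assemble_gr[OF that] gr_in_sum_mod[OF that] by (metis imageI)
  then show ?thesis using inj_on_assemble assemble(1) by (auto simp: bij_betw_def)
qed

text \<open>The addition map is a linear bijection onto X, so naming the families by their sums
  gives back X itself; action and grading are compared degree by degree. Hence
  \<open>components X\<close> and \<open>assemble X\<close> together determine X.\<close>

lemma direct_sum_components: "direct_sum (components X) (assemble X) = X"
proof (rule yd_module_eqI)
  note K = kmod_functor_components and X = yd_kmodule[OF yd]
  note S = kmodule_sum_mod[OF K] and lin = yd_lin_on_gr[OF yd]
  show "yd_module group_hopf (direct_sum (components X) (assemble X))"
    by (rule yd_module_direct_sum[OF K inj_on_assemble])
  have sub: "p g \<in> car (hcomp X g)" if "p \<in> car (sum_mod (components X))" for p g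
    using that by (simp add: car_sum_mod)
  have "lin_on (sum_mod (components X)) (kmod.truncate X) (assemble X)"
  proof (rule lin_onI)
    fix p q assume p: "p \<in> car (sum_mod (components X))" and q: "q \<in> car (sum_mod (components X))"
    have "assemble X (vadd (sum_mod (components X)) p q) = vadd X (assemble X p) (assemble X q)"
      using p q S X by - (rule yd_eqI[OF yd], simp_all add: assemble lin_on_add[OF lin] hcomp_simps(2) sub[OF p] sub[OF q])
    then show "assemble X (vadd (sum_mod (components X)) p q) =
        vadd (kmod.truncate X) (assemble X p) (assemble X q)"
      by (simp add: kmod.truncate_def)
  next
    fix p c assume p: "p \<in> car (sum_mod (components X))"
    have "assemble X (vsmult (sum_mod (components X)) c p) = vsmult X c (assemble X p)"
      using p S X by - (rule yd_eqI[OF yd], simp_all add: assemble lin_on_smult[OF lin] hcomp_simps(4) sub[OF p])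
    then show "assemble X (vsmult (sum_mod (components X)) c p) = vsmult (kmod.truncate X) c (assemble X p)"
      by (simp add: kmod.truncate_def)
  qed (simp add: assemble kmod.truncate_def)
  moreover have "ext_kmodule (kmod.truncate X)"
    using yd_ext_kmodule[OF yd]
    unfolding ext_kmodule_def kmodule_def kmod.truncate_def kmod.simps .
  ultimately show "kmod.truncate (direct_sum (components X) (assemble X)) = kmod.truncate X"
    unfolding truncate_direct_sum
    using bij_betw_assemble by (intro rename_mod_eqI[OF S]) (simp_all add: kmod.truncate_def)
  fix g x assume "x \<in> car (direct_sum (components X) (assemble X))"
  then obtain p where p: "p \<in> car (sum_mod (components X))" "x = assemble X p" by auto
  then have x: "x \<in> car X" by (simp add: assemble)
  have "assemble X (shift (components X) g p) = rho X g (assemble X p)"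
    using p lin_on_closed[OF lin_on_shift[OF K] p(1)]
    by - (rule yd_eqI[OF yd], simp_all add: assemble yd_rho_in[OF yd] yd_gr_rho[OF yd] shift_def sub[OF p(1)])
  then show "rho (direct_sum (components X) (assemble X)) g x = rho X g x"
    using p by (simp add: rho_direct_sum[OF K inj_on_assemble])
  have "gr X k (p g) = (if k = g then p g else vzero X)" for k
    using sub[OF p(1), of g] yd_gr_homogeneous[OF yd] by (simp add: hcomp_simps(1))
  then have "assemble X (proj (components X) g p) = gr X g (assemble X p)"
    using p lin_on_closed[OF lin_on_proj[OF K] p(1), of g] sub[OF p(1), of g]
    by - (rule yd_eqI[OF yd], auto simp: assemble yd_gr_in[OF yd] proj_def hcomp_simps(1,3))
  then show "gr (direct_sum (components X) (assemble X)) g x = gr X g x"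
    using p by (simp add: gr_direct_sum[OF K inj_on_assemble])
qed (rule yd)

end

text \<open>An element of degree \<open>g\<close> in the direct sum is the name of a family
  vanishing in all other degrees, so its entry at \<open>g\<close>, which \<open>m g\<close> reads
  from the name, identifies it with an element of \<open>fob F g\<close>.\<close>

lemma rename_components_direct_sum:
  assumes F: "kmod_functor F" and s: "inj_on s (car (sum_mod F))"
    and m: "\<And>p g. p \<in> car (sum_mod F) \<Longrightarrow> m g (s p) = p g"
  shows "rename_functor (components (direct_sum F s)) m = F" and "inj_on (m g) (car (hcomp (direct_sum F s) g))"
proof -
  note yd = yd_module_direct_sum[OF F s] and S = kmodule_sum_mod[OF F] and V = fob_kmodule[OF F]
  note K = kmod_functor_components[OF yd]
  have hc: "x \<in> car (hcomp (direct_sum F s) g) \<longleftrightarrow>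
      (\<exists>p\<in>car (sum_mod F). x = s p \<and> (\<forall>k. k \<noteq> g \<longrightarrow> p k = vzero (fob F k)))" for x g
  proof -
    have "s (proj F g p) = s p \<longleftrightarrow> (\<forall>k. k \<noteq> g \<longrightarrow> p k = vzero (fob F k))" if p: "p \<in> car (sum_mod F)" for p
      using inj_on_eq_iff[OF s lin_on_closed[OF lin_on_proj[OF F] p] p] by (auto simp: proj_def fun_eq_iff)
    then show ?thesis
      by (auto simp: hcomp_simps gr_direct_sum[OF F s])
  qed
  have sub: "x \<in> car (rename_mod (sum_mod F) s)" if "x \<in> car (hcomp (direct_sum F s) g)" for x g
    using that by (auto simp: hcomp_simps)
  have inj: "inj_on (m g) (car (hcomp (direct_sum F s) g))" for g
    by (rule inj_onI) (auto simp: hc m fun_eq_iff, metis ext)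
  then show "inj_on (m g) (car (hcomp (direct_sum F s) g))" .
  have "inj_on (m g) (car (fob (components (direct_sum F s)) g))" for g
    using inj by simp
  then show "rename_functor (components (direct_sum F s)) m = F"
  proof (rule rename_functor_eqI[OF K _ F])
    fix g
    have L: "lin_on (rename_mod (sum_mod F) s) (fob F g) (m g)"
      using S s kmod_add[OF S] kmod_smult[OF S] by (intro lin_onI) (auto simp: m car_sum_mod)
    show "lin_on (fob (components (direct_sum F s)) g) (fob F g) (m g)"
      unfolding fob_components
      by (rule lin_onI) (simp_all only: hcomp_simps(2,4) vadd_direct_sum vsmult_direct_sum sub
          lin_on_closed[OF L] lin_on_add[OF L] lin_on_smult[OF L])
    have "v \<in> m g ` car (hcomp (direct_sum F s) g)" if v: "v \<in> car (fob F g)" for v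
    proof -
      let ?p = "\<lambda>k. if k = g then v else vzero (fob F k)"
      have p: "?p \<in> car (sum_mod F)"
        using v V by (auto simp: car_sum_mod intro: finite_subset[of _ "{g}"])
      then show ?thesis
        by (intro image_eqI[of _ _ "s ?p"]) (auto simp: m hc)
    qed
    moreover have "m g x \<in> car (fob F g)" if "x \<in> car (hcomp (direct_sum F s) g)" for x
      using that by (auto simp: hc m car_sum_mod)
    ultimately show "bij_betw (m g) (car (fob (components (direct_sum F s)) g)) (car (fob F g))"
      using inj by (auto simp: bij_betw_def)
  next
    fix h g x assume "x \<in> car (fob (components (direct_sum F s)) g)"
    then show "m (h + g - h) (fmap (components (direct_sum F s)) h g x) = fmap F h g (m g x)"
      using lin_on_closed[OF lin_on_shift[OF F]]
      by (auto simp: hc rho_direct_sum[OF F s] m shift_def)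
  qed
qed

section \<open>Counting names\<close>

text \<open>A finite set is enumerated by a list, and the list is coded by iterating a pairing of
  \<open>A \<times> A\<close> into \<open>A\<close>. The length is stored as well, by means of a
  copy of the natural numbers in \<open>A\<close>.\<close>

lemma infinite_Fpow_inj:
  fixes A :: "'a set"
  assumes "infinite A"
  shows "\<exists>f. inj_on f (Fpow A) \<and> f ` Fpow A \<subseteq> A"
proof -
  obtain c where "bij_betw c (A \<times> A) A"
    using card_of_Times_same_infinite[OF assms, unfolded card_of_ordIso[symmetric]] by blast
  then have c: "inj_on c (A \<times> A)" "\<And>x y. x \<in> A \<Longrightarrow> y \<in> A \<Longrightarrow> c (x, y) \<in> A"
    by (auto simp: bij_betw_def)
  obtain n :: "nat \<Rightarrow> 'a" where n: "inj n" "range n \<subseteq> A"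
    using infinite_countable_subset[OF assms] by blast
  \<comment> \<open>The end marker \<open>n 0\<close> may itself be the code of a pair, so
    \<open>e\<close> is claimed to be injective only among lists of equal length.\<close>
  define e where "e xs = foldr (\<lambda>x y. c (x, y)) xs (n 0)" for xs
  have e_in: "e xs \<in> A" if "set xs \<subseteq> A" for xs
    using that n(2) by (induction xs) (auto simp: e_def intro: c(2))
  have e_inj: "xs = ys" if "length xs = length ys" "set xs \<subseteq> A" "set ys \<subseteq> A" "e xs = e ys" for xs ys
    using that
  proof (induction xs ys rule: list_induct2)
    case (Cons x xs y ys)
    then have "c (x, e xs) = c (y, e ys)" by (simp add: e_def)
    then have "(x, e xs) = (y, e ys)"
      by (rule inj_onD[OF c(1)]) (use e_in Cons.prems in auto)
    with Cons show ?case by simp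
  qed simp
  define l where "l S = (SOME xs. set xs = S)" for S :: "'a set"
  have l: "set (l S) = S" if "finite S" for S
    unfolding l_def by (rule someI_ex[OF finite_list[OF that]])
  define f where "f S = c (n (length (l S)), e (l S))" for S
  have "inj_on f (Fpow A)"
  proof (rule inj_onI)
    fix S T assume S: "S \<in> Fpow A" and T: "T \<in> Fpow A" and eq: "f S = f T"
    then have *: "set (l S) \<subseteq> A" "set (l T) \<subseteq> A" by (auto simp: Fpow_def l)
    have "(n (length (l S)), e (l S)) = (n (length (l T)), e (l T))"
      using eq n(2) e_in[OF *(1)] e_in[OF *(2)] by (intro inj_onD[OF c(1)]) (auto simp: f_def)
    then have "l S = l T"
      using e_inj * n(1) by (simp add: inj_eq)
    then show "S = T" using S T l by (metis (no_types, lifting) Fpow_def mem_Collect_eq)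
  qed
  moreover have "f ` Fpow A \<subseteq> A"
    using n(2) e_in by (auto simp: f_def Fpow_def l intro!: c(2))
  ultimately show ?thesis by blast
qed

lemma finite_tuple_inj:
  fixes c :: "'v \<Rightarrow> 'v \<Rightarrow> 'v"
  assumes c: "\<And>x y x' y'. c x y = c x' y' \<Longrightarrow> x = x' \<and> y = y'" and "finite P"
  shows "\<exists>e :: ('b \<Rightarrow> 'v) \<Rightarrow> 'v. \<forall>s s'. e s = e s' \<longrightarrow> (\<forall>p\<in>P. s p = s' p)"
  using assms(2)
proof (induction P rule: finite_induct)
  case (insert p P)
  then obtain e :: "('b \<Rightarrow> 'v) \<Rightarrow> 'v" where "\<forall>s s'. e s = e s' \<longrightarrow> (\<forall>p\<in>P. s p = s' p)" by blast
  then show ?case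
    by (intro exI[of _ "\<lambda>s. c (s p) (e s)"]) (auto dest: c)
qed auto

text \<open>
  For infinite \<open>A\<close> the set \<open>P\<close> injects into \<open>A\<close>; for finite \<open>A\<close> the set \<open>P\<close> is finite, and a
  \<open>P\<close>-indexed family in \<open>'v\<close> is a single element of \<open>'v\<close>.
\<close>

lemma encode_families:
  fixes c :: "'v \<Rightarrow> 'v \<Rightarrow> 'v" and A :: "'a set" and P :: "'b set"
  assumes c: "\<And>x y x' y'. c x y = c x' y' \<Longrightarrow> x = x' \<and> y = y'"
    and A: "A \<noteq> {}" and f: "inj_on f P" "f ` P \<subseteq> Fpow A"
  shows "\<exists>\<Theta> :: ('b \<Rightarrow> 'v) \<Rightarrow> 'a \<Rightarrow> 'v.
    \<forall>s s'. (\<forall>a\<in>A. \<Theta> s a = \<Theta> s' a) \<longrightarrow> (\<forall>p\<in>P. s p = s' p)"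
proof (cases "finite A")
  case True
  then have "finite P"
    using f by (meson Fpow_subset_Pow finite_Pow_iff finite_subset inj_on_finite)
  from finite_tuple_inj[OF c this] obtain e :: "('b \<Rightarrow> 'v) \<Rightarrow> 'v"
    where "\<forall>s s'. e s = e s' \<longrightarrow> (\<forall>p\<in>P. s p = s' p)" by blast
  \<comment> \<open>The whole family is a single code, stored as a constant function; since
    \<open>A\<close> is nonempty, the code can be read back from it.\<close>
  with A show ?thesis by (intro exI[of _ "\<lambda>s a. e s"]) blast
next
  case False
  then obtain k where k: "inj_on k (Fpow A)" "k ` Fpow A \<subseteq> A"
    using infinite_Fpow_inj by blast
  have inj: "inj_on (k \<circ> f) P"
    using f k(1) by (meson comp_inj_on inj_on_subset)
  \<comment> \<open>The value at \<open>p\<close> is stored in the slot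
    \<open>(k \<circ> f) p\<close> of \<open>A\<close>; the contents of slots outside the image are
    arbitrary.\<close>
  show ?thesis
  proof (intro exI[of _ "\<lambda>s a. s (inv_into P (k \<circ> f) a)"] allI impI ballI)
    fix s s' :: "'b \<Rightarrow> 'v" and p
    assume eq: "\<forall>a\<in>A. s (inv_into P (k \<circ> f) a) = s' (inv_into P (k \<circ> f) a)" and p: "p \<in> P"
    then have "(k \<circ> f) p \<in> A" using f(2) k(2) by auto
    with eq have "s (inv_into P (k \<circ> f) ((k \<circ> f) p)) = s' (inv_into P (k \<circ> f) ((k \<circ> f) p))"
      by blast
    then show "s p = s' p" by (simp only: inv_into_f_f[OF inj p])
  qed
qed

text \<open>A family is coded by the graph of its nonzero part, which is finite; a degree missing
  from the graph stands for the entry zero.\<close>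

lemma sum_mod_Fpow:
  "\<exists>f. inj_on f (car (sum_mod F)) \<and> f ` car (sum_mod F) \<subseteq> Fpow (SIGMA g:UNIV. car (fob F g))"
proof (intro exI[of _ "\<lambda>p. {(g, p g) | g. p g \<noteq> vzero (fob F g)}"] conjI)
  show "inj_on (\<lambda>p. {(g, p g) | g. p g \<noteq> vzero (fob F g)}) (car (sum_mod F))"
  proof (rule inj_onI, rule ext)
    fix p q g assume "{(g, p g) | g. p g \<noteq> vzero (fob F g)} = {(g, q g) | g. q g \<noteq> vzero (fob F g)}"
    then have "(g, x) \<in> {(g, p g) | g. p g \<noteq> vzero (fob F g)} \<longleftrightarrow>
        (g, x) \<in> {(g, q g) | g. q g \<noteq> vzero (fob F g)}" for x
      by simp
    from this[of "p g"] this[of "q g"] show "p g = q g" by auto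
  qed
  have "{(g, p g) | g. p g \<noteq> vzero (fob F g)} = (\<lambda>g. (g, p g)) ` {g. p g \<noteq> vzero (fob F g)}" for p
    by auto
  then show "(\<lambda>p. {(g, p g) | g. p g \<noteq> vzero (fob F g)}) ` car (sum_mod F) \<subseteq>
      Fpow (SIGMA g:UNIV. car (fob F g))"
    by (auto simp: Fpow_def car_sum_mod)
qed


section \<open>The equivalence\<close>

lemma isomorphic_objects_refl:
  assumes "is_category D" "a \<in> ob D"
  shows "isomorphic_objects D a a"
  unfolding isomorphic_objects_def using cat_simps[OF assms(1)] assms(2)
  by (intro bexI[of _ "ident D a"]) auto

lemma is_category_kmod_functor_category: "is_category kmod_functor_category"
  by (rule is_category_functor_category[OF is_category_conj_groupoid is_category_kmod_category])

lemma ob_kmod_functor_category [simp]: "F \<in> ob kmod_functor_category \<longleftrightarrow> kmod_functor F"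
  by (simp add: functor_category_def)

abbreviation kG_yd_category ::
  "(('k::field, 'g::group_add \<Rightarrow>\<^sub>0 'k, 'v) ydmod, _) category" where
  "kG_yd_category \<equiv> yd_category group_hopf"

lemma kG_yd_category_simps:
  "ob (kG_yd_category :: (('k::field, 'g::group_add \<Rightarrow>\<^sub>0 'k, 'v) ydmod, _) category) = {X. yd_module group_hopf X}"
  "arr (kG_yd_category :: (('k::field, 'g::group_add \<Rightarrow>\<^sub>0 'k, 'v) ydmod, _) category) =
    {(X, f, Y). yd_module group_hopf X \<and> yd_module group_hopf Y \<and> yd_morphism group_hopf X Y f}"
  "dom (kG_yd_category :: (('k::field, 'g::group_add \<Rightarrow>\<^sub>0 'k, 'v) ydmod, _) category) (X, f, Y) = X"
  "cod (kG_yd_category :: (('k::field, 'g::group_add \<Rightarrow>\<^sub>0 'k, 'v) ydmod, _) category) (X, f, Y) = Y"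
  by (simp_all add: yd_category_def)

definition hmap ::
  "('k::field, 'g::group_add \<Rightarrow>\<^sub>0 'k, 'v) ydmod \<Rightarrow> ('v \<Rightarrow> 'v) \<Rightarrow>
   ('k, 'g \<Rightarrow>\<^sub>0 'k, 'v) ydmod \<Rightarrow> 'g \<Rightarrow> ('k, 'v) kmod \<times> ('v \<Rightarrow> 'v) \<times> ('k, 'v) kmod" where
  "hmap X f Y g = (hcomp X g, \<lambda>x\<in>car (hcomp X g). f x, hcomp Y g)"

definition components_functor ::
  "(('k::field, 'g::group_add \<Rightarrow>\<^sub>0 'k, 'v) ydmod,
    ('k, 'g \<Rightarrow>\<^sub>0 'k, 'v) ydmod \<times> ('v \<Rightarrow> 'v) \<times> ('k, 'g \<Rightarrow>\<^sub>0 'k, 'v) ydmod,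
    ('k, 'g, 'v) kmod_func,
    ('k, 'g, 'v) kmod_func \<times> ('g \<Rightarrow> ('k, 'v) kmod \<times> ('v \<Rightarrow> 'v) \<times> ('k, 'v) kmod) \<times>
      ('k, 'g, 'v) kmod_func) func" where
  "components_functor =
    \<lparr> fob = (\<lambda>X\<in>ob kG_yd_category. components X),
      farr = (\<lambda>(X, f, Y)\<in>arr kG_yd_category. (components X, hmap X f Y, components Y)) \<rparr>"

context
  fixes X Y :: "('k::field, 'g::group_add \<Rightarrow>\<^sub>0 'k, 'v) ydmod"
  assumes X: "yd_module group_hopf X" and Y: "yd_module group_hopf Y"
begin

lemma yd_morphism_hcomp:
  assumes "yd_morphism group_hopf X Y f" "x \<in> car (hcomp X g)"
  shows "f x \<in> car (hcomp Y g)"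
proof -
  have "lin_on X Y f" "f (gr X g x) = gr Y g (f x)" "x \<in> car X" "gr X g x = x"
    using assms unfolding yd_morphism_group_hopf_iff[OF X Y] hcomp_simps(1)
    by (blast intro: klinear_lin_on)+
  then show ?thesis by (metis hcomp_simps(1) lin_on_closed)
qed

lemma is_nat_trans_hmap:
  assumes f: "yd_morphism group_hopf X Y f"
  shows "is_nat_trans conj_groupoid kmod_category (components X) (hmap X f Y) (components Y)"
proof -
  have lin: "lin_on X Y f" and rho: "\<And>g x. x \<in> car X \<Longrightarrow> f (rho X g x) = rho Y g (f x)"
    using f by (auto simp: yd_morphism_group_hopf_iff[OF X Y] klinear_lin_on)
  show ?thesis
    unfolding kmod_nat_trans_iff[OF kmod_functor_components[OF X] kmod_functor_components[OF Y]]
  proof (intro exI[of _ "\<lambda>g. \<lambda>x\<in>car (hcomp X g). f x"] conjI allI ballI)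
    show "klinear (fob (components X) g) (fob (components Y) g) (\<lambda>x\<in>car (hcomp X g). f x)" for g
      using lin_on_hcomp[OF X lin, of g Y g] yd_morphism_hcomp[OF f, of _ g]
        klinear_restrict[OF kmodule_hcomp[OF X], of g "hcomp Y g" f] by simp
    fix h g x assume x: "x \<in> car (fob (components X) g)"
    then show "(\<lambda>x\<in>car (hcomp X (h + g - h)). f x) (fmap (components X) h g x) =
        fmap (components Y) h g ((\<lambda>x\<in>car (hcomp X g). f x) x)"
      using rho_hcomp[OF X, of x g h] yd_morphism_hcomp[OF f, of x g] rho[of x h]
      by (simp add: hcomp_simps(1)[of x])
  qed (auto simp: hmap_def)
qed

text \<open>The components of \<open>f x\<close> are the images of the components of
  \<open>x\<close>, so a morphism is determined by its values on homogeneous elements.\<close>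

lemma hmap_faithful:
  assumes f: "yd_morphism group_hopf X Y f" and f': "yd_morphism group_hopf X Y f'"
    and eq: "hmap X f Y = hmap X f' Y"
  shows "f = f'"
proof (rule extensionalityI[of _ "car X"])
  have 1: "klinear X Y f" "\<And>g x. x \<in> car X \<Longrightarrow> f (gr X g x) = gr Y g (f x)"
    and 2: "klinear X Y f'" "\<And>g x. x \<in> car X \<Longrightarrow> f' (gr X g x) = gr Y g (f' x)"
    using f f' by (auto simp: yd_morphism_group_hopf_iff[OF X Y])
  show "f \<in> extensional (car X)" "f' \<in> extensional (car X)"
    using 1(1) 2(1) by (auto simp: klinear_iff_lin_on)
  fix x assume x: "x \<in> car X"
  have "f (gr X g x) = f' (gr X g x)" for g
  proof -
    have "(\<lambda>x\<in>car (hcomp X g). f x) (gr X g x) = (\<lambda>x\<in>car (hcomp X g). f' x) (gr X g x)"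
      using fun_cong[OF eq, of g] by (simp add: hmap_def)
    then show ?thesis using gr_in_hcomp[OF X x] by simp
  qed
  then show "f x = f' x"
    using 1 2 x lin_on_closed[OF klinear_lin_on] by (intro yd_eqI[OF Y, of "f x" "f' x"]) auto
qed

text \<open>The maps of the transformation are glued: an element is split into its components,
  mapped in each degree and reassembled in \<open>Y\<close>. Naturality becomes
  equivariance.\<close>

lemma hmap_full:
  assumes n: "is_nat_trans conj_groupoid kmod_category (components X) \<eta> (components Y)"
  shows "\<exists>f. yd_morphism group_hopf X Y f \<and> hmap X f Y = \<eta>"
proof -
  obtain m where \<eta>: "\<eta> = (\<lambda>g. (hcomp X g, m g, hcomp Y g))"
    and kl: "\<And>g. klinear (hcomp X g) (hcomp Y g) (m g)"
    and nat: "\<And>h g x. x \<in> car (hcomp X g) \<Longrightarrow>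
      m (h + g - h) (fmap (components X) h g x) = fmap (components Y) h g (m g x)"
    using n unfolding kmod_nat_trans_iff[OF kmod_functor_components[OF X] kmod_functor_components[OF Y]]
    by auto
  note lin = klinear_lin_on[OF kl] and kX = yd_kmodule[OF X] and kY = yd_kmodule[OF Y]
  note linX = yd_lin_on_gr[OF X] and linY = yd_lin_on_gr[OF Y] and hX = gr_in_hcomp[OF X]
  have m_in: "m g x \<in> car (hcomp Y g)" if "x \<in> car (hcomp X g)" for g x
    using lin_on_closed[OF lin that] .
  have m_zero: "m g (vzero X) = vzero Y" for g
    using lin_on_zero[OF lin kmodule_hcomp[OF X] kmodule_hcomp[OF Y]] by (simp add: hcomp_simps(3))
  define f where "f = (\<lambda>x\<in>car X. assemble Y (\<lambda>g. m g (gr X g x)))"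
  have "finite {g. m g (gr X g x) \<noteq> vzero Y}" if "x \<in> car X" for x
    by (rule finite_subset[OF _ yd_finite_gr[OF X that]]) (auto simp: m_zero)
  then have S: "(\<lambda>g. m g (gr X g x)) \<in> car (sum_mod (components Y))" if "x \<in> car X" for x
    using that m_in[OF hX[OF that]] by (simp add: car_sum_mod hcomp_simps(3))
  have f: "f x \<in> car Y" "gr Y g (f x) = m g (gr X g x)" if "x \<in> car X" for x g
    using assemble[OF Y S[OF that]] that by (simp_all add: f_def)
  have "klinear X Y f"
  proof -
    have "lin_on X Y f"
    proof (rule lin_onI)
      fix x y assume x: "x \<in> car X" and y: "y \<in> car X"
      have "m g (vadd X (gr X g x) (gr X g y)) = vadd Y (m g (gr X g x)) (m g (gr X g y))" for g
        using lin_on_add[OF lin hX[OF x] hX[OF y]] hX[OF x] hX[OF y] m_in by (simp add: hcomp_simps(2))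
      then show "f (vadd X x y) = vadd Y (f x) (f y)"
        using x y kX kY f(1)
        by - (rule yd_eqI[OF Y], simp_all add: f(2) lin_on_add[OF linX] lin_on_add[OF linY])
    next
      fix c x assume x: "x \<in> car X"
      have "m g (vsmult X c (gr X g x)) = vsmult Y c (m g (gr X g x))" for g
        using lin_on_smult[OF lin hX[OF x]] hX[OF x] m_in by (simp add: hcomp_simps(4))
      then show "f (vsmult X c x) = vsmult Y c (f x)"
        using x kX kY f(1)
        by - (rule yd_eqI[OF Y], simp_all add: f(2) lin_on_smult[OF linX] lin_on_smult[OF linY])
    qed (rule f(1))
    then show ?thesis by (simp add: klinear_iff_lin_on f_def)
  qed
  moreover have f_hcomp: "f x = m g x" if x: "x \<in> car (hcomp X g)" for g x
  proof (rule yd_eqI[OF Y])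
    have x': "x \<in> car X" "gr X g x = x" using x by (auto simp: hcomp_simps(1))
    have y: "m g x \<in> car Y" "gr Y g (m g x) = m g x" using m_in[OF x] by (auto simp: hcomp_simps(1))
    show "f x \<in> car Y" "m g x \<in> car Y" using f x' y by auto
    show "gr Y k (f x) = gr Y k (m g x)" for k
      using f(2)[OF x'(1), of k] yd_gr_homogeneous[OF X x', of k] yd_gr_homogeneous[OF Y y, of k]
      by (simp add: m_zero)
  qed
  moreover have "f (rho X h x) = rho Y h (f x)" if x: "x \<in> car X" for h x
  proof (rule yd_eqI[OF Y])
    show "f (rho X h x) \<in> car Y" "rho Y h (f x) \<in> car Y"
      using f(1) x yd_rho_in[OF X] yd_rho_in[OF Y] by auto
    fix k
    \<comment> \<open>Naturality at the arrow that starts in degree \<open>- h + k + h\<close> and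
      ends in degree \<open>k\<close>.\<close>
    have "m (h + (- h + k + h) - h) (rho X h (gr X (- h + k + h) x)) =
        rho Y h (m (- h + k + h) (gr X (- h + k + h) x))"
      using nat[OF hX[OF x], of h "- h + k + h"] m_in[OF hX[OF x]] hX[OF x] by simp
    then show "gr Y k (f (rho X h x)) = gr Y k (rho Y h (f x))"
      using x f(1) by (simp add: f(2) yd_rho_in[OF X] yd_gr_rho[OF X] yd_gr_rho[OF Y])
  qed
  moreover have "f (gr X g x) = gr Y g (f x)" if x: "x \<in> car X" for g x
    using f(2)[OF x] f_hcomp[OF hX[OF x]] by simp
  moreover have "hmap X f Y = \<eta>"
  proof -
    have "restrict f (car (hcomp X g)) = m g" for g
      using kl[of g] f_hcomp by (intro extensionalityI[of _ "car (hcomp X g)"]) (auto simp: klinear_iff_lin_on)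
    then show ?thesis by (simp add: hmap_def \<eta> fun_eq_iff)
  qed
  ultimately show ?thesis by (auto simp: yd_morphism_group_hopf_iff[OF X Y])
qed

end

lemma is_functor_components:
  "is_functor (kG_yd_category :: (('k::field, 'g::group_add \<Rightarrow>\<^sub>0 'k, 'v) ydmod, _) category)
     kmod_functor_category components_functor" (is "is_functor ?C ?D ?E")
proof -
  have ident: "farr ?E (ident ?C X) = ident ?D (fob ?E X)" if "X \<in> ob ?C" for X
    using that yd_morphism_ident[of X]
    by (auto simp: components_functor_def kG_yd_category_simps yd_category_def functor_category_def hmap_def
        conj_groupoid_def kmod_category_def fun_eq_iff hcomp_simps(1))
  have comp: "farr ?E (comp ?C g f) = comp ?D (farr ?E g) (farr ?E f)"
    if "f \<in> arr ?C" "g \<in> arr ?C" "cod ?C f = dom ?C g" for f g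
  proof -
    obtain X f' Y where f: "f = (X, f', Y)" by (cases f)
    moreover obtain Y' g' Z where "g = (Y', g', Z)" by (cases g)
    ultimately have g: "g = (Y, g', Z)" using that(3) by (simp add: kG_yd_category_simps)
    have *: "yd_module group_hopf X" "yd_module group_hopf Y" "yd_module group_hopf Z"
      "yd_morphism group_hopf X Y f'" "yd_morphism group_hopf Y Z g'"
      using that f g by (auto simp: yd_category_def)
    have "hmap X (compose (car X) g' f') Z k = comp kmod_category (hmap Y g' Z k) (hmap X f' Y k)" for k
      using yd_morphism_hcomp[OF *(1,2,4)]
      by (auto simp: hmap_def kmod_category_def compose_def hcomp_simps(1) fun_eq_iff)
    then show ?thesis
      using * yd_morphism_compose[OF *]
      by (simp add: f g components_functor_def kG_yd_category_simps yd_category_def functor_category_def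
          conj_groupoid_def fun_eq_iff)
  qed
  show ?thesis
    unfolding is_functor_def using ident comp
    by (auto simp: components_functor_def kG_yd_category_simps kmod_functor_components is_nat_trans_hmap)
      (auto simp: functor_category_def kmod_functor_components is_nat_trans_hmap)
qed

section \<open>Injections between the classes of objects\<close>

text \<open>With a single degree every element is homogeneous, so \<open>assemble X\<close> merely
  reads off the entry at 0 and adds no information to \<open>components X\<close>.\<close>

lemma inj_on_components_trivial_group:
  assumes trivial: "\<And>g :: 'g::group_add. g = 0"
  shows "inj_on components {X :: ('k::field, 'g \<Rightarrow>\<^sub>0 'k, 'v) ydmod. yd_module group_hopf X}"
proof (rule inj_onI)
  fix X Y :: "('k, 'g \<Rightarrow>\<^sub>0 'k, 'v) ydmod"
  assume "X \<in> {X. yd_module group_hopf X}" "Y \<in> {X. yd_module group_hopf X}"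
    and eq: "components X = components Y"
  then have X: "yd_module group_hopf X" and Y: "yd_module group_hopf Y" by auto
  have a: "assemble Z p = p 0"
    if Z: "yd_module group_hopf Z" and p: "p \<in> car (sum_mod (components Z))"
    for p and Z :: "('k, 'g \<Rightarrow>\<^sub>0 'k, 'v) ydmod"
  proof (rule yd_eqI[OF Z])
    have "p 0 \<in> car (hcomp Z 0)" using p by (simp add: car_sum_mod)
    then show "p 0 \<in> car Z" "gr Z g (assemble Z p) = gr Z g (p 0)" for g
      using assemble(2)[OF Z p, of 0] trivial[of g] by (simp_all add: hcomp_simps(1))
  qed (rule assemble(1)[OF Z p])
  have "assemble X = assemble Y"
    by (rule extensionalityI[of _ "car (sum_mod (components X))"])
      (use a[OF X] a[OF Y] eq in \<open>simp_all add: assemble_def\<close>)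
  then show "X = Y" using direct_sum_components[OF X] direct_sum_components[OF Y] eq by metis
qed

text \<open>
  Renaming the elements of the homogeneous components leaves room to record the map
  \<^term>\<open>assemble X\<close>, that is, the elements of \<open>X\<close> that are not homogeneous.
\<close>

lemma ex_inj_isomorphic_functor:
  assumes universe: "\<exists>j :: ('g::group_add \<Rightarrow> 'v) \<Rightarrow> 'v. inj j"
  shows "\<exists>i. inj_on i {X :: ('k::field, 'g \<Rightarrow>\<^sub>0 'k, 'v) ydmod. yd_module group_hopf X} \<and>
    (\<forall>X. yd_module group_hopf X \<longrightarrow> kmod_functor (i X) \<and>
      isomorphic_objects kmod_functor_category (components X) (i X))"
proof (cases "\<forall>g :: 'g. g = 0")
  case True
  then have "inj_on components {X :: ('k, 'g \<Rightarrow>\<^sub>0 'k, 'v) ydmod. yd_module group_hopf X}"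
    by (intro inj_on_components_trivial_group) blast
  then show ?thesis
    by (intro exI[of _ components])
      (simp add: kmod_functor_components isomorphic_objects_refl[OF is_category_kmod_functor_category])
next
  case False
  then obtain b :: 'g where b: "b \<noteq> 0" by blast
  obtain J :: "('g \<Rightarrow> 'v) \<Rightarrow> 'v" where J: "inj J" using universe by blast
  \<comment> \<open>A pairing on 'v: a function taking one value at 0 and another at
    \<open>b\<close> remembers both, and \<open>J\<close> codes it as one element.\<close>
  define c where "c x y = J (\<lambda>g. if g = 0 then x else y)" for x y
  have c: "x = x' \<and> y = y'" if "c x y = c x' y'" for x y x' y'
    using injD[OF J, OF that[unfolded c_def]] b by (metis (full_types))
  \<comment> \<open>The first projection of the pairing. It does not depend on X, so it decodes the
    renamed components of every module alike.\<close>
  define c1 where "c1 z = (SOME x. \<exists>y. z = c x y)" for z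
  have c1: "c1 (c x y) = x" for x y
    unfolding c1_def by (rule some_equality) (use c in blast)+
  \<comment> \<open>The homogeneous elements tagged by their degree: the slots in which names can be
    recorded.\<close>
  define A :: "('k, 'g, 'v) kmod_func \<Rightarrow> _"
    where "A F = (SIGMA g:UNIV. car (fob F g))" for F
  have "\<exists>\<Theta> :: (('g \<Rightarrow> 'v) \<Rightarrow> 'v) \<Rightarrow> 'g \<times> 'v \<Rightarrow> 'v. \<forall>s s'. (\<forall>a\<in>A F. \<Theta> s a = \<Theta> s' a) \<longrightarrow>
      (\<forall>p\<in>car (sum_mod F). s p = s' p)" if "kmod_functor F" for F
  proof -
    have "(0, vzero (fob F 0)) \<in> A F" using fob_kmodule[OF that] by (simp add: A_def)
    then have "A F \<noteq> {}" by blast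
    moreover obtain f where "inj_on f (car (sum_mod F))" "f ` car (sum_mod F) \<subseteq> Fpow (A F)"
      using sum_mod_Fpow[of F] by (auto simp: A_def)
    ultimately show ?thesis by - (rule encode_families[of c "A F" f], rule c, assumption+)
  qed
  then obtain \<Theta> :: "_ \<Rightarrow> (('g \<Rightarrow> 'v) \<Rightarrow> 'v) \<Rightarrow> 'g \<times> 'v \<Rightarrow> 'v"
    where \<Theta>: "\<And>F s s'. kmod_functor F \<Longrightarrow> (\<And>a. a \<in> A F \<Longrightarrow> \<Theta> F s a = \<Theta> F s' a) \<Longrightarrow>
      (\<forall>p\<in>car (sum_mod F). s p = s' p)"
    by metis
  \<comment> \<open>The first entry makes the renaming reversible; the second is the part of the
    code of \<open>assemble X\<close> kept in the slot \<open>(g, x)\<close>.\<close>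
  define \<psi> where "\<psi> X g x = c x (\<Theta> (components X) (assemble X) (g, x))"
    for X :: "('k, 'g \<Rightarrow>\<^sub>0 'k, 'v) ydmod" and g x
  have \<psi>: "inj_on (\<psi> X g) (car (fob (components X) g))" for X g
    by (rule inj_on_inverseI[of _ c1]) (simp add: \<psi>_def c1)
  have "inj_on (\<lambda>X. rename_functor (components X) (\<psi> X)) {X. yd_module group_hopf X}"
  proof (rule inj_onI)
    fix X Y :: "('k, 'g \<Rightarrow>\<^sub>0 'k, 'v) ydmod"
    assume "X \<in> {X. yd_module group_hopf X}" "Y \<in> {X. yd_module group_hopf X}"
      and eq: "rename_functor (components X) (\<psi> X) = rename_functor (components Y) (\<psi> Y)"
    then have X: "yd_module group_hopf X" and Y: "yd_module group_hopf Y" by auto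
    note K = kmod_functor_components[OF X]
    have "rename_functor (rename_functor (components Z) (\<psi> Z)) (\<lambda>_. c1) = components Z"
      if "yd_module group_hopf Z" for Z :: "('k, 'g \<Rightarrow>\<^sub>0 'k, 'v) ydmod"
      by (rule rename_functor_inverse[OF kmod_functor_components[OF that]]) (simp add: \<psi>_def c1)
    from this[OF X] this[OF Y] eq have XY: "components X = components Y" by simp
    have "\<Theta> (components X) (assemble X) a = \<Theta> (components X) (assemble Y) a"
      if a: "a \<in> A (components X)" for a
    proof -
      obtain g x where gx: "a = (g, x)" "x \<in> car (hcomp X g)" using a by (auto simp: A_def)
      \<comment> \<open>Equal renamed functors have equal carriers in degree \<open>g\<close>, so
        the new name of \<open>x\<close> for X is also a new name for Y. Injectivity of the pairing
        then matches the recorded entries.\<close>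
      have "car (fob (rename_functor (components X) (\<psi> X)) g) = car (fob (rename_functor (components Y) (\<psi> Y)) g)"
        by (simp only: eq)
      then have "\<psi> X g ` car (hcomp X g) = \<psi> Y g ` car (hcomp Y g)" by simp
      with gx obtain x' where "\<psi> X g x = \<psi> Y g x'" by blast
      then have "x = x' \<and> \<Theta> (components X) (assemble X) (g, x) = \<Theta> (components Y) (assemble Y) (g, x')"
        unfolding \<psi>_def by (rule c)
      then show ?thesis using gx(1) XY by auto
    qed
    then have "\<forall>p\<in>car (sum_mod (components X)). assemble X p = assemble Y p"
      by (rule \<Theta>[OF K])
    then have "assemble X = assemble Y"
      by (intro extensionalityI[of _ "car (sum_mod (components X))"]) (auto simp: assemble_def XY)
    then show "X = Y" using direct_sum_components[OF X] direct_sum_components[OF Y] XY by metis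
  qed
  then show ?thesis
    by (intro exI[of _ "\<lambda>X. rename_functor (components X) (\<psi> X)"])
      (simp add: kmod_functor_rename_functor[OF kmod_functor_components \<psi>]
        isomorphic_objects_rename_functor[OF kmod_functor_components \<psi>])
qed

text \<open>An element is decoded by inverting \<open>J\<close> and evaluating at \<open>g\<close>,
  with no reference to \<open>F\<close>. Hence the first equation exhibits a left inverse of the
  object map taking \<open>F\<close> to \<open>direct_sum F J\<close>.\<close>

lemma components_direct_sum:
  fixes F :: "('k::field, 'g::group_add, 'v) kmod_func"
  assumes F: "kmod_functor F" and J: "inj J"
  shows "rename_functor (components (direct_sum F J)) (\<lambda>g x. inv_into UNIV J x g) = F"
    and "isomorphic_objects kmod_functor_category (components (direct_sum F J)) F"
proof -
  have s: "inj_on J (car (sum_mod F))" using J by (rule inj_on_subset) simp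
  have m: "inv_into UNIV J (J p) g = p g" for p g using J by simp
  show rename_functor: "rename_functor (components (direct_sum F J)) (\<lambda>g x. inv_into UNIV J x g) = F"
    by (rule rename_components_direct_sum(1)[OF F s m])
  have "inj_on (\<lambda>x. inv_into UNIV J x g) (car (fob (components (direct_sum F J)) g))" for g
    using rename_components_direct_sum(2)[OF F s, of "\<lambda>g x. inv_into UNIV J x g" g] m by simp
  then show "isomorphic_objects kmod_functor_category (components (direct_sum F J)) F"
    using isomorphic_objects_rename_functor[OF kmod_functor_components[OF yd_module_direct_sum[OF F s]],
        of "\<lambda>g x. inv_into UNIV J x g"] rename_functor by simp
qed

theorem proposition2p2:
  assumes universe: "\<exists>j :: ('g::group_add \<Rightarrow> 'v) \<Rightarrow> 'v. inj j"
  shows "isomorphic_categories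
    (yd_category (group_hopf :: ('k::field, 'g \<Rightarrow>\<^sub>0 'k) hopf)
      :: (('k, 'g \<Rightarrow>\<^sub>0 'k, 'v) ydmod, _) category)
    (functor_category (conj_groupoid :: ('g, 'g \<times> 'g) category)
      (kmod_category :: (('k, 'v) kmod, _) category))"
proof -
  obtain J :: "('g \<Rightarrow> 'v) \<Rightarrow> 'v" where J: "inj J" using universe by blast
  obtain i where i: "inj_on i {X :: ('k, 'g \<Rightarrow>\<^sub>0 'k, 'v) ydmod. yd_module group_hopf X}"
    "\<And>X. yd_module group_hopf X \<Longrightarrow> kmod_functor (i X) \<and>
      isomorphic_objects kmod_functor_category (components X) (i X)"
    using ex_inj_isomorphic_functor[OF universe] by blast
  have yd_direct_sum: "yd_module group_hopf (direct_sum F J)" if "kmod_functor F"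
    for F :: "('k, 'g, 'v) kmod_func"
    using that J by (intro yd_module_direct_sum) (auto intro: inj_on_subset)
  show ?thesis
  proof (rule isomorphic_categoriesI[OF is_category_yd_category is_category_kmod_functor_category
        is_functor_components, where i = i])
    fix f f' :: "('k, 'g \<Rightarrow>\<^sub>0 'k, 'v) ydmod \<times> ('v \<Rightarrow> 'v) \<times> ('k, 'g \<Rightarrow>\<^sub>0 'k, 'v) ydmod"
    assume "f \<in> arr kG_yd_category" "f' \<in> arr kG_yd_category"
      "dom kG_yd_category f = dom kG_yd_category f'" "cod kG_yd_category f = cod kG_yd_category f'"
      "farr components_functor f = farr components_functor f'"
    then show "f = f'"
      by (cases f; cases f') (auto simp: kG_yd_category_simps components_functor_def intro: hmap_faithful)
  next
    fix X Y :: "('k, 'g \<Rightarrow>\<^sub>0 'k, 'v) ydmod"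
      and n :: "('k, 'g, 'v) kmod_func \<times>
        ('g \<Rightarrow> ('k, 'v) kmod \<times> ('v \<Rightarrow> 'v) \<times> ('k, 'v) kmod) \<times>
        ('k, 'g, 'v) kmod_func"
    assume X: "X \<in> ob kG_yd_category" and Y: "Y \<in> ob kG_yd_category"
      and n: "n \<in> arr kmod_functor_category" "dom kmod_functor_category n = fob components_functor X"
      "cod kmod_functor_category n = fob components_functor Y"
    then obtain \<eta> where \<eta>: "n = (components X, \<eta>, components Y)"
      "is_nat_trans conj_groupoid kmod_category (components X) \<eta> (components Y)"
      by (cases n) (auto simp: functor_category_def components_functor_def)
    then obtain f where "yd_morphism group_hopf X Y f" "hmap X f Y = \<eta>"
      using hmap_full[OF _ _ \<eta>(2)] X Y by (auto simp: kG_yd_category_simps)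
    then show "\<exists>f\<in>arr kG_yd_category. dom kG_yd_category f = X \<and> cod kG_yd_category f = Y \<and>
        farr components_functor f = n"
      using X Y \<eta>(1)
      by (intro bexI[of _ "(X, f, Y)"]) (auto simp: kG_yd_category_simps components_functor_def)
  next
    show "inj_on (\<lambda>F. direct_sum F J) (ob kmod_functor_category)"
      by (rule inj_on_inverseI[of _ "\<lambda>X. rename_functor (components X) (\<lambda>g x. inv_into UNIV J x g)"])
        (simp add: components_direct_sum(1)[OF _ J])
  qed (simp_all add: kG_yd_category_simps components_functor_def components_direct_sum(2)[OF _ J] i yd_direct_sum)
qed

end
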